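(* For every choice of positive integers $U$ and $n_t$, the family $\mathfrak{C}_{U,n_t}$ is non-empty; that is, there exist suitable data $(K,L,p,\sigma)$ for $(U,n_t)$ and an integer $k>\frac{U(n_t-1)}{2}$, and hence a code $C_{U,n_t}(L/K,p,\sigma,k)$.
   Context: Let $U,n_t$ be positive integers. All fields are subfields of $\mathbb{C}$, and $\mathcal{O}_E$ denotes the ring of integers of a number field $E$. Suitable data: $K$ is an imaginary quadratic extension of $\mathbb{Q}$ with class number $1$; $L/K$ is a cyclic Galois extension of degree $Un_t$ such that $L=K(\alpha)$ for some $\alpha\in\mathbb{R}$; $\sigma$ is a generator of $\mathrm{Gal}(L/K)$; $p\in\mathcal{O}_K$ is a prime that is inert in $L/K$ (i.e. $p\mathcal{O}_K$ is a nonzero prime ideal and $p\mathcal{O}_L$ is again prime). Put $\tau=\sigma^U$. For $x_1,\dots,x_{n_t}\in\mathcal{O}_L$ let $M(x_1,\dots,x_{n_t})$ be the $n_t\times n_t$ matrix whose $(i,j)$ entry is $\tau^{j-1}(x_{i-j+1})$ if $i\ge j$ and $p\,\tau^{j-1}(x_{i-j+1+n_t})$ if $i<j$. Automorphisms are applied to matrices entrywise. Let $k$ be an integer with $k>\frac{U(n_t-1)}{2}$. The code $C_{U,n_t}(L/K,p,\sigma,k)$ is the set of all $Un_t\times Un_t$ matrices $A$ consisting of $U\times U$ blocks of size $n_t\times n_t$, where the $(j,l)$ block is $\sigma^{l-1}(M_j)$ if $l\ne j$ and $p^{-k}\sigma^{j-1}(M_j)$ if $l=j$, with $M_j=M(x_{j,1},\dots,x_{j,n_t})$,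 $x_{j,h}\in\mathcal{O}_L$, and for each $j=1,\dots,U$ at least one $x_{j,h}\neq0$. $\mathfrak{C}_{U,n_t}$ is the family of all codes $C_{U,n_t}(L/K,p,\sigma,k)$ obtained from any suitable $(K,L,p,\sigma)$ and any integer $k>\frac{U(n_t-1)}{2}$. *)

theory Defs
  imports
    Complex_Main
    "HOL-Computational_Algebra.Polynomial"
    "HOL-Algebra.Algebra"
    "HOL-Algebra.Bij"
    "HOL-Algebra.Embedded_Algebras"
    "Jordan_Normal_Form.Matrix"
    "Jordan_Normal_Form.VS_Connect"
begin

text \<open>
  All fields are subfields of the complex numbers. They are carrier sets of type
  \<^typ>\<open>complex set\<close> inside the ring record \<open>CC\<close>, to which the notions of HOL-Algebra apply.
\<close>

abbreviation CC :: "complex ring" where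
  "CC \<equiv> class_ring"

definition field_ext :: "complex set \<Rightarrow> complex set \<Rightarrow> nat \<Rightarrow> bool" where
  "field_ext L K n \<longleftrightarrow>
     subfield K CC \<and> subfield L CC \<and> K \<subseteq> L \<and> ring.dimension CC n K L"

definition int_ring_of :: "complex set \<Rightarrow> complex ring" where
  "int_ring_of E = CC\<lparr>carrier := {x \<in> E. algebraic_int x}\<rparr>"

definition nonzero_ideals :: "complex set \<Rightarrow> complex set set" where
  "nonzero_ideals E = {I. ideal I (int_ring_of E) \<and> I \<noteq> {0}}"

definition ideal_class_rel :: "complex set \<Rightarrow> (complex set \<times> complex set) set" where
  "ideal_class_rel E =
     {(I, J). I \<in> nonzero_ideals E \<and> J \<in> nonzero_ideals E \<and>
        (\<exists>a \<in> carrier (int_ring_of E) - {0}. \<exists>b \<in> carrier (int_ring_of E) - {0}.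
           (\<lambda>x. a * x) ` I = (\<lambda>x. b * x) ` J)}"

definition class_number :: "complex set \<Rightarrow> nat" where
  "class_number E = card (nonzero_ideals E // ideal_class_rel E)"

definition imaginary_quadratic :: "complex set \<Rightarrow> bool" where
  "imaginary_quadratic K \<longleftrightarrow> field_ext K \<rat> 2 \<and> \<not> K \<subseteq> \<real>"

text \<open>
  The elements of \<open>Gal L K\<close> are extensional functions: they are \<^const>\<open>undefined\<close> outside
  \<open>L\<close>, so that a field automorphism of \<open>L\<close> is represented by exactly one function.
\<close>

definition Gal :: "complex set \<Rightarrow> complex set \<Rightarrow> (complex \<Rightarrow> complex) monoid" where
  "Gal L K = (BijGroup L)\<lparr>carrier :=
     {f \<in> Bij L. f \<in> Ring.ring_hom (CC\<lparr>carrier := L\<rparr>) (CC\<lparr>carrier := L\<rparr>) \<and> (\<forall>x \<in> K. f x = x)}\<rparr>"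

definition galois_ext :: "complex set \<Rightarrow> complex set \<Rightarrow> nat \<Rightarrow> bool" where
  "galois_ext L K n \<longleftrightarrow>
     field_ext L K n \<and> {x \<in> L. \<forall>f \<in> carrier (Gal L K). f x = x} = K"

definition inert_prime :: "complex set \<Rightarrow> complex set \<Rightarrow> complex \<Rightarrow> bool" where
  "inert_prime L K p \<longleftrightarrow>
     p \<in> carrier (int_ring_of K) \<and> p \<noteq> 0 \<and>
     primeideal (PIdl\<^bsub>int_ring_of K\<^esub> p) (int_ring_of K) \<and>
     primeideal (PIdl\<^bsub>int_ring_of L\<^esub> p) (int_ring_of L)"

text \<open>
  That \<open>Gal L K\<close> is cyclic is the existence of the generator \<open>\<sigma>\<close>.
\<close>

definition suitable_data ::
  "nat \<Rightarrow> nat \<Rightarrow> complex set \<Rightarrow> complex set \<Rightarrow> complex \<Rightarrow> (complex \<Rightarrow> complex) \<Rightarrow> bool" where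
  "suitable_data U nt K L p \<sigma> \<longleftrightarrow>
     imaginary_quadratic K \<and> class_number K = 1 \<and>
     galois_ext L K (U * nt) \<and>
     (\<exists>\<alpha> \<in> \<real>. L = generate_field CC (insert \<alpha> K)) \<and>
     \<sigma> \<in> carrier (Gal L K) \<and> carrier (Gal L K) = generate (Gal L K) {\<sigma>} \<and>
     inert_prime L K p"

text \<open>
  Matrix and block indices start at 0, and so do the sequences of integers:
  \<open>x h\<close> below is $x_{h+1}$, and \<open>x j h\<close> is $x_{j+1,h+1}$.
\<close>

definition cyclic_mat ::
  "nat \<Rightarrow> (complex \<Rightarrow> complex) \<Rightarrow> complex \<Rightarrow> (nat \<Rightarrow> complex) \<Rightarrow> complex mat" where
  "cyclic_mat nt \<tau> p x = mat nt nt (\<lambda>(i, j).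
     if j \<le> i then (\<tau> ^^ j) (x (i - j)) else p * (\<tau> ^^ j) (x (i + nt - j)))"

definition code_mat ::
  "nat \<Rightarrow> nat \<Rightarrow> complex \<Rightarrow> (complex \<Rightarrow> complex) \<Rightarrow> int \<Rightarrow> (nat \<Rightarrow> nat \<Rightarrow> complex) \<Rightarrow> complex mat" where
  "code_mat U nt p \<sigma> k x = mat (U * nt) (U * nt) (\<lambda>(r, c).
     let j = r div nt; l = c div nt;
         M = cyclic_mat nt (\<sigma> ^^ U) p (x j);
         B = (if l = j then (p powi (- k)) \<cdot>\<^sub>m map_mat (\<sigma> ^^ j) M else map_mat (\<sigma> ^^ l) M)
     in B $$ (r mod nt, c mod nt))"

definition code ::
  "nat \<Rightarrow> nat \<Rightarrow> complex set \<Rightarrow> complex \<Rightarrow> (complex \<Rightarrow> complex) \<Rightarrow> int \<Rightarrow> complex mat set" where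
  "code U nt L p \<sigma> k = {code_mat U nt p \<sigma> k x | x.
     (\<forall>j < U. \<forall>h < nt. x j h \<in> carrier (int_ring_of L)) \<and> (\<forall>j < U. \<exists>h < nt. x j h \<noteq> 0)}"

definition code_family :: "nat \<Rightarrow> nat \<Rightarrow> complex mat set set" where
  "code_family U nt = {code U nt L p \<sigma> k | K L p \<sigma> k.
     suitable_data U nt K L p \<sigma> \<and> real_of_int k > real U * (real nt - 1) / 2}"

end

(*
Everything is built from K = Q(i). Let n = U * nt and let l be a prime with l = 1 mod 4 n. It splits
in K, as l = p * q, and it splits completely in the n-th cyclotomic field.

Suppose that algebraic integers \<alpha> 0, ..., \<alpha> (n - 1), indexed cyclically, multiply with rational structure
constants that are invariant under the shift of indices, have a dual family up to a factor d prime to l,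
and satisfy the Frobenius congruence \<alpha> j ^ l = \<alpha> (j + 1) mod l. A relation between them with coefficients in Z[i]
can be raised to the powers l, l^2, ... modulo p, which turns it into all its shifts; the dual family then
makes all the coefficients divisible by p, and infinite descent makes them 0. Hence the \<alpha> j are a basis of a
field L of degree n over K, on which the shift is an automorphism \<sigma> that generates Gal(L/K) and is congruent
to x \<mapsto> x ^ l modulo p. If p divides x y, then it divides the norm of x, say, which is congruent to x ^ m
with m = 1 + l + ... + l^(n-1), and as x is congruent to x ^ (l^n) it divides x: so p is inert.

Such a family comes from Kummer theory, without Dirichlet's theorem on primes. Take conjugate elements
\<beta> s of the n-th cyclotomic field, s a unit modulo n, such that modulo a fixed prime over l one of them is a
primitive root and all the others are 1. With n-th roots b s of \<beta> s, put
\<omega> t = \<Prod> b s ^ (t s mod n) and let \<alpha> j = \<Sum> \<zeta> ^ (j t) \<omega> t. Then \<omega> t ^ (l - 1) is congruent to \<zeta> ^ t modulo l, which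
is the Frobenius congruence, and the exponents are chosen so that the structure constants are fixed by
the Galois group of the cyclotomic field and the \<alpha> j by complex conjugation.
*)

theory Submission
  imports Defs "Jordan_Normal_Form.Char_Poly" "HOL-Number_Theory.Number_Theory"
begin

text \<open>Frobenius is written down here rather than found. The residue field of Z[i] at
  \<open>p\<close> has \<open>l\<close> elements, so \<open>x \<mapsto> x ^ l\<close> fixes Gaussian
  coefficients modulo \<open>p\<close> and acts on a combination of the \<alpha> j by shifting them.
  Since \<open>d\<close> is prime to \<open>l\<close>, and \<open>d\<close> times an integer of
  \<open>L\<close> has Gaussian integers as coordinates, congruences proved for such combinations
  reach every integer of \<open>L\<close>. The exponents of the \<open>b s\<close> come from Galois
  descent. Under \<zeta> \<mapsto> \<zeta> ^ w the element \<beta> s goes to \<beta> (s / w), so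
  that formally \<omega> t goes to \<omega> (w t). It transforms exactly as \<zeta> ^ t does, and
  \<alpha> j stays fixed. The residues 1 leave a single factor of \<omega> t ^ (l - 1) visible at
  each prime over \<open>l\<close>; the primitive root makes that factor a power of \<zeta> of the
  right order, so that Frobenius has order \<open>n\<close>.\<close>

hide_const (open) Divisibility.prime

section \<open>Algebraic integers and congruences\<close>

text \<open>Multiplication by \<open>x\<close> on the generators in \<open>S\<close> is given by an
  integer matrix. The vector of the elements of \<open>S\<close>, nonzero because of
  \<open>s0\<close>, is an eigenvector for \<open>x\<close>, and the characteristic polynomial of
  the matrix is monic with integer coefficients.\<close>

lemma algebraic_int_if_stabilizes_lattice:
  fixes x :: complex
  assumes fin: "finite S" and s0: "s0 \<in> S" "s0 \<noteq> 0"
    and stab: "\<And>s. s \<in> S \<Longrightarrow> \<exists>c :: complex \<Rightarrow> int. x * s = (\<Sum>t\<in>S. of_int (c t) * t)"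
  shows "algebraic_int x"
proof -
  obtain C :: "complex \<Rightarrow> complex \<Rightarrow> int"
    where C: "\<And>s. s \<in> S \<Longrightarrow> x * s = (\<Sum>t\<in>S. of_int (C s t) * t)"
    using stab by metis
  obtain xs where xs: "set xs = S" "List.distinct xs"
    using finite_distinct_list[OF fin] by blast
  define n where "n = length xs"
  define A :: "int mat" where "A = mat n n (\<lambda>(i, j). C (xs ! i) (xs ! j))"
  define A' :: "complex mat" where "A' = map_mat of_int A"
  define v where "v = vec n (\<lambda>i. xs ! i)"
  have A: "A \<in> carrier_mat n n" and A': "A' \<in> carrier_mat n n"
    by (auto simp: A_def A'_def)
  have sum_xs: "(\<Sum>t\<in>S. f t) = (\<Sum>j = 0..<n. f (xs ! j))" for f :: "complex \<Rightarrow> complex"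
  proof -
    have "(\<Sum>t\<in>S. f t) = (\<Sum>t\<leftarrow>xs. f t)"
      using xs by (metis sum.distinct_set_conv_list)
    also have "\<dots> = (\<Sum>j = 0..<n. f (xs ! j))"
      by (simp add: sum_list_sum_nth n_def)
    finally show ?thesis .
  qed
  have "A' *\<^sub>v v = x \<cdot>\<^sub>v v"
  proof
    show "dim_vec (A' *\<^sub>v v) = dim_vec (x \<cdot>\<^sub>v v)"
      by (simp add: A'_def A_def v_def)
  next
    fix i assume "i < dim_vec (x \<cdot>\<^sub>v v)"
    then have i: "i < n" by (simp add: v_def)
    then have "xs ! i \<in> S" using xs by (auto simp: n_def)
    then have "x * xs ! i = (\<Sum>j = 0..<n. of_int (C (xs ! i) (xs ! j)) * xs ! j)"
      using C sum_xs by simp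
    then show "(A' *\<^sub>v v) $ i = (x \<cdot>\<^sub>v v) $ i"
      using i by (simp add: A'_def A_def v_def scalar_prod_def)
  qed
  moreover have "v \<noteq> 0\<^sub>v n"
  proof
    assume v0: "v = 0\<^sub>v n"
    obtain i where i: "i < n" "xs ! i = s0"
      using s0 xs by (metis in_set_conv_nth n_def)
    have "v $ i = 0" using v0 i by simp
    then show False using i s0 by (simp add: v_def)
  qed
  moreover have "v \<in> carrier_vec n" by (simp add: v_def)
  ultimately have "eigenvalue A' x"
    using A' by (auto simp: eigenvalue_def eigenvector_def)
  then have root: "poly (char_poly A') x = 0"
    using eigenvalue_root_char_poly[OF A'] by simp
  have "char_poly A' = map_poly of_int (char_poly A)"
    unfolding A'_def using of_int_hom.char_poly_hom[OF A] by simp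
  moreover have "lead_coeff (char_poly A) = 1"
    using degree_monic_char_poly[OF A] by simp
  ultimately show ?thesis
    using root algebraic_int_altdef_ipoly by metis
qed

text \<open>The monic equation solved for its top power, the form in which it reduces
  monomials.\<close>

lemma algebraic_int_power_in_span:
  fixes x :: complex
  assumes "algebraic_int x"
  obtains m and a :: "nat \<Rightarrow> int" where "m > 0" "x ^ m = (\<Sum>i<m. of_int (a i) * x ^ i)"
proof -
  obtain p :: "int poly" where p: "poly (map_poly of_int p) x = 0" "lead_coeff p = 1"
    using assms algebraic_int_altdef_ipoly by blast
  define m where "m = degree p"
  have "m > 0"
  proof (rule ccontr)
    assume "\<not> m > 0"
    then obtain c where "p = [:c:]" by (metis degree_eq_zeroE m_def gr0I)
    then have "p = 1" using p(2) by simp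
    then show False using p(1) by simp
  qed
  have m1: "coeff p m = 1" using p(2) by (simp add: m_def)
  have "0 = (\<Sum>i\<le>m. of_int (coeff p i) * x ^ i)"
    using p(1) by (simp add: poly_altdef degree_map_poly m_def coeff_map_poly)
  also have "\<dots> = (\<Sum>i<m. of_int (coeff p i) * x ^ i) + x ^ m"
    unfolding lessThan_Suc_atMost[symmetric] by (simp add: m1)
  finally have "x ^ m = - (\<Sum>i<m. of_int (coeff p i) * x ^ i)"
    by (metis add_eq_0_iff)
  also have "\<dots> = (\<Sum>i<m. of_int (- coeff p i) * x ^ i)"
    by (simp add: sum_negf)
  finally have "x ^ m = (\<Sum>i<m. of_int (- coeff p i) * x ^ i)" .
  with \<open>m > 0\<close> show ?thesis by (rule that)
qed

text \<open>The lattice \<open>M\<close> spanned by the monomials \<open>x ^ i * y ^ j\<close> of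
  bounded exponents is stable under \<open>x\<close> and \<open>y\<close>, hence under their sum and
  product. \<open>S\<close> collects the values of the monomials, so coincidences between them do no
  harm.\<close>

lemma algebraic_int_add_times:
  fixes x y :: complex
  assumes x: "algebraic_int x" and y: "algebraic_int y"
  shows algebraic_int_add: "algebraic_int (x + y)"
    and algebraic_int_times: "algebraic_int (x * y)"
proof -
  obtain m a where m: "m > 0" and xm: "x ^ m = (\<Sum>i<m. of_int (a i) * x ^ i)"
    using algebraic_int_power_in_span[OF x] by metis
  obtain k b where k: "k > 0" and yk: "y ^ k = (\<Sum>i<k. of_int (b i) * y ^ i)"
    using algebraic_int_power_in_span[OF y] by metis
  define S where "S = (\<lambda>(i, j). x ^ i * y ^ j) ` ({..<m} \<times> {..<k})"
  define M where "M = {(\<Sum>t\<in>S. of_int (c t) * t) | c :: complex \<Rightarrow> int. True}"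
  have fin: "finite S" by (simp add: S_def)
  have M0: "0 \<in> M" unfolding M_def by (auto intro!: exI[of _ "\<lambda>_. 0"])
  have Madd: "u + w \<in> M" if uw: "u \<in> M" "w \<in> M" for u w
  proof -
    obtain c c' where "u = (\<Sum>t\<in>S. of_int (c t) * t)" "w = (\<Sum>t\<in>S. of_int (c' t) * t)"
      using uw by (auto simp: M_def)
    then have "u + w = (\<Sum>t\<in>S. of_int (c t + c' t) * t)"
      by (simp add: sum.distrib ring_distribs)
    then show ?thesis by (subst M_def) (rule CollectI, rule exI[of _ "\<lambda>t. c t + c' t"], simp)
  qed
  have Mscale: "of_int e * u \<in> M" if u: "u \<in> M" for u and e :: int
  proof -
    obtain c where "u = (\<Sum>t\<in>S. of_int (c t) * t)"
      using u by (auto simp: M_def)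
    then have "of_int e * u = (\<Sum>t\<in>S. of_int (e * c t) * t)"
      by (simp add: sum_distrib_left mult.assoc)
    then show ?thesis by (subst M_def) (rule CollectI, rule exI[of _ "\<lambda>t. e * c t"], simp)
  qed
  have Msum: "(\<Sum>t\<in>T. f t) \<in> M" if "\<And>t. t \<in> T \<Longrightarrow> f t \<in> M"
    for T and f :: "'z \<Rightarrow> complex"
    using that by (induction T rule: infinite_finite_induct) (auto intro: M0 Madd)
  have SM: "s \<in> M" if s: "s \<in> S" for s
  proof -
    have "(\<Sum>t\<in>S. of_int (if t = s then 1 else 0) * t) = (\<Sum>t\<in>S. if t = s then t else 0)"
      by (rule sum.cong) auto
    also have "\<dots> = s" using s fin by simp
    finally have "s = (\<Sum>t\<in>S. of_int (if t = s then 1 else 0) * t)" by (rule sym)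
    then show ?thesis
      by (subst M_def) (rule CollectI, rule exI[of _ "\<lambda>t. if t = s then 1 else 0"], simp)
  qed
  have mon: "x ^ i * y ^ j \<in> M" if "i < m" "j < k" for i j
    using that by (intro SM) (auto simp: S_def)
  have xS: "x * s \<in> M" if s: "s \<in> S" for s
  proof -
    obtain i j where ij: "i < m" "j < k" "s = x ^ i * y ^ j" using s by (auto simp: S_def)
    show ?thesis
    proof (cases "Suc i < m")
      case True
      then show ?thesis using mon[of "Suc i" j] ij by (simp add: mult.assoc)
    next
      case False
      then have "x * s = x ^ m * y ^ j" using ij
        by (metis Suc_lessI mult.assoc power_Suc)
      also have "\<dots> = (\<Sum>i<m. of_int (a i) * (x ^ i * y ^ j))"
        by (simp add: xm sum_distrib_right mult.assoc)
      also have "\<dots> \<in> M" using ij by (intro Msum Mscale mon) auto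
      finally show ?thesis .
    qed
  qed
  have yS: "y * s \<in> M" if s: "s \<in> S" for s
  proof -
    obtain i j where ij: "i < m" "j < k" "s = x ^ i * y ^ j" using s by (auto simp: S_def)
    show ?thesis
    proof (cases "Suc j < k")
      case True
      then show ?thesis using mon[of i "Suc j"] ij by (simp add: mult_ac)
    next
      case False
      then have "Suc j = k" using ij by simp
      then have "y * s = x ^ i * y ^ k" using ij by (simp add: mult_ac flip: \<open>Suc j = k\<close>)
      also have "\<dots> = (\<Sum>j<k. of_int (b j) * (x ^ i * y ^ j))"
        by (simp add: yk sum_distrib_left mult_ac)
      also have "\<dots> \<in> M" using ij by (intro Msum Mscale mon) auto
      finally show ?thesis .
    qed
  qed
  have xM: "x * u \<in> M" if u: "u \<in> M" for u
  proof -
    obtain c where "u = (\<Sum>t\<in>S. of_int (c t) * t)" using u by (auto simp: M_def)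
    then have "x * u = (\<Sum>t\<in>S. of_int (c t) * (x * t))"
      by (simp add: sum_distrib_left mult_ac)
    also have "\<dots> \<in> M" by (intro Msum Mscale xS)
    finally show ?thesis .
  qed
  have "1 \<in> S" unfolding S_def using m k by (intro image_eqI[of _ _ "(0, 0)"]) auto
  have algI: "algebraic_int z" if z: "\<And>s. s \<in> S \<Longrightarrow> z * s \<in> M" for z
    by (rule algebraic_int_if_stabilizes_lattice[OF fin \<open>1 \<in> S\<close>]) (use z in \<open>auto simp: M_def\<close>)
  show "algebraic_int (x + y)"
    by (rule algI) (auto simp: distrib_right intro!: Madd xS yS)
  show "algebraic_int (x * y)"
    by (rule algI) (auto simp: mult.assoc intro!: xM yS)
qed

lemma algebraic_int_diff:
  fixes x y :: complex
  shows "algebraic_int x \<Longrightarrow> algebraic_int y \<Longrightarrow> algebraic_int (x - y)"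
  using algebraic_int_add[of x "- y"] by simp

lemma algebraic_int_sum:
  fixes f :: "'b \<Rightarrow> complex"
  shows "(\<And>x. x \<in> A \<Longrightarrow> algebraic_int (f x)) \<Longrightarrow> algebraic_int (sum f A)"
  by (induction A rule: infinite_finite_induct) (auto intro: algebraic_int_add)

lemma algebraic_int_prod:
  fixes f :: "'b \<Rightarrow> complex"
  shows "(\<And>x. x \<in> A \<Longrightarrow> algebraic_int (f x)) \<Longrightarrow> algebraic_int (prod f A)"
  by (induction A rule: infinite_finite_induct) (auto intro: algebraic_int_times)

lemma algebraic_int_power:
  fixes x :: complex
  shows "algebraic_int x \<Longrightarrow> algebraic_int (x ^ k)"
  by (induction k) (auto intro: algebraic_int_times)

section \<open>Congruences between complex numbers\<close>

text \<open>The quotient is tested in the ring of all algebraic integers. This fixes no number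
  field, so the same relation serves the cyclotomic field, its Kummer extension and
  \<open>L\<close>.\<close>

definition int_cong :: "complex \<Rightarrow> complex \<Rightarrow> complex \<Rightarrow> bool" where
  "int_cong m x y \<longleftrightarrow> algebraic_int ((x - y) / m)"

lemma int_cong_refl [simp]: "int_cong m x x"
  by (simp add: int_cong_def)

lemma int_cong_sym: "int_cong m x y \<Longrightarrow> int_cong m y x"
  using algebraic_int_minus_iff[of "(x - y) / m"]
  by (simp add: int_cong_def minus_divide_left del: algebraic_int_minus_iff)

lemma int_cong_trans [trans]:
  assumes "int_cong m x y" "int_cong m y z"
  shows "int_cong m x z"
proof -
  have "(x - z) / m = (x - y) / m + (y - z) / m" by (simp add: diff_divide_distrib)
  then show ?thesis using assms by (simp add: int_cong_def algebraic_int_add)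
qed

lemma int_cong_add:
  assumes "int_cong m x y" "int_cong m x' y'"
  shows "int_cong m (x + x') (y + y')"
proof -
  have "(x + x' - (y + y')) / m = (x - y) / m + (x' - y') / m"
    by (simp add: diff_divide_distrib add_divide_distrib)
  then show ?thesis using assms by (simp add: int_cong_def algebraic_int_add)
qed

lemma int_cong_diff:
  assumes "int_cong m x y" "int_cong m x' y'"
  shows "int_cong m (x - x') (y - y')"
proof -
  have "(x - x' - (y - y')) / m = (x - y) / m - (x' - y') / m"
    by (simp add: diff_divide_distrib)
  then show ?thesis using assms by (simp add: int_cong_def algebraic_int_diff)
qed

lemma int_cong_mult:
  assumes "int_cong m x y" "int_cong m x' y'" "algebraic_int x'" "algebraic_int y"
  shows "int_cong m (x * x') (y * y')"
proof -
  have "(x * x' - y * y') / m = (x - y) / m * x' + y * ((x' - y') / m)"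
    by (simp add: algebra_simps diff_divide_distrib)
  moreover have "algebraic_int \<dots>"
    using assms unfolding int_cong_def by (intro algebraic_int_add algebraic_int_times)
  ultimately show ?thesis by (simp add: int_cong_def)
qed

lemma int_cong_mult_left:
  "int_cong m x y \<Longrightarrow> algebraic_int z \<Longrightarrow> int_cong m (z * x) (z * y)"
  using algebraic_int_times[of z "(x - y) / m"] by (simp add: int_cong_def algebra_simps)

lemma int_cong_sum:
  "(\<And>i. i \<in> A \<Longrightarrow> int_cong m (f i) (g i)) \<Longrightarrow> int_cong m (sum f A) (sum g A)"
  by (induction A rule: infinite_finite_induct) (auto intro: int_cong_add)

lemma int_cong_prod:
  assumes "\<And>i. i \<in> A \<Longrightarrow> int_cong m (f i) (g i)" "\<And>i. i \<in> A \<Longrightarrow> algebraic_int (f i)"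
    "\<And>i. i \<in> A \<Longrightarrow> algebraic_int (g i)"
  shows "int_cong m (prod f A) (prod g A)"
  using assms
  by (induction A rule: infinite_finite_induct) (auto intro!: int_cong_mult algebraic_int_prod)

lemma int_cong_power:
  assumes "int_cong m x y" "algebraic_int x" "algebraic_int y"
  shows "int_cong m (x ^ k) (y ^ k)"
  by (induction k) (use assms in \<open>auto intro!: int_cong_mult algebraic_int_power\<close>)

lemma int_cong_dvd_modulus:
  assumes "int_cong (m * k) x y" "algebraic_int k" "k \<noteq> 0"
  shows "int_cong m x y"
  using algebraic_int_times[OF assms(2), of "(x - y) / (m * k)"] assms
  by (simp add: int_cong_def)

lemma int_cong_0_mult:
  "int_cong m x 0 \<Longrightarrow> algebraic_int y \<Longrightarrow> int_cong m (y * x) 0"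
  using int_cong_mult_left[of m x 0 y] by simp

lemma int_cong_of_int:
  assumes "[a = b] (mod l)"
  shows "int_cong (of_int l) (of_int a) (of_int b)"
proof -
  obtain k where "a - b = l * k" using assms by (meson cong_iff_dvd_diff dvdE)
  then have "of_int a - of_int b = (of_int l * of_int k :: complex)"
    by (metis of_int_diff of_int_mult)
  then show ?thesis by (cases "l = 0") (auto simp: int_cong_def)
qed

lemma int_cong_of_nat:
  assumes "[a = b] (mod l)"
  shows "int_cong (of_nat l) (of_nat a) (of_nat b)"
  using int_cong_of_int[of "int a" "int b" "int l"] assms by (simp add: cong_int_iff)

text \<open>As \<open>l\<close> vanishes modulo \<open>m\<close>, Bezout makes \<open>d\<close>
  invertible modulo \<open>m\<close>.\<close>

lemma int_cong_cancel_coprime: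
  fixes d l :: int
  assumes "int_cong m (of_int d * x) 0" "int_cong m (of_int l) 0" "coprime d l" "algebraic_int x"
  shows "int_cong m x 0"
proof -
  obtain u v where uv: "u * d + v * l = 1"
    using assms(3) by (metis bezout_int coprime_imp_gcd_eq_1)
  have "int_cong m (of_int u * (of_int d * x) + of_int v * x * of_int l) (0 + 0)"
    by (intro int_cong_add int_cong_0_mult assms algebraic_int_times) auto
  moreover have "of_int u * (of_int d * x) + of_int v * x * of_int l = of_int (u * d + v * l) * x"
    by (simp add: algebra_simps)
  ultimately show ?thesis by (simp add: uv)
qed

lemma frobenius_int_cong_add:
  assumes l: "prime l" and xy: "algebraic_int x" "algebraic_int y"
  shows "int_cong (of_nat l) ((x + y) ^ l) (x ^ l + y ^ l)"
proof -
  have "l > 1" using l prime_gt_1_nat by blast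
  then have set_eq: "{..l} = insert 0 (insert l {1..<l})" by auto
  have "(x + y) ^ l = (\<Sum>k\<le>l. of_nat (l choose k) * x ^ k * y ^ (l - k))"
    by (simp add: binomial_ring)
  also have "\<dots> = y ^ l + x ^ l + (\<Sum>k\<in>{1..<l}. of_nat (l choose k) * x ^ k * y ^ (l - k))"
    unfolding set_eq using \<open>l > 1\<close> by (simp add: add.assoc)
  finally have eq: "(x + y) ^ l - (x ^ l + y ^ l) =
    (\<Sum>k\<in>{1..<l}. of_nat (l choose k) * x ^ k * y ^ (l - k))" by simp
  have "algebraic_int ((\<Sum>k\<in>{1..<l}. of_nat (l choose k) * x ^ k * y ^ (l - k)) / of_nat l)"
    unfolding sum_divide_distrib
  proof (rule algebraic_int_sum)
    fix k assume "k \<in> {1..<l}"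
    then have "l dvd (l choose k)" using l by (intro dvd_choose_prime) auto
    then obtain e where "l choose k = l * e" by blast
    then have "of_nat (l choose k) * x ^ k * y ^ (l - k) / of_nat l = of_nat e * x ^ k * y ^ (l - k)"
      using \<open>l > 1\<close> by simp
    then show "algebraic_int (of_nat (l choose k) * x ^ k * y ^ (l - k) / of_nat l)"
      using xy by (simp add: algebraic_int_times algebraic_int_power)
  qed
  then show ?thesis by (simp add: int_cong_def eq)
qed

lemma frobenius_int_cong_sum:
  assumes l: "prime l" and f: "\<And>i. i \<in> A \<Longrightarrow> algebraic_int (f i)"
  shows "int_cong (of_nat l) ((\<Sum>i\<in>A. f i) ^ l) (\<Sum>i\<in>A. f i ^ l)"
  using f
proof (induction A rule: infinite_finite_induct)
  case (insert i A)
  have "int_cong (of_nat l) ((f i + sum f A) ^ l) (f i ^ l + sum f A ^ l)"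
    using insert by (intro frobenius_int_cong_add l algebraic_int_sum) auto
  also have "int_cong (of_nat l) (f i ^ l + sum f A ^ l) (f i ^ l + (\<Sum>i\<in>A. f i ^ l))"
    using insert by (intro int_cong_add) auto
  finally show ?case using insert by simp
qed (use prime_gt_0_nat[OF l] in \<open>simp_all add: zero_power\<close>)

section \<open>Subfields of the complex numbers and Gaussian integers\<close>

lemma field_CC: "field CC" and cring_CC: "cring CC" and ring_CC: "ring CC"
  by (rule class_field, rule fieldE(1)[OF class_field], rule field.is_ring[OF class_field])

lemma CC_uminus: "\<ominus>\<^bsub>CC\<^esub> x = - x"
  by (simp add: class_ring_simps)

lemma CC_inverse: "x \<noteq> 0 \<Longrightarrow> inv\<^bsub>CC\<^esub> x = inverse x"
  by (simp add: class_ring_simps)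

lemma subring_CC_I:
  assumes "1 \<in> H" "\<And>x. x \<in> H \<Longrightarrow> - x \<in> H"
    "\<And>x y. x \<in> H \<Longrightarrow> y \<in> H \<Longrightarrow> x * y \<in> H" "\<And>x y. x \<in> H \<Longrightarrow> y \<in> H \<Longrightarrow> x + y \<in> H"
  shows "subring H CC"
  by (rule ring.subringI[OF ring_CC]) (use assms in \<open>auto simp: CC_uminus\<close>)

lemma subfield_CC_I:
  assumes "1 \<in> E" "\<And>x. x \<in> E \<Longrightarrow> - x \<in> E" "\<And>x. x \<in> E \<Longrightarrow> x \<noteq> 0 \<Longrightarrow> inverse x \<in> E"
    "\<And>x y. x \<in> E \<Longrightarrow> y \<in> E \<Longrightarrow> x * y \<in> E" "\<And>x y. x \<in> E \<Longrightarrow> y \<in> E \<Longrightarrow> x + y \<in> E"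
  shows "subfield E CC"
  by (rule field.subfieldI'[OF field_CC subring_CC_I]) (use assms in \<open>auto simp: CC_inverse\<close>)

lemma subfield_CC_D:
  assumes "subfield E CC"
  shows "1 \<in> E" "0 \<in> E" "\<And>x. x \<in> E \<Longrightarrow> - x \<in> E" "\<And>x. x \<in> E \<Longrightarrow> inverse x \<in> E"
    "\<And>x y. x \<in> E \<Longrightarrow> y \<in> E \<Longrightarrow> x * y \<in> E" "\<And>x y. x \<in> E \<Longrightarrow> y \<in> E \<Longrightarrow> x + y \<in> E"
    "\<And>x y. x \<in> E \<Longrightarrow> y \<in> E \<Longrightarrow> x - y \<in> E"
proof -
  note sr = subringE[OF subfieldE(1)[OF assms]]
  show one: "1 \<in> E" and zero: "0 \<in> E" using sr(2,3) by simp_all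
  show um: "- x \<in> E" if "x \<in> E" for x using sr(5)[OF that] by (simp only: CC_uminus)
  show "x * y \<in> E" if "x \<in> E" "y \<in> E" for x y using sr(6)[OF that] by simp
  show ad: "x + y \<in> E" if "x \<in> E" "y \<in> E" for x y using sr(7)[OF that] by simp
  show "x - y \<in> E" if "x \<in> E" "y \<in> E" for x y using ad[OF that(1) um[OF that(2)]] by simp
  show "inverse x \<in> E" if "x \<in> E" for x
  proof (cases "x = 0")
    case False
    then have "inv\<^bsub>CC\<^esub> x \<in> E"
      using ring.subfield_m_inv(1)[OF ring_CC assms, of x] that by simp
    then show ?thesis by (simp only: CC_inverse[OF False])
  qed (use zero in simp)
qed

lemma cring_int_ring_of:
  assumes "subfield E CC"
  shows "cring (int_ring_of E)"
proof -
  note E = subfield_CC_D[OF assms]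
  have "subring {x \<in> E. algebraic_int x} CC"
    by (rule subring_CC_I) (auto intro!: E algebraic_int_add algebraic_int_times)
  then have "subcring {x \<in> E. algebraic_int x} CC"
    using cring.subcringI'[OF cring_CC] by blast
  then show ?thesis
    unfolding int_ring_of_def using ring.subcring_iff[OF ring_CC] by simp
qed

lemma PIdl_int_ring_of:
  "PIdl\<^bsub>int_ring_of E\<^esub> p = {x * p | x. x \<in> E \<and> algebraic_int x}"
  by (simp add: cgenideal_def int_ring_of_def)

section \<open>Gaussian rationals and their integers\<close>

definition gauss_rat :: "complex set" where
  "gauss_rat = {z. Re z \<in> \<rat> \<and> Im z \<in> \<rat>}"

definition gauss_int :: "complex set" where
  "gauss_int = {z. Re z \<in> \<int> \<and> Im z \<in> \<int>}"

lemma subfield_gauss_rat: "subfield gauss_rat CC"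
  by (rule subfield_CC_I) (auto simp: gauss_rat_def power2_eq_square)

lemmas gauss_rat_closed = subfield_CC_D[OF subfield_gauss_rat]

lemma gauss_int_closed:
  "0 \<in> gauss_int" "1 \<in> gauss_int" "\<i> \<in> gauss_int" "of_int k \<in> gauss_int" "of_nat m \<in> gauss_int"
  "x \<in> gauss_int \<Longrightarrow> - x \<in> gauss_int"
  "x \<in> gauss_int \<Longrightarrow> y \<in> gauss_int \<Longrightarrow> x + y \<in> gauss_int"
  "x \<in> gauss_int \<Longrightarrow> y \<in> gauss_int \<Longrightarrow> x - y \<in> gauss_int"
  "x \<in> gauss_int \<Longrightarrow> y \<in> gauss_int \<Longrightarrow> x * y \<in> gauss_int"
  by (auto simp: gauss_int_def)

lemma gauss_int_power: "x \<in> gauss_int \<Longrightarrow> x ^ k \<in> gauss_int"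
  by (induction k) (auto intro: gauss_int_closed)

lemma Ints_subset_Rats: "x \<in> \<int> \<Longrightarrow> x \<in> \<rat>"
  by (auto elim!: Ints_cases)

lemma gauss_int_subset_rat: "x \<in> gauss_int \<Longrightarrow> x \<in> gauss_rat"
  by (auto simp: gauss_int_def gauss_rat_def Ints_subset_Rats)

lemma Rats_subset_gauss_rat:
  assumes "x \<in> \<rat>"
  shows "x \<in> gauss_rat"
proof -
  obtain a b where "x = of_int a / of_int b" using assms by (elim Rats_cases')
  then have "x = complex_of_real (of_int a / of_int b)" by simp
  then show ?thesis by (simp only: gauss_rat_def) simp
qed

lemma gauss_int_algebraic_int:
  assumes "x \<in> gauss_int"
  shows "algebraic_int x"
proof -
  obtain a b where "Re x = of_int a" "Im x = of_int b"
    using assms by (auto simp: gauss_int_def elim!: Ints_cases)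
  then have "x = of_int a + \<i> * of_int b" by (simp add: complex_eq_iff)
  then show ?thesis by (auto intro!: algebraic_int_add algebraic_int_times)
qed

lemma real_algebraic_int_rat: "algebraic_int (complex_of_real r) \<Longrightarrow> r \<in> \<rat> \<Longrightarrow> r \<in> \<int>"
  using rational_algebraic_int_is_int[of r] by simp

lemma four_dvd_sum_squares:
  fixes A B :: int
  assumes "4 dvd A\<^sup>2 + B\<^sup>2"
  shows "even A \<and> even B"
proof -
  have "even (A\<^sup>2 + B\<^sup>2)" by (rule dvd_trans[OF _ assms]) simp
  then have "even A \<longleftrightarrow> even B" by simp
  moreover have "even A" if odd: "odd A" "odd B"
  proof -
    obtain a b where "A = 2 * a + 1" "B = 2 * b + 1" using odd by (auto elim!: oddE)
    then have "A\<^sup>2 + B\<^sup>2 = 4 * (a\<^sup>2 + a + b\<^sup>2 + b) + 2" by (simp add: power2_eq_square algebra_simps)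
    then have "4 dvd (2::int)" using assms by (metis dvd_add_right_iff dvd_triv_left)
    then show ?thesis by simp
  qed
  ultimately show ?thesis by blast
qed

text \<open>The traces of \<open>x\<close> and of \<open>- \<i> * x\<close> make
  \<open>2 * Re x\<close> and \<open>2 * Im x\<close> integers \<open>A\<close> and
  \<open>B\<close>. The norm makes \<open>A\<^sup>2 + B\<^sup>2\<close> divisible by 4, which
  excludes half-integers.\<close>

lemma gauss_rat_algebraic_int:
  assumes x: "x \<in> gauss_rat" and ai: "algebraic_int x"
  shows "x \<in> gauss_int"
proof -
  have rat: "Re x \<in> \<rat>" "Im x \<in> \<rat>" using x by (auto simp: gauss_rat_def)
  have "x + cnj x = complex_of_real (2 * Re x)" by (simp add: complex_eq_iff)
  then have "2 * Re x \<in> \<int>"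
    using algebraic_int_add[OF ai algebraic_int_cnj[OF ai]] rat
    by (intro real_algebraic_int_rat) simp_all
  then obtain A :: int where A: "2 * Re x = of_int A" by (elim Ints_cases)
  have "- \<i> * (x - cnj x) = complex_of_real (2 * Im x)" by (simp add: complex_eq_iff)
  moreover have "algebraic_int (- \<i> * (x - cnj x))"
    using ai by (intro algebraic_int_times algebraic_int_diff) auto
  ultimately have "2 * Im x \<in> \<int>"
    using rat by (intro real_algebraic_int_rat) simp_all
  then obtain B :: int where B: "2 * Im x = of_int B" by (elim Ints_cases)
  have "x * cnj x = complex_of_real ((Re x)\<^sup>2 + (Im x)\<^sup>2)"
    by (simp add: complex_eq_iff power2_eq_square)
  then have "(Re x)\<^sup>2 + (Im x)\<^sup>2 \<in> \<int>"
    using algebraic_int_times[OF ai algebraic_int_cnj[OF ai]] rat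
    by (intro real_algebraic_int_rat) simp_all
  then obtain C :: int where C: "(Re x)\<^sup>2 + (Im x)\<^sup>2 = of_int C" by (elim Ints_cases)
  have "of_int (A\<^sup>2 + B\<^sup>2) = (2 * Re x)\<^sup>2 + (2 * Im x)\<^sup>2" by (simp add: A B)
  also have "\<dots> = 4 * ((Re x)\<^sup>2 + (Im x)\<^sup>2)" by (simp add: power2_eq_square)
  also have "\<dots> = of_int (4 * C)" by (simp add: C)
  finally have "A\<^sup>2 + B\<^sup>2 = 4 * C" by linarith
  then have "even A \<and> even B" by (intro four_dvd_sum_squares) simp
  then obtain a b where "A = 2 * a" "B = 2 * b" by blast
  then have "Re x = of_int a" "Im x = of_int b" using A B by simp_all
  then show ?thesis by (simp add: gauss_int_def)
qed

lemma carrier_int_ring_of_gauss_rat: "{x \<in> gauss_rat. algebraic_int x} = gauss_int"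
  using gauss_rat_algebraic_int gauss_int_algebraic_int gauss_int_subset_rat by blast

section \<open>Euclidean division and class number one\<close>

text \<open>The floor only serves to land in \<open>nat\<close>, for least elements and for
  induction; on Gaussian integers it is exact.\<close>

definition gauss_norm :: "complex \<Rightarrow> nat" where
  "gauss_norm x = nat \<lfloor>(cmod x)\<^sup>2\<rfloor>"

lemma gauss_norm_eq:
  assumes "x \<in> gauss_int"
  shows "real (gauss_norm x) = (cmod x)\<^sup>2"
proof -
  have "(cmod x)\<^sup>2 = (Re x)\<^sup>2 + (Im x)\<^sup>2" by (rule cmod_power2)
  then have "(cmod x)\<^sup>2 \<in> \<int>" using assms by (simp add: gauss_int_def)
  then obtain k :: int where "(cmod x)\<^sup>2 = of_int k" by (elim Ints_cases)
  moreover from this have "k \<ge> 0" by (metis of_int_0_le_iff zero_le_power2)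
  ultimately show ?thesis by (simp add: gauss_norm_def)
qed

text \<open>Rounding both coordinates of \<open>u / g\<close> leaves an error of squared length at
  most 1/2.\<close>

lemma gauss_int_division:
  assumes "g \<noteq> 0"
  obtains q where "q \<in> gauss_int" "cmod (u - q * g) < cmod g"
proof -
  define w where "w = u / g"
  define q where "q = Complex (of_int (round (Re w))) (of_int (round (Im w)))"
  have "(cmod (w - q))\<^sup>2 = (Re w - of_int (round (Re w)))\<^sup>2 + (Im w - of_int (round (Im w)))\<^sup>2"
    by (simp add: cmod_power2 q_def)
  also have "\<dots> \<le> (1/2)\<^sup>2 + (1/2)\<^sup>2"
    by (intro add_mono; rule abs_le_square_iff[THEN iffD1])
      (use of_int_round_abs_le[of "Re w"] of_int_round_abs_le[of "Im w"] in
        \<open>simp_all add: abs_minus_commute\<close>)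
  also have "\<dots> < 1\<^sup>2" by (simp add: power2_eq_square)
  finally have "cmod (w - q) < 1" by (rule power2_less_imp_less) simp
  then have "cmod (w - q) * cmod g < 1 * cmod g"
    using assms by (intro mult_strict_right_mono) auto
  moreover have "(w - q) * g = u - q * g" using assms by (simp add: w_def field_simps)
  ultimately have "cmod (u - q * g) < cmod g" by (metis mult_1 norm_mult)
  moreover have "q \<in> gauss_int" by (simp add: q_def gauss_int_def)
  ultimately show ?thesis using that by blast
qed

text \<open>Stated for plain sets rather than ideals of a ring record, so that it applies both to
  the class number and to the kernel in \<open>split_gauss_prime\<close>.\<close>

lemma gauss_int_principal:
  assumes sub: "I \<subseteq> gauss_int" and ne: "\<exists>x\<in>I. x \<noteq> 0"
    and diff: "\<And>x y. x \<in> I \<Longrightarrow> y \<in> I \<Longrightarrow> x - y \<in> I"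
    and mult: "\<And>x y. x \<in> gauss_int \<Longrightarrow> y \<in> I \<Longrightarrow> x * y \<in> I"
  shows "\<exists>g\<in>I. g \<noteq> 0 \<and> I = (\<lambda>x. g * x) ` gauss_int"
proof -
  obtain g where g: "g \<in> I" "g \<noteq> 0"
    and min: "\<And>x. x \<in> I \<Longrightarrow> x \<noteq> 0 \<Longrightarrow> gauss_norm g \<le> gauss_norm x"
    using ne ex_has_least_nat[of "\<lambda>x. x \<in> I \<and> x \<noteq> 0" _ gauss_norm] by blast
  have "u \<in> (\<lambda>x. g * x) ` gauss_int" if u: "u \<in> I" for u
  proof -
    obtain q where q: "q \<in> gauss_int" "cmod (u - q * g) < cmod g"
      using gauss_int_division[OF g(2)] by blast
    have r: "u - q * g \<in> I" using u g q by (intro diff mult)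
    have "u - q * g = 0"
    proof (rule ccontr)
      assume "u - q * g \<noteq> 0"
      then have "gauss_norm g \<le> gauss_norm (u - q * g)" using min r by blast
      then have "(cmod g)\<^sup>2 \<le> (cmod (u - q * g))\<^sup>2"
        using gauss_norm_eq g r sub by (metis of_nat_le_iff subsetD)
      then show False using q(2) by (metis not_less norm_ge_zero power2_le_imp_le)
    qed
    then show ?thesis using q by (intro image_eqI[of _ _ q]) (auto simp: mult.commute)
  qed
  moreover have "(\<lambda>x. g * x) ` gauss_int \<subseteq> I"
    using mult[OF _ g(1)] by (auto simp: mult.commute)
  ultimately have "I = (\<lambda>x. g * x) ` gauss_int" by blast
  with g show ?thesis by blast
qed

lemma class_number_gauss_rat: "class_number gauss_rat = 1"
proof -
  let ?R = "int_ring_of gauss_rat" and ?A = "nonzero_ideals gauss_rat"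
  have R: "ring ?R" using cring_int_ring_of[OF subfield_gauss_rat] by (rule cring.axioms)
  have carr: "carrier ?R = gauss_int"
    using carrier_int_ring_of_gauss_rat by (simp add: int_ring_of_def)
  have princ: "\<exists>g \<in> gauss_int. g \<noteq> 0 \<and> I = (\<lambda>x. g * x) ` gauss_int" if I: "I \<in> ?A" for I
  proof -
    have idl: "ideal I ?R" and ne: "I \<noteq> {0}" using I by (auto simp: nonzero_ideals_def)
    note add_sub = ideal.axioms(1)[OF idl]
    have sub: "I \<subseteq> gauss_int" using additive_subgroup.a_subset[OF add_sub] carr by simp
    have add: "x + y \<in> I" if "x \<in> I" "y \<in> I" for x y
      using additive_subgroup.a_closed[OF add_sub that] by (simp add: int_ring_of_def)
    have mult: "x * y \<in> I" if "x \<in> gauss_int" "y \<in> I" for x y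
    proof -
      have "x \<otimes>\<^bsub>?R\<^esub> y \<in> I" using ideal.I_l_closed[OF idl] that carr by blast
      then show ?thesis by (simp add: int_ring_of_def)
    qed
    have "0 \<in> I" using additive_subgroup.zero_closed[OF add_sub] by (simp add: int_ring_of_def)
    then have nz: "\<exists>x\<in>I. x \<noteq> 0" using ne by blast
    have diff: "x - y \<in> I" if "x \<in> I" "y \<in> I" for x y
      using add[OF that(1) mult[OF _ that(2), of "-1"]] gauss_int_closed(2,6) by simp
    show ?thesis using gauss_int_principal[OF sub nz diff mult] sub by blast
  qed
  have rel: "(I, J) \<in> ideal_class_rel gauss_rat" if IJ: "I \<in> ?A" "J \<in> ?A" for I J
  proof -
    obtain g h where g: "g \<in> gauss_int" "g \<noteq> 0" "I = (\<lambda>x. g * x) ` gauss_int"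
      and h: "h \<in> gauss_int" "h \<noteq> 0" "J = (\<lambda>x. h * x) ` gauss_int"
      using princ[OF IJ(1)] princ[OF IJ(2)] by blast
    have "(\<lambda>x. h * x) ` I = (\<lambda>x. g * x) ` J"
      by (simp add: g(3) h(3) image_image mult.left_commute)
    then show ?thesis using IJ g h carr unfolding ideal_class_rel_def by blast
  qed
  have "ideal_class_rel gauss_rat `` {I} = ?A" if "I \<in> ?A" for I
    using rel[OF that] by (auto simp: ideal_class_rel_def)
  moreover have "gauss_int \<noteq> {0}" using gauss_int_closed(2) by (metis singletonD zero_neq_one)
  \<comment> \<open>The unit ideal shows that there is a nonzero ideal at all; otherwise the
    quotient would be empty and have cardinality 0.\<close>
  then have "carrier ?R \<in> ?A"
    using ring.oneideal[OF R] gauss_int_closed(2) carr by (auto simp: nonzero_ideals_def)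
  ultimately have "?A // ideal_class_rel gauss_rat = {?A}"
    unfolding quotient_def by auto
  then show ?thesis by (simp add: class_number_def)
qed

section \<open>A Gaussian prime over a split rational prime\<close>

lemma fermat_int:
  assumes l: "prime (l::nat)"
  shows "[a ^ l = a] (mod int l)"
proof -
  define b where "b = nat (a mod int l)"
  have l1: "l > 1" using l prime_gt_1_nat by blast
  have ab: "[a = int b] (mod int l)" using l1 by (simp add: b_def cong_def)
  have "[b ^ l = b] (mod l)"
  proof (cases "l dvd b")
    case True
    moreover have "l dvd b ^ l" using True l1 dvd_trans[OF True dvd_power[of l b]] by simp
    ultimately show ?thesis by (simp add: cong_def dvd_eq_mod_eq_0)
  next
    case False
    then have "[b ^ (l - 1) * b = 1 * b] (mod l)"
      using fermat_theorem[OF l] by (intro cong_mult cong_refl)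
    moreover have "b ^ (l - 1) * b = b ^ l" using l1 by (intro power_minus_mult) simp
    ultimately show ?thesis by simp
  qed
  then have "[int b ^ l = int b] (mod int l)" using cong_int_iff[of "b ^ l" b l] by simp
  then show ?thesis using cong_trans[OF cong_pow[OF ab] cong_trans[OF _ cong_sym[OF ab]]] by blast
qed

text \<open>Sending \<open>\<i>\<close> to the square root \<open>y\<close> of -1 is a ring
  homomorphism from Z[i] onto the field with \<open>l\<close> elements. Its kernel is principal, and
  \<open>p\<close> is a generator: primality comes from the target being a domain, and the last
  property is Fermat's theorem in the target.\<close>

lemma split_gauss_prime:
  assumes l: "prime (l::nat)" and y: "[y\<^sup>2 = -1] (mod int l)"
  obtains p where "p \<in> gauss_int" "p \<noteq> 0" "\<And>x. x \<in> gauss_int \<Longrightarrow> p * x \<noteq> 1"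
    "\<exists>k\<in>gauss_int. k \<noteq> 0 \<and> of_nat l = p * k"
    "\<And>u v. u \<in> gauss_int \<Longrightarrow> v \<in> gauss_int \<Longrightarrow> \<exists>x\<in>gauss_int. u * v = p * x \<Longrightarrow>
        (\<exists>x\<in>gauss_int. u = p * x) \<or> (\<exists>x\<in>gauss_int. v = p * x)"
    "\<And>u. u \<in> gauss_int \<Longrightarrow> \<exists>x\<in>gauss_int. u ^ l - u = p * x"
proof -
  \<comment> \<open>The floors read off the integer coordinates of a Gaussian integer.\<close>
  define \<phi> where "\<phi> u = \<lfloor>Re u\<rfloor> + y * \<lfloor>Im u\<rfloor>" for u
  have l1: "l > 1" using l prime_gt_1_nat by blast
  have add: "\<phi> (u + v) = \<phi> u + \<phi> v" and mult: "[\<phi> (u * v) = \<phi> u * \<phi> v] (mod int l)"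
    if uv: "u \<in> gauss_int" "v \<in> gauss_int" for u v
  proof -
    obtain a b c d :: int where abcd: "Re u = of_int a" "Im u = of_int b" "Re v = of_int c" "Im v = of_int d"
      using uv by (auto simp: gauss_int_def elim!: Ints_cases)
    then show "\<phi> (u + v) = \<phi> u + \<phi> v" by (simp add: \<phi>_def algebra_simps flip: of_int_add)
    have "\<phi> (u * v) = (a * c + (-1) * (b * d)) + y * (a * d + b * c)"
      using abcd by (simp add: \<phi>_def flip: of_int_add of_int_mult of_int_diff)
    also have "[(a * c + (-1) * (b * d)) + y * (a * d + b * c) =
        (a * c + y\<^sup>2 * (b * d)) + y * (a * d + b * c)] (mod int l)"
      by (intro cong_add cong_mult cong_refl cong_sym[OF y])
    also have "(a * c + y\<^sup>2 * (b * d)) + y * (a * d + b * c) = \<phi> u * \<phi> v"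
      using abcd by (simp add: \<phi>_def algebra_simps power2_eq_square)
    finally show "[\<phi> (u * v) = \<phi> u * \<phi> v] (mod int l)" .
  qed
  have neg: "\<phi> (- u) = - \<phi> u" if "u \<in> gauss_int" for u
    using add[OF that gauss_int_closed(6)[OF that]] by (simp add: \<phi>_def)
  have diff: "\<phi> (u - v) = \<phi> u - \<phi> v" if "u \<in> gauss_int" "v \<in> gauss_int" for u v
    using add[OF that(1) gauss_int_closed(6)[OF that(2)]] neg[OF that(2)] by simp
  have pow: "[\<phi> (u ^ k) = \<phi> u ^ k] (mod int l)" if "u \<in> gauss_int" for u k
  proof (induction k)
    case (Suc k)
    have "[\<phi> (u * u ^ k) = \<phi> u * \<phi> (u ^ k)] (mod int l)"
      using that by (intro mult gauss_int_power)
    also have "[\<phi> u * \<phi> (u ^ k) = \<phi> u * \<phi> u ^ k] (mod int l)"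
      by (intro cong_mult cong_refl Suc)
    finally show ?case by simp
  qed (simp add: \<phi>_def)
  define I where "I = {u \<in> gauss_int. int l dvd \<phi> u}"
  have lI: "of_nat l \<in> I" by (simp add: I_def \<phi>_def gauss_int_closed)
  have sub: "I \<subseteq> gauss_int" by (auto simp: I_def)
  have ne: "\<exists>x\<in>I. x \<noteq> 0" using lI l1 by (intro bexI[of _ "of_nat l"]) auto
  have I_diff: "u - v \<in> I" if "u \<in> I" "v \<in> I" for u v
    using that by (auto simp: I_def diff gauss_int_closed)
  have I_mult: "u * v \<in> I" if "u \<in> gauss_int" "v \<in> I" for u v
  proof -
    have "int l dvd \<phi> u * \<phi> v" using that by (simp add: I_def)
    then have "int l dvd \<phi> (u * v)" using mult[of u v] that by (simp add: I_def cong_dvd_iff)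
    then show ?thesis using that by (simp add: I_def gauss_int_closed)
  qed
  obtain p where p: "p \<in> I" "p \<noteq> 0" and I: "I = (\<lambda>x. p * x) ` gauss_int"
    using gauss_int_principal[OF sub ne I_diff I_mult] by blast
  have memI: "u \<in> I \<longleftrightarrow> (\<exists>x\<in>gauss_int. u = p * x)" for u unfolding I by blast
  show ?thesis
  proof (rule that[of p])
    show "p \<in> gauss_int" using p by (simp add: I_def)
    show "p \<noteq> 0" by (rule p)
    show "p * x \<noteq> 1" if "x \<in> gauss_int" for x
    proof
      assume "p * x = 1"
      then have "1 \<in> I" using memI that by metis
      then show False using l1 by (simp add: I_def \<phi>_def)
    qed
    show "\<exists>k\<in>gauss_int. k \<noteq> 0 \<and> of_nat l = p * k" using lI memI l1
      by (metis mult_zero_right not_less_zero of_nat_0_eq_iff)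
    show "(\<exists>x\<in>gauss_int. u = p * x) \<or> (\<exists>x\<in>gauss_int. v = p * x)"
      if uv: "u \<in> gauss_int" "v \<in> gauss_int" "\<exists>x\<in>gauss_int. u * v = p * x" for u v
    proof -
      have "int l dvd \<phi> (u * v)" using uv(3) memI by (auto simp: I_def)
      then have "int l dvd \<phi> u * \<phi> v" using mult[OF uv(1,2)] by (simp add: cong_dvd_iff)
      then have "int l dvd \<phi> u \<or> int l dvd \<phi> v" using l by (simp add: prime_dvd_mult_iff)
      then show ?thesis using uv(1,2) memI by (auto simp: I_def)
    qed
    show "\<exists>x\<in>gauss_int. u ^ l - u = p * x" if u: "u \<in> gauss_int" for u
    proof -
      have "[\<phi> u ^ l = \<phi> u] (mod int l)"
        by (rule fermat_int[OF l])
      then have "[\<phi> (u ^ l) = \<phi> u] (mod int l)" using pow[OF u, of l] cong_trans by blast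
      then have "u ^ l - u \<in> I"
        using u by (simp add: I_def diff gauss_int_power gauss_int_closed cong_iff_dvd_diff)
      then show ?thesis using memI by simp
    qed
  qed
qed

section \<open>Cyclic extensions from a basis permuted by the Frobenius map\<close>

lemma gauss_rat_common_denominator:
  assumes "finite A" "\<And>x. x \<in> A \<Longrightarrow> f x \<in> gauss_rat"
  shows "\<exists>D>0. \<forall>x\<in>A. of_nat D * f x \<in> gauss_int"
  using assms
proof (induction A rule: finite_induct)
  case (insert a A)
  then obtain D where D: "D > 0" "\<And>x. x \<in> A \<Longrightarrow> of_nat D * f x \<in> gauss_int" by auto
  have "Re (f a) \<in> \<rat>" "Im (f a) \<in> \<rat>" using insert.prems by (auto simp: gauss_rat_def)
  then obtain r s t u where r: "Re (f a) = of_int r / of_int s" "s > 0"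
    and t: "Im (f a) = of_int t / of_int u" "u > 0"
    by (elim Rats_cases')
  define E where "E = D * nat s * nat u"
  have E: "real E = real D * of_int s * of_int u" using r(2) t(2) by (simp add: E_def)
  have "real E * Re (f a) = of_int (int D * u * r)" "real E * Im (f a) = of_int (int D * s * t)"
    using r t by (simp_all add: E)
  then have "of_nat E * f a \<in> gauss_int" by (simp add: gauss_int_def)
  moreover have "of_nat E * f x \<in> gauss_int" if x: "x \<in> A" for x
  proof -
    have "of_nat E * f x = of_nat (nat s * nat u) * (of_nat D * f x)" by (simp add: E_def)
    then show ?thesis using D(2)[OF x] gauss_int_closed(5,9) by metis
  qed
  moreover have "E > 0" using D(1) r(2) t(2) by (simp add: E_def)
  ultimately show ?case by auto
qed auto

text \<open>Multiplication by \<open>n - 1\<close> is negation modulo \<open>n\<close>, here and in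
  all later index computations; it keeps indices in \<open>nat\<close>.\<close>

lemma sum_shift_mod:
  fixes F :: "nat \<Rightarrow> 'a :: comm_monoid_add"
  assumes "n > 0"
  shows "(\<Sum>j<n. F ((j + k) mod n)) = (\<Sum>j<n. F j)"
proof (rule sum.reindex_bij_witness[of _ "\<lambda>i. (i + (n - 1) * k) mod n" "\<lambda>j. (j + k) mod n"])
  have e: "j + k + (n - 1) * k = j + n * k" for j
    using assms by (cases n) auto
  fix j assume j: "j \<in> {..<n}"
  have "((j + k) mod n + (n - 1) * k) mod n = (j + k + (n - 1) * k) mod n"
    by (simp add: mod_add_left_eq)
  then show "((j + k) mod n + (n - 1) * k) mod n = j" using j by (simp only: e) simp
  have "((j + (n - 1) * k) mod n + k) mod n = (j + (n - 1) * k + k) mod n"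
    by (rule mod_add_left_eq)
  also have "j + (n - 1) * k + k = j + k + (n - 1) * k" by simp
  finally show "((j + (n - 1) * k) mod n + k) mod n = j" using j by (simp only: e) simp
qed (use assms in auto)

lemma prod_lessThan_split:
  fixes F :: "nat \<Rightarrow> 'a :: comm_monoid_mult"
  assumes "n > 0"
  shows prod_lessThan_first: "(\<Prod>k<n. F k) = F 0 * (\<Prod>k<n - 1. F (Suc k))"
    and prod_lessThan_last: "(\<Prod>k<n. F k) = (\<Prod>k<n - 1. F k) * F (n - 1)"
proof -
  obtain m where "n = Suc m" using assms by (cases n) auto
  then show "(\<Prod>k<n. F k) = F 0 * (\<Prod>k<n - 1. F (Suc k))"
    "(\<Prod>k<n. F k) = (\<Prod>k<n - 1. F k) * F (n - 1)"
    by (simp_all only: prod.lessThan_Suc_shift diff_Suc_1) (simp_all flip: prod.lessThan_Suc_shift)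
qed

text \<open>\<open>\<alpha>_mult\<close> has the same constants for every shift \<open>k\<close>,
  which will make the shift multiplicative. \<open>\<alpha>_total\<close> places the base field
  inside the span, with constant coordinates, and \<open>p_fermat\<close> says that Frobenius at
  \<open>p\<close> fixes Gaussian coefficients.\<close>

locale frobenius_basis =
  fixes n l :: nat and p :: complex and d :: int and \<alpha> \<alpha>' :: "nat \<Rightarrow> complex"
    and c :: "nat \<Rightarrow> nat \<Rightarrow> nat \<Rightarrow> complex"
  assumes n: "n > 0" and l: "prime l"
    and p_gauss: "p \<in> gauss_int" and p_nz: "p \<noteq> 0"
    and p_nonunit: "\<And>x. x \<in> gauss_int \<Longrightarrow> p * x \<noteq> 1"
    and p_dvd_l: "\<exists>k\<in>gauss_int. k \<noteq> 0 \<and> of_nat l = p * k"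
    and p_prime: "\<And>u v. u \<in> gauss_int \<Longrightarrow> v \<in> gauss_int \<Longrightarrow> \<exists>x\<in>gauss_int. u * v = p * x \<Longrightarrow>
        (\<exists>x\<in>gauss_int. u = p * x) \<or> (\<exists>x\<in>gauss_int. v = p * x)"
    and p_fermat: "\<And>u. u \<in> gauss_int \<Longrightarrow> \<exists>x\<in>gauss_int. u ^ l - u = p * x"
    and coprime_d: "coprime d (int l)"
    and \<alpha>_int: "\<And>j. algebraic_int (\<alpha> j)" and \<alpha>'_int: "\<And>j. algebraic_int (\<alpha>' j)"
    and \<alpha>_real: "\<And>j. \<alpha> j \<in> \<real>"
    and \<alpha>_period: "\<And>j. \<alpha> (j + n) = \<alpha> j"
    and c_rat: "\<And>i j m. c i j m \<in> \<rat>"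
    and \<alpha>_mult: "\<And>i j k. i < n \<Longrightarrow> j < n \<Longrightarrow> \<alpha> (i + k) * \<alpha> (j + k) = (\<Sum>m<n. c i j m * \<alpha> (m + k))"
    and \<alpha>_total: "\<And>k. (\<Sum>j<n. \<alpha> (j + k)) = of_nat n"
    and \<alpha>_dual: "\<And>i j. i < n \<Longrightarrow> j < n \<Longrightarrow>
        (\<Sum>k<n. \<alpha> (i + k) * \<alpha>' (j + k)) = (if i = j then of_int d else 0)"
    and \<alpha>_frob: "\<And>j. int_cong (of_nat l) (\<alpha> j ^ l) (\<alpha> (Suc j))"
begin

lemma l_gt_1: "l > 1"
  using l prime_gt_1_nat by blast

lemma d_nz: "d \<noteq> 0"
  using coprime_d l_gt_1 by auto

lemma \<alpha>_mod: "\<alpha> (j mod n + k) = \<alpha> (j + k)"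
proof -
  have per: "\<alpha> (i + q * n) = \<alpha> i" for i q
  proof (induction q)
    case (Suc q)
    have "i + Suc q * n = (i + q * n) + n" by simp
    then show ?case using Suc \<alpha>_period by metis
  qed simp
  have "j mod n + k + j div n * n = j + k" using div_mult_mod_eq[of j n] by linarith
  then show ?thesis using per[of "j mod n + k" "j div n"] by simp
qed

lemma p_cong_of_l_cong: "int_cong (of_nat l) x y \<Longrightarrow> int_cong p x y"
  using p_dvd_l int_cong_dvd_modulus gauss_int_algebraic_int by metis

lemma l_cong_0: "int_cong p (of_nat l) 0"
  using p_dvd_l p_nz gauss_int_algebraic_int by (auto simp: int_cong_def)

lemma gauss_fermat: "u \<in> gauss_int \<Longrightarrow> int_cong p (u ^ l) u"
  using p_fermat[of u] p_nz gauss_int_algebraic_int by (auto simp: int_cong_def)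

lemma p_cong_cancel_d: "int_cong p (of_int d * x) 0 \<Longrightarrow> algebraic_int x \<Longrightarrow> int_cong p x 0"
  using int_cong_cancel_coprime[OF _ _ coprime_d] l_cong_0 by simp

text \<open>\<open>S 0 a\<close> is the element with coordinates \<open>a\<close>, and
  \<open>S k a\<close> is meant as its image under the k-th power of \<sigma>. That this image
  depends only on the element, and not on the coordinates chosen for it, rests on
  \<open>S_inj\<close>.\<close>

definition S :: "nat \<Rightarrow> (nat \<Rightarrow> complex) \<Rightarrow> complex" where
  "S k a = (\<Sum>j<n. a j * \<alpha> (j + k))"

definition shift :: "nat \<Rightarrow> (nat \<Rightarrow> complex) \<Rightarrow> nat \<Rightarrow> complex" where
  "shift k a i = a ((i + (n - 1) * k) mod n)"

lemma S_cong: "(\<And>j. j < n \<Longrightarrow> a j = b j) \<Longrightarrow> S k a = S k b"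
  by (simp add: S_def)

lemma S_shift: "S m (shift k a) = S (k + m) a"
proof -
  have e: "j + k + (n - 1) * k = j + n * k" for j
    using n by (cases n) auto
  have "S m (shift k a) = (\<Sum>j<n. shift k a ((j + k) mod n) * \<alpha> ((j + k) mod n + m))"
    unfolding S_def by (rule sum_shift_mod[OF n, symmetric])
  also have "\<dots> = (\<Sum>j<n. a j * \<alpha> (j + (k + m)))"
  proof (rule sum.cong[OF refl])
    fix j assume j: "j \<in> {..<n}"
    have "((j + k) mod n + (n - 1) * k) mod n = (j + n * k) mod n"
      by (simp only: mod_add_left_eq e)
    then have "shift k a ((j + k) mod n) = a j" using j by (simp add: shift_def)
    then show "shift k a ((j + k) mod n) * \<alpha> ((j + k) mod n + m) = a j * \<alpha> (j + (k + m))"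
      by (simp add: \<alpha>_mod add.assoc)
  qed
  finally show ?thesis by (simp add: S_def)
qed

lemma S_period: "S (k + n) a = S k a"
  by (simp add: S_def \<alpha>_period flip: add.assoc)

lemma S_add: "S k (\<lambda>j. a j + b j) = S k a + S k b"
  by (simp add: S_def sum.distrib ring_distribs)

lemma S_diff: "S k (\<lambda>j. a j - b j) = S k a - S k b"
  by (simp add: S_def sum_subtractf ring_distribs)

lemma S_scale: "S k (\<lambda>j. u * a j) = u * S k a"
  by (simp add: S_def sum_distrib_left mult.assoc)

lemma S_const: "S k (\<lambda>_. u) = u * of_nat n"
  by (simp add: S_def \<alpha>_total flip: sum_distrib_left)

lemma S_unit: "i < n \<Longrightarrow> S k (\<lambda>j. if j = i then 1 else 0) = \<alpha> (i + k)"
proof -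
  assume i: "i < n"
  have "S k (\<lambda>j. if j = i then 1 else 0) = (\<Sum>j<n. if j = i then \<alpha> (j + k) else 0)"
    unfolding S_def by (rule sum.cong) auto
  then show ?thesis using i by simp
qed

definition conv :: "(nat \<Rightarrow> complex) \<Rightarrow> (nat \<Rightarrow> complex) \<Rightarrow> nat \<Rightarrow> complex" where
  "conv a b m = (\<Sum>i<n. \<Sum>j<n. a i * b j * c i j m)"

text \<open>The product coordinates \<open>conv a b\<close> do not involve \<open>k\<close>:
  multiplication commutes with the shift.\<close>

lemma S_mult: "S k a * S k b = S k (conv a b)"
proof -
  have "S k a * S k b = (\<Sum>i<n. \<Sum>j<n. a i * b j * (\<alpha> (i + k) * \<alpha> (j + k)))"
    by (simp add: S_def sum_product mult_ac)
  also have "\<dots> = (\<Sum>i<n. \<Sum>j<n. \<Sum>m<n. a i * b j * c i j m * \<alpha> (m + k))"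
    by (intro sum.cong refl) (simp add: \<alpha>_mult sum_distrib_left mult_ac)
  also have "\<dots> = (\<Sum>i<n. \<Sum>m<n. \<Sum>j<n. a i * b j * c i j m * \<alpha> (m + k))"
    by (intro sum.cong refl sum.swap)
  also have "\<dots> = (\<Sum>m<n. \<Sum>i<n. \<Sum>j<n. a i * b j * c i j m * \<alpha> (m + k))"
    by (rule sum.swap)
  also have "\<dots> = S k (conv a b)"
    by (simp add: S_def conv_def sum_distrib_right)
  finally show ?thesis .
qed

text \<open>The \<open>n\<close> conjugates of an element determine its coordinates up to the factor
  \<open>d\<close>. Uniqueness of coordinates, their integrality and the description of all
  automorphisms are drawn from this identity.\<close>

lemma S_dual: "j < n \<Longrightarrow> (\<Sum>k<n. S k a * \<alpha>' (j + k)) = of_int d * a j"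
proof -
  assume j: "j < n"
  have "(\<Sum>k<n. S k a * \<alpha>' (j + k)) = (\<Sum>k<n. \<Sum>i<n. a i * (\<alpha> (i + k) * \<alpha>' (j + k)))"
    by (simp add: S_def sum_distrib_right mult.assoc)
  also have "\<dots> = (\<Sum>i<n. \<Sum>k<n. a i * (\<alpha> (i + k) * \<alpha>' (j + k)))"
    by (rule sum.swap)
  also have "\<dots> = (\<Sum>i<n. a i * (if i = j then of_int d else 0))"
    by (intro sum.cong refl) (simp add: \<alpha>_dual j flip: sum_distrib_left)
  also have "\<dots> = (\<Sum>i<n. if i = j then of_int d * a i else 0)"
    by (intro sum.cong) auto
  finally show ?thesis using j by simp
qed

lemma S_algebraic_int: "(\<And>j. j < n \<Longrightarrow> algebraic_int (a j)) \<Longrightarrow> algebraic_int (S k a)"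
  unfolding S_def by (intro algebraic_int_sum algebraic_int_times \<alpha>_int) auto

lemma S_frob:
  assumes a: "\<And>j. j < n \<Longrightarrow> a j \<in> gauss_int"
  shows "int_cong p (S k a ^ l) (S (Suc k) a)"
proof -
  note ai = gauss_int_algebraic_int[OF a]
  have "int_cong p (S k a ^ l) (\<Sum>j<n. (a j * \<alpha> (j + k)) ^ l)"
    unfolding S_def
    by (intro p_cong_of_l_cong frobenius_int_cong_sum l algebraic_int_times \<alpha>_int ai) auto
  also have "int_cong p (\<Sum>j<n. (a j * \<alpha> (j + k)) ^ l) (\<Sum>j<n. a j * \<alpha> (j + Suc k))"
    unfolding power_mult_distrib
    by (intro int_cong_sum int_cong_mult gauss_fermat a ai algebraic_int_power \<alpha>_int)
      (use \<alpha>_frob in \<open>auto intro: p_cong_of_l_cong\<close>)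
  finally show ?thesis by (simp add: S_def)
qed

lemma S_cong_0_imp_dvd:
  assumes a: "\<And>j. j < n \<Longrightarrow> a j \<in> gauss_int" and S0: "int_cong p (S 0 a) 0" and j: "j < n"
  shows "a j / p \<in> gauss_int"
proof -
  have Sk: "int_cong p (S k a) 0" for k
  proof (induction k)
    case (Suc k)
    have "int_cong p (S (Suc k) a) (S k a ^ l)" by (rule int_cong_sym, rule S_frob, rule a)
    also have "int_cong p (S k a ^ l) (0 ^ l)"
      using a gauss_int_algebraic_int by (intro int_cong_power Suc S_algebraic_int) auto
    finally show ?case using l_gt_1 by (simp add: zero_power)
  qed (rule S0)
  have "int_cong p (\<Sum>k<n. \<alpha>' (j + k) * S k a) (\<Sum>k<n. 0)"
    by (intro int_cong_sum int_cong_0_mult Sk \<alpha>'_int)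
  then have "int_cong p (of_int d * a j) 0" using S_dual[OF j] by (simp add: mult.commute)
  then have "int_cong p (a j) 0" using a[OF j] gauss_int_algebraic_int p_cong_cancel_d by blast
  then have "algebraic_int (a j / p)" by (simp add: int_cong_def)
  moreover have "a j / p \<in> gauss_rat"
    using a[OF j] p_gauss gauss_int_subset_rat gauss_rat_closed(4,5) by (metis divide_inverse)
  ultimately show ?thesis using gauss_rat_algebraic_int by blast
qed

text \<open>The descent below needs the norm to drop strictly on division by \<open>p\<close>. A
  Gaussian integer of norm 1 has its conjugate as inverse, which \<open>p_nonunit\<close>
  excludes.\<close>

lemma norm_p: "cmod p > 1"
proof (rule ccontr)
  assume "\<not> cmod p > 1"
  then have "(cmod p)\<^sup>2 \<le> 1" by (simp add: power_le_one)
  then have "gauss_norm p \<le> 1" using gauss_norm_eq[OF p_gauss] by linarith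
  moreover have "real (gauss_norm p) > 0" using gauss_norm_eq[OF p_gauss] p_nz by simp
  ultimately have "gauss_norm p = 1" by linarith
  then have "(cmod p)\<^sup>2 = 1" using gauss_norm_eq[OF p_gauss] by simp
  then have "p * cnj p = 1" using complex_norm_square[of p] by simp
  moreover have "cnj p \<in> gauss_int" using p_gauss by (simp add: gauss_int_def)
  ultimately show False using p_nonunit by blast
qed

text \<open>The descent is measured by the sum of the norms of the coordinates: division by
  \<open>p\<close> raises none of them and strictly lowers the nonzero ones.\<close>

lemma S_eq_0_gauss_int:
  assumes "\<And>j. j < n \<Longrightarrow> a j \<in> gauss_int" and "S 0 a = 0" and "j < n"
  shows "a j = 0"
  using assms
proof (induction "\<Sum>j<n. gauss_norm (a j)" arbitrary: a j rule: less_induct)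
  case less
  show ?case
  proof (rule ccontr)
    assume nz: "a j \<noteq> 0"
    define b where "b i = a i / p" for i
    have ab: "a i = p * b i" for i using p_nz by (simp add: b_def)
    have b: "b i \<in> gauss_int" if "i < n" for i
      unfolding b_def using S_cong_0_imp_dvd[of a i] less.prems that by simp
    have "p * S 0 b = S 0 a" using S_scale[of 0 p b] by (simp flip: ab)
    then have S0: "S 0 b = 0" using less.prems(2) p_nz by simp
    have norm: "real (gauss_norm (b i)) * (cmod p)\<^sup>2 = real (gauss_norm (a i))" if "i < n" for i
      using gauss_norm_eq[OF b[OF that]] gauss_norm_eq[OF less.prems(1)[OF that]]
      by (simp add: ab norm_mult power_mult_distrib)
    have p2: "(cmod p)\<^sup>2 > 1" using norm_p by (simp add: one_less_power)
    have le: "gauss_norm (b i) \<le> gauss_norm (a i)" if "i < n" for i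
    proof -
      have "real (gauss_norm (b i)) * 1 \<le> real (gauss_norm (b i)) * (cmod p)\<^sup>2"
        using p2 by (intro mult_left_mono) auto
      then show ?thesis using norm[OF that] by simp
    qed
    have "gauss_norm (b j) < gauss_norm (a j)"
    proof -
      have "gauss_norm (b j) > 0"
        using gauss_norm_eq[OF b[OF less.prems(3)]] nz ab[of j]
        by (metis gr0I mult_zero_right norm_eq_zero of_nat_0 power_eq_0_iff)
      then have "real (gauss_norm (b j)) * 1 < real (gauss_norm (b j)) * (cmod p)\<^sup>2"
        using p2 by (intro mult_strict_left_mono) auto
      then show ?thesis using norm[OF less.prems(3)] by simp
    qed
    then have "(\<Sum>j<n. gauss_norm (b j)) < (\<Sum>j<n. gauss_norm (a j))"
      using le less.prems(3) by (intro sum_strict_mono_ex1) auto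
    then have "b j = 0" using less.hyps[of b j] b S0 less.prems(3) by blast
    then show False using nz ab by simp
  qed
qed

lemma S_eq_0:
  assumes a: "\<And>j. j < n \<Longrightarrow> a j \<in> gauss_rat" and S0: "S 0 a = 0" and j: "j < n"
  shows "a j = 0"
proof -
  obtain D where D: "D > 0" "\<And>j. j < n \<Longrightarrow> of_nat D * a j \<in> gauss_int"
    using gauss_rat_common_denominator[of "{..<n}" a] a by auto
  have S0': "S 0 (\<lambda>j. of_nat D * a j) = 0" using S0 by (simp add: S_scale)
  have "of_nat D * a j = 0"
    by (rule S_eq_0_gauss_int[of "\<lambda>j. of_nat D * a j", OF D(2) S0' j])
  then show ?thesis using D(1) by simp
qed

lemma S_inj:
  assumes "\<And>j. a j \<in> gauss_rat" "\<And>j. b j \<in> gauss_rat" "S 0 a = S 0 b" "j < n"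
  shows "a j = b j"
proof -
  have "a j - b j = 0"
    by (rule S_eq_0[of "\<lambda>j. a j - b j"]) (use assms in \<open>auto simp: S_diff gauss_rat_closed\<close>)
  then show ?thesis by simp
qed

section \<open>The field \<open>L\<close> and the powers of the shift on it\<close>

definition L :: "complex set" where
  "L = {S 0 a | a. \<forall>j. a j \<in> gauss_rat}"

text \<open>\<open>SOME\<close> is used because only the values of \<open>a\<close> below
  \<open>n\<close> are determined by \<open>x\<close>; \<open>sig_S\<close> shows that the choice
  does not matter.\<close>

definition sig :: "nat \<Rightarrow> complex \<Rightarrow> complex" where
  "sig k x = S k (SOME a. (\<forall>j. a j \<in> gauss_rat) \<and> x = S 0 a)"

lemma L_E: "x \<in> L \<Longrightarrow> (\<And>a. (\<And>j. a j \<in> gauss_rat) \<Longrightarrow> x = S 0 a \<Longrightarrow> P) \<Longrightarrow> P"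
  unfolding L_def by blast

lemma L_I: "(\<And>j. a j \<in> gauss_rat) \<Longrightarrow> S 0 a \<in> L"
  unfolding L_def by blast

lemma shift_rat: "(\<And>j. a j \<in> gauss_rat) \<Longrightarrow> shift k a j \<in> gauss_rat"
  by (simp add: shift_def)

lemma S_in_L:
  assumes "\<And>j. a j \<in> gauss_rat"
  shows "S k a \<in> L"
  using L_I[of "shift k a", OF shift_rat[OF assms]] by (simp add: S_shift)

lemma sig_S:
  assumes a: "\<And>j. a j \<in> gauss_rat"
  shows "sig k (S m a) = S (m + k) a"
proof -
  define b where "b = (SOME b. (\<forall>j. b j \<in> gauss_rat) \<and> S m a = S 0 b)"
  have "(\<forall>j. shift m a j \<in> gauss_rat) \<and> S m a = S 0 (shift m a)"
    using shift_rat[OF a] by (simp add: S_shift)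
  then have b: "(\<forall>j. b j \<in> gauss_rat) \<and> S m a = S 0 b"
    unfolding b_def by (rule someI[of "\<lambda>b. (\<forall>j. b j \<in> gauss_rat) \<and> S m a = S 0 b"])
  have "S k b = S k (shift m a)"
    by (rule S_cong, rule S_inj) (use b shift_rat[OF a] in \<open>auto simp: S_shift\<close>)
  then show ?thesis by (simp add: sig_def b_def S_shift)
qed

lemma sig_in_L: "x \<in> L \<Longrightarrow> sig k x \<in> L"
  by (elim L_E) (simp add: sig_S S_in_L)

lemma sig_sig: "x \<in> L \<Longrightarrow> sig j (sig k x) = sig (k + j) x"
  by (elim L_E) (simp add: sig_S)

lemma sig_0: "x \<in> L \<Longrightarrow> sig 0 x = x"
  by (elim L_E) (simp add: sig_S)

lemma sig_period: "x \<in> L \<Longrightarrow> sig (k + n) x = sig k x"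
  by (elim L_E) (simp add: sig_S S_period)

lemma sig_mod: "x \<in> L \<Longrightarrow> sig (k mod n) x = sig k x"
proof -
  assume x: "x \<in> L"
  have "sig (i + q * n) x = sig i x" for i q
  proof (induction q)
    case (Suc q)
    have "i + Suc q * n = (i + q * n) + n" by simp
    then show ?case using Suc sig_period[OF x] by metis
  qed simp
  from this[of "k mod n" "k div n"] show ?thesis by simp
qed

lemma conv_rat: "(\<And>j. a j \<in> gauss_rat) \<Longrightarrow> (\<And>j. b j \<in> gauss_rat) \<Longrightarrow> conv a b m \<in> gauss_rat"
proof -
  assume ab: "\<And>j. a j \<in> gauss_rat" "\<And>j. b j \<in> gauss_rat"
  have sum: "(\<And>x. x \<in> A \<Longrightarrow> f x \<in> gauss_rat) \<Longrightarrow> sum f A \<in> gauss_rat" for A :: "nat set" and f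
    by (induction A rule: infinite_finite_induct) (auto intro: gauss_rat_closed)
  show ?thesis unfolding conv_def
    by (intro sum gauss_rat_closed ab Rats_subset_gauss_rat c_rat)
qed

lemma L_add: "x \<in> L \<Longrightarrow> y \<in> L \<Longrightarrow> x + y \<in> L"
  and sig_add: "x \<in> L \<Longrightarrow> y \<in> L \<Longrightarrow> sig k (x + y) = sig k x + sig k y"
  by (elim L_E; simp add: sig_S gauss_rat_closed S_add[symmetric] L_I)+

lemma L_mult: "x \<in> L \<Longrightarrow> y \<in> L \<Longrightarrow> x * y \<in> L"
  and sig_mult: "x \<in> L \<Longrightarrow> y \<in> L \<Longrightarrow> sig k (x * y) = sig k x * sig k y"
  by (elim L_E; simp add: sig_S conv_rat S_mult L_I)+

lemma K_subset_L: "x \<in> gauss_rat \<Longrightarrow> x \<in> L"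
  and sig_K: "x \<in> gauss_rat \<Longrightarrow> sig k x = x"
proof -
  assume x: "x \<in> gauss_rat"
  have r: "x / of_nat n \<in> gauss_rat"
    unfolding divide_inverse
    by (rule gauss_rat_closed(5)[OF x Rats_subset_gauss_rat]) simp
  \<comment> \<open>The \<alpha> j add up to \<open>n\<close>, so a constant has all its coordinates
    equal and every shift fixes it.\<close>
  have eq: "S m (\<lambda>_. x / of_nat n) = x" for m using n by (simp add: S_const)
  show "x \<in> L" using L_I[of "\<lambda>_. x / of_nat n"] r eq by simp
  show "sig k x = x" using sig_S[of "\<lambda>_. x / of_nat n" k 0] r eq by simp
qed

lemma L_minus: "x \<in> L \<Longrightarrow> - x \<in> L"
  using L_mult[OF K_subset_L[of "-1"]] gauss_rat_closed by simp

lemma L_prod: "(\<And>i. i \<in> A \<Longrightarrow> f i \<in> L) \<Longrightarrow> prod f A \<in> L"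
  and sig_prod: "(\<And>i. i \<in> A \<Longrightarrow> f i \<in> L) \<Longrightarrow> sig k (prod f A) = (\<Prod>i\<in>A. sig k (f i))"
proof -
  have "prod f A \<in> L \<and> sig k (prod f A) = (\<Prod>i\<in>A. sig k (f i))" if "\<And>i. i \<in> A \<Longrightarrow> f i \<in> L"
    using that
    by (induction A rule: infinite_finite_induct)
      (auto simp: K_subset_L sig_K gauss_rat_closed L_mult sig_mult)
  then show "(\<And>i. i \<in> A \<Longrightarrow> f i \<in> L) \<Longrightarrow> prod f A \<in> L"
    "(\<And>i. i \<in> A \<Longrightarrow> f i \<in> L) \<Longrightarrow> sig k (prod f A) = (\<Prod>i\<in>A. sig k (f i))" by blast+
qed

lemma L_sum: "(\<And>i. i \<in> A \<Longrightarrow> f i \<in> L) \<Longrightarrow> sum f A \<in> L"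
  and sig_sum: "(\<And>i. i \<in> A \<Longrightarrow> f i \<in> L) \<Longrightarrow> sig k (sum f A) = (\<Sum>i\<in>A. sig k (f i))"
proof -
  have "sum f A \<in> L \<and> sig k (sum f A) = (\<Sum>i\<in>A. sig k (f i))" if "\<And>i. i \<in> A \<Longrightarrow> f i \<in> L"
    using that
    by (induction A rule: infinite_finite_induct)
      (auto simp: K_subset_L sig_K gauss_rat_closed L_add sig_add)
  then show "(\<And>i. i \<in> A \<Longrightarrow> f i \<in> L) \<Longrightarrow> sum f A \<in> L"
    "(\<And>i. i \<in> A \<Longrightarrow> f i \<in> L) \<Longrightarrow> sig k (sum f A) = (\<Sum>i\<in>A. sig k (f i))" by blast+
qed

lemma L_power: "x \<in> L \<Longrightarrow> x ^ m \<in> L"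
  and sig_power: "x \<in> L \<Longrightarrow> sig k (x ^ m) = sig k x ^ m"
  using L_prod[of "{..<m}" "\<lambda>_. x"] sig_prod[of "{..<m}" "\<lambda>_. x" k] by simp_all

lemma sig_inverse_shift: "x \<in> L \<Longrightarrow> sig ((n - 1) * k) (sig k x) = x"
proof -
  assume x: "x \<in> L"
  have "k + (n - 1) * k = n * k" using n by (cases n) auto
  then show ?thesis using x sig_mod[OF x, of "n * k"] by (simp add: sig_sig sig_0)
qed

lemma sig_eq_0_iff: "x \<in> L \<Longrightarrow> sig k x = 0 \<longleftrightarrow> x = 0"
  using sig_inverse_shift[of x k] sig_K[OF gauss_rat_closed(2)] by metis

lemma \<alpha>_in_L: "\<alpha> j \<in> L"
  and sig_\<alpha>: "sig k (\<alpha> j) = \<alpha> (j + k)"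
proof -
  define a :: "nat \<Rightarrow> complex" where "a = (\<lambda>i. if i = j mod n then 1 else 0)"
  have a: "a i \<in> gauss_rat" for i by (simp add: a_def gauss_rat_closed)
  have eq: "S m a = \<alpha> (j + m)" for m unfolding a_def using n by (simp add: S_unit \<alpha>_mod)
  show "\<alpha> j \<in> L" using S_in_L[of a 0, OF a] by (simp add: eq)
  show "sig k (\<alpha> j) = \<alpha> (j + k)" using sig_S[of a k 0, OF a] by (simp add: eq)
qed

text \<open>By uniqueness of coordinates, those of a fixed element are invariant under the shift of
  indices, hence all equal; \<open>\<alpha>_total\<close> then evaluates the element.\<close>

lemma sig_fixed_imp_K:
  assumes x: "x \<in> L" and fix1: "sig 1 x = x"
  shows "x \<in> gauss_rat"
proof -
  obtain a where a: "\<And>j. a j \<in> gauss_rat" and xa: "x = S 0 a" using x by (elim L_E) blast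
  have eq: "shift 1 a j = a j" if "j < n" for j
  proof (rule S_inj)
    show "S 0 (shift 1 a) = S 0 a" using fix1 a by (simp add: xa sig_S S_shift)
  qed (use a that in \<open>auto intro: shift_rat\<close>)
  have const: "a j = a 0" if "j < n" for j
    using that
  proof (induction j)
    case (Suc j)
    have "(Suc j + (n - 1) * 1) mod n = (j + n) mod n" using n by (cases n) auto
    then have "shift 1 a (Suc j) = a j" using Suc.prems by (simp add: shift_def)
    then show ?case using eq[OF Suc.prems] Suc by simp
  qed simp
  have "x = S 0 (\<lambda>_. a 0)" unfolding xa by (rule S_cong) (rule const)
  then have "x = a 0 * of_nat n" by (simp add: S_const)
  then show ?thesis using a by (simp add: gauss_rat_closed Rats_subset_gauss_rat)
qed

definition Nm :: "complex \<Rightarrow> complex" where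
  "Nm x = (\<Prod>k<n. sig k x)"

lemma Nm_K:
  assumes x: "x \<in> L"
  shows "Nm x \<in> gauss_rat"
proof (rule sig_fixed_imp_K)
  show "Nm x \<in> L" unfolding Nm_def using x by (intro L_prod sig_in_L)
  have "sig 1 (Nm x) = (\<Prod>k<n. sig (Suc k) x)"
    unfolding Nm_def using x by (subst sig_prod) (auto simp: sig_in_L sig_sig)
  also have "\<dots> = (\<Prod>k<n - 1. sig (Suc k) x) * sig n x"
    using n by (simp add: prod_lessThan_last[OF n, of "\<lambda>k. sig (Suc k) x"])
  also have "sig n x = sig 0 x" using sig_period[OF x, of 0] by simp
  also have "(\<Prod>k<n - 1. sig (Suc k) x) * sig 0 x = Nm x"
    unfolding Nm_def prod_lessThan_first[OF n] by (simp add: mult.commute)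
  finally show "sig 1 (Nm x) = Nm x" .
qed

text \<open>Inverses come from the norm: the product of the other conjugates of \<open>x\<close>,
  divided by the nonzero element \<open>Nm x\<close> of the base field.\<close>

lemma subfield_L: "subfield L CC"
proof (rule subfield_CC_I)
  fix x assume x: "x \<in> L" "x \<noteq> 0"
  define y where "y = (\<Prod>k<n - 1. sig (Suc k) x)"
  have y: "y \<in> L" unfolding y_def using x by (intro L_prod sig_in_L)
  have "Nm x = x * y"
    unfolding Nm_def prod_lessThan_first[OF n] y_def using x by (simp add: sig_0)
  moreover have "Nm x \<noteq> 0" unfolding Nm_def using x by (simp add: sig_eq_0_iff)
  ultimately have "inverse x = y * inverse (Nm x)" using x by (simp add: field_simps)
  moreover have "y * inverse (Nm x) \<in> L"
    by (intro L_mult y K_subset_L gauss_rat_closed(4) Nm_K x)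
  ultimately show "inverse x \<in> L" by simp
qed (auto simp: L_add L_mult L_minus K_subset_L gauss_rat_closed)

end

section \<open>Linear combinations, spans and dimension as finite sums\<close>

text \<open>\<open>combine\<close> stops at the end of the shorter list, so missing coefficients
  count as 0.\<close>

lemma combine_CC:
  "ring.combine CC Ks Us = (\<Sum>j<length Us. (if j < length Ks then Ks ! j else 0) * Us ! j)"
proof (induction Us arbitrary: Ks)
  case Nil
  show ?case by (cases Ks) (simp_all add: ring.combine.simps[OF ring_CC])
next
  case (Cons u Us)
  show ?case
  proof (cases Ks)
    case Nil
    then show ?thesis by (simp add: ring.combine.simps[OF ring_CC])
  next
    case K: (Cons k Ks')
    have "ring.combine CC Ks (u # Us) = k * u + ring.combine CC Ks' Us"
      by (simp add: K ring.combine.simps[OF ring_CC])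
    then show ?thesis
      by (simp add: Cons.IH K sum.lessThan_Suc_shift del: sum.lessThan_Suc cong: if_cong)
  qed
qed

lemma independent_CC_I:
  assumes K: "subfield K CC"
    and indep: "\<And>a j. (\<And>j. a j \<in> K) \<Longrightarrow> (\<Sum>j<n. a j * u j) = 0 \<Longrightarrow> j < n \<Longrightarrow> a j = 0"
  shows "ring.independent CC K (map u [0..<n])"
proof (rule ring.trivial_combine_imp_independent[OF ring_CC K])
  fix Ks assume Ks: "set Ks \<subseteq> K" and comb: "ring.combine CC Ks (map u [0..<n]) = \<zero>\<^bsub>CC\<^esub>"
  define a where "a j = (if j < length Ks then Ks ! j else 0)" for j
  have aK: "a j \<in> K" for j
    using Ks subfield_CC_D(2)[OF K] by (auto simp: a_def)
  have 0: "(\<Sum>j<n. a j * u j) = 0" using comb by (simp add: combine_CC a_def)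
  have a0: "a j = 0" if "j < n" for j by (rule indep[of a j, OF aK 0 that])
  show "set (take (length (map u [0..<n])) Ks) \<subseteq> {\<zero>\<^bsub>CC\<^esub>}"
  proof
    fix x assume "x \<in> set (take (length (map u [0..<n])) Ks)"
    then obtain j where "j < n" "j < length Ks" "x = Ks ! j"
      by (auto simp: in_set_conv_nth)
    then show "x \<in> {\<zero>\<^bsub>CC\<^esub>}" using a0[of j] by (simp add: a_def)
  qed
qed simp

lemma Span_CC:
  assumes K: "subfield K CC"
  shows "ring.Span CC K (map u [0..<n]) = {(\<Sum>j<n. a j * u j) | a. \<forall>j. a j \<in> K}"
proof -
  have "ring.Span CC K (map u [0..<n]) = {ring.combine CC Ks (map u [0..<n]) | Ks. set Ks \<subseteq> K}"
    by (rule ring.Span_eq_combine_set[OF ring_CC K]) simp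
  also have "\<dots> = {(\<Sum>j<n. a j * u j) | a. \<forall>j. a j \<in> K}" (is "?A = ?B")
  proof (intro equalityI subsetI)
    fix x assume "x \<in> ?A"
    then obtain Ks where Ks: "set Ks \<subseteq> K" "x = ring.combine CC Ks (map u [0..<n])" by blast
    have "x = (\<Sum>j<n. (if j < length Ks then Ks ! j else 0) * u j)"
      by (simp add: Ks(2) combine_CC)
    moreover have "(if j < length Ks then Ks ! j else 0) \<in> K" for j
      using Ks(1) subfield_CC_D(2)[OF K] by auto
    ultimately show "x \<in> ?B"
      by (intro CollectI exI[of _ "\<lambda>j. if j < length Ks then Ks ! j else 0"]) simp
  next
    fix x assume "x \<in> ?B"
    then obtain a where a: "\<And>j. a j \<in> K" "x = (\<Sum>j<n. a j * u j)" by blast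
    have "x = ring.combine CC (map a [0..<n]) (map u [0..<n])"
      by (simp add: a(2) combine_CC)
    then show "x \<in> ?A" using a(1) by (intro CollectI exI[of _ "map a [0..<n]"]) auto
  qed
  finally show ?thesis .
qed

lemma dimension_CC_I:
  assumes K: "subfield K CC"
    and indep: "\<And>a j. (\<And>j. a j \<in> K) \<Longrightarrow> (\<Sum>j<n. a j * u j) = 0 \<Longrightarrow> j < n \<Longrightarrow> a j = 0"
    and E: "E = {(\<Sum>j<n. a j * u j) | a. \<forall>j. a j \<in> K}"
  shows "ring.dimension CC n K E"
proof -
  have "ring.independent CC K (map u [0..<n])"
    by (rule independent_CC_I[OF K]) (rule indep)
  then show ?thesis
    using ring.dimensionI[OF ring_CC K _ Span_CC[OF K], of u n] by (simp add: E)
qed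

lemma subfield_Rats: "subfield \<rat> CC"
  by (rule subfield_CC_I) auto

lemma Complex_Rats: "a \<in> \<rat> \<Longrightarrow> Re a \<in> \<rat> \<and> Im a = 0"
proof -
  assume "a \<in> \<rat>"
  then obtain r s where "a = of_int r / of_int s" by (elim Rats_cases')
  then have "a = complex_of_real (of_int r / of_int s)" by simp
  then show ?thesis by (simp only:) simp
qed

lemma imaginary_quadratic_gauss_rat: "imaginary_quadratic gauss_rat"
proof -
  let ?u = "\<lambda>j::nat. if j = 0 then 1 else \<i>"
  have sum: "(\<Sum>j<2. a j * ?u j) = a 0 + a 1 * \<i>" for a :: "nat \<Rightarrow> complex"
    by (simp add: numeral_2_eq_2)
  have "ring.dimension CC 2 \<rat> gauss_rat"
  proof (rule dimension_CC_I[where u = ?u, OF subfield_Rats])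
    fix a :: "nat \<Rightarrow> complex" and j :: nat
    assume a: "\<And>j. a j \<in> \<rat>" and 0: "(\<Sum>j<2. a j * ?u j) = 0" and j: "j < 2"
    have "a 0 = 0 \<and> a 1 = 0"
      using 0 Complex_Rats[OF a[of 0]] Complex_Rats[OF a[of 1]]
      unfolding sum by (simp add: complex_eq_iff)
    then show "a j = 0" using j by (auto simp: less_2_cases_iff)
  next
    show "gauss_rat = {(\<Sum>j<2. a j * ?u j) | a. \<forall>j. a j \<in> \<rat>}" (is "_ = ?B")
    proof (intro equalityI subsetI)
      fix x assume x: "x \<in> gauss_rat"
      define a where "a j = (if j = (0::nat) then complex_of_real (Re x) else complex_of_real (Im x))" for j
      have rat: "complex_of_real r \<in> \<rat>" if r: "r \<in> \<rat>" for r
      proof -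
        obtain s t where "r = of_int s / of_int t" using r Rats_cases' by metis
        then show ?thesis by simp
      qed
      have "x = (\<Sum>j<2. a j * ?u j)" unfolding sum by (simp add: a_def complex_eq_iff)
      moreover have "\<forall>j. a j \<in> \<rat>" using x rat by (auto simp: a_def gauss_rat_def)
      ultimately show "x \<in> ?B" by (intro CollectI exI[of _ a]) simp
    next
      fix x assume "x \<in> ?B"
      then obtain a where a: "\<And>j. a j \<in> \<rat>" and x: "x = (\<Sum>j<2. a j * ?u j)" by blast
      show "x \<in> gauss_rat" unfolding x sum
        by (intro gauss_rat_closed(5,6) Rats_subset_gauss_rat a gauss_int_subset_rat gauss_int_closed(3))
    qed
  qed
  moreover have "\<i> \<in> gauss_rat" by (intro gauss_int_subset_rat gauss_int_closed(3))
  then have "\<not> gauss_rat \<subseteq> \<real>" by (auto simp: complex_is_Real_iff)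
  moreover have "\<rat> \<subseteq> gauss_rat" by (rule subsetI) (rule Rats_subset_gauss_rat)
  ultimately show ?thesis
    unfolding imaginary_quadratic_def field_ext_def using subfield_Rats subfield_gauss_rat by blast
qed

context frobenius_basis
begin

lemma dimension_L: "ring.dimension CC n gauss_rat L"
proof (rule dimension_CC_I[where u = \<alpha>, OF subfield_gauss_rat])
  show "a j = 0" if "\<And>j. a j \<in> gauss_rat" "(\<Sum>j<n. a j * \<alpha> j) = 0" "j < n" for a j
    using S_eq_0[of a j] that by (simp add: S_def)
  show "L = {(\<Sum>j<n. a j * \<alpha> j) | a. \<forall>j. a j \<in> gauss_rat}"
    by (simp add: L_def S_def)
qed

lemma field_ext_L: "field_ext L gauss_rat n"
  unfolding field_ext_def using dimension_L subfield_L subfield_gauss_rat K_subset_L by blast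

lemma \<alpha>_inj: "i < n \<Longrightarrow> j < n \<Longrightarrow> \<alpha> i = \<alpha> j \<Longrightarrow> i = j"
proof (rule ccontr)
  assume ij: "i < n" "j < n" "\<alpha> i = \<alpha> j" "i \<noteq> j"
  define a :: "nat \<Rightarrow> nat \<Rightarrow> complex" where "a k = (\<lambda>m. if m = k then 1 else 0)" for k
  have S: "S 0 (a k) = \<alpha> k" if "k < n" for k
    unfolding a_def using S_unit[OF that, of 0] by simp
  have aK: "a k m \<in> gauss_rat" for k m by (simp add: a_def gauss_rat_closed)
  have "a i i = a j i" by (rule S_inj) (use ij S aK in auto)
  then show False using ij by (simp add: a_def)
qed

text \<open>A relation is a polynomial \<open>P\<close> of degree below \<open>n\<close> that
  vanishes at \<alpha> 0. The shift fixes its coefficients, so all the \<alpha> k are roots, and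
  these are \<open>n\<close> distinct numbers.\<close>

lemma powers_independent:
  assumes a: "\<And>j. a j \<in> gauss_rat" and 0: "(\<Sum>j<n. a j * \<alpha> 0 ^ j) = 0" and j: "j < n"
  shows "a j = 0"
proof -
  define P where "P = (\<Sum>j<n. monom (a j) j)"
  have coeffP: "coeff P i = (if i < n then a i else 0)" for i
    by (simp add: P_def coeff_sum)
  have root: "poly P (\<alpha> k) = 0" for k
  proof -
    have "poly P (\<alpha> k) = (\<Sum>j<n. a j * \<alpha> k ^ j)" by (simp add: P_def poly_sum poly_monom)
    also have "\<dots> = sig k (\<Sum>j<n. a j * \<alpha> 0 ^ j)"
      by (simp add: sig_sum sig_mult sig_K sig_power sig_\<alpha> a L_mult L_power K_subset_L \<alpha>_in_L)
    finally show ?thesis using 0 by (simp add: sig_K gauss_rat_closed)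
  qed
  have "P = 0"
  proof (rule ccontr)
    assume P: "P \<noteq> 0"
    have "degree P \<le> n - 1" by (rule degree_le) (auto simp: coeffP)
    then have deg: "degree P < n" using n by linarith
    have "n = card (\<alpha> ` {..<n})" by (subst card_image) (auto intro: inj_onI \<alpha>_inj)
    also have "\<dots> \<le> card {x. poly P x = 0}"
      using root P by (intro card_mono poly_roots_finite) auto
    also have "\<dots> \<le> degree P" using P by (rule poly_roots_degree)
    finally show False using deg by simp
  qed
  then show ?thesis using coeffP[of j] j by simp
qed

text \<open>The real generator is \<alpha> 0: its first \<open>n\<close> powers are independent, so
  they span the \<open>n\<close>-dimensional space \<open>L\<close>.\<close>

lemma L_generated: "L = generate_field CC (insert (\<alpha> 0) gauss_rat)"
proof
  let ?M = "generate_field CC (insert (\<alpha> 0) gauss_rat)"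
  show "?M \<subseteq> L"
    by (rule field.generate_field_min_subfield1[OF field_CC _ subfield_L])
      (auto intro: \<alpha>_in_L K_subset_L)
  have M: "subfield ?M CC" by (rule field.generate_field_is_subfield[OF field_CC]) simp
  note M' = subfield_CC_D[OF M]
  have ind: "ring.independent CC gauss_rat (map (\<lambda>j. \<alpha> 0 ^ j) [0..<n])"
    by (rule independent_CC_I[OF subfield_gauss_rat]) (rule powers_independent)
  have "ring.Span CC gauss_rat (map (\<lambda>j. \<alpha> 0 ^ j) [0..<n]) = L"
    using ring.independent_length_eq_dimension[OF ring_CC subfield_gauss_rat dimension_L ind]
    by (auto intro: L_power \<alpha>_in_L)
  then have L: "L = {(\<Sum>j<n. a j * \<alpha> 0 ^ j) | a. \<forall>j. a j \<in> gauss_rat}"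
    using Span_CC[OF subfield_gauss_rat] by metis
  have \<alpha>M: "\<alpha> 0 \<in> ?M" and KM: "\<And>x. x \<in> gauss_rat \<Longrightarrow> x \<in> ?M"
    by (auto intro: generate_field.incl)
  have pow: "\<alpha> 0 ^ j \<in> ?M" for j
    by (induction j) (simp_all add: M'(1) M'(5) \<alpha>M)
  have sum: "sum f A \<in> ?M" if "\<And>i. i \<in> A \<Longrightarrow> f i \<in> ?M" for f :: "nat \<Rightarrow> complex" and A
    using that by (induction A rule: infinite_finite_induct) (simp_all add: M'(2) M'(6))
  show "L \<subseteq> ?M"
  proof
    fix x assume "x \<in> L"
    then obtain a where a: "\<And>j. a j \<in> gauss_rat" "x = (\<Sum>j<n. a j * \<alpha> 0 ^ j)"
      unfolding L by blast
    show "x \<in> ?M" unfolding a(2) by (intro sum M'(5) pow KM a(1))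
  qed
qed

section \<open>The Galois group of \<open>L\<close>\<close>

text \<open>The restriction produces the extensional representative that membership in
  \<open>Gal\<close> demands.\<close>

definition gal :: "nat \<Rightarrow> complex \<Rightarrow> complex" where
  "gal k = restrict (sig k) L"

lemma gal_eq: "x \<in> L \<Longrightarrow> gal k x = sig k x"
  by (simp add: gal_def)

lemma gal_mod: "gal (k mod n) = gal k"
  unfolding gal_def by (rule restrict_ext) (rule sig_mod)

lemma gal_in_Bij: "gal k \<in> Bij L"
proof -
  have "bij_betw (sig k) L L"
  proof (rule bij_betw_byWitness[where f' = "sig ((n - 1) * k)"])
    have "(n - 1) * k + k = n * k" using n by (cases n) auto
    then show "\<forall>x\<in>L. sig k (sig ((n - 1) * k) x) = x"
      using sig_mod[of _ "n * k"] by (simp add: sig_sig sig_0)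
    show "\<forall>x\<in>L. sig ((n - 1) * k) (sig k x) = x" using sig_inverse_shift by blast
  qed (auto simp: sig_in_L)
  then have "bij_betw (gal k) L L"
    using bij_betw_cong[of L "gal k" "sig k" L] gal_eq by blast
  then show ?thesis by (simp add: Bij_def gal_def)
qed

lemma gal_in_Gal: "gal k \<in> carrier (Gal L gauss_rat)"
proof -
  have "gal k \<in> Ring.ring_hom (CC\<lparr>carrier := L\<rparr>) (CC\<lparr>carrier := L\<rparr>)"
    by (rule ring_hom_memI)
      (auto simp: gal_eq sig_in_L L_mult L_add sig_mult sig_add K_subset_L sig_K gauss_rat_closed)
  then show ?thesis
    using gal_in_Bij by (simp add: Gal_def gal_eq K_subset_L sig_K)
qed

lemma Gal_mult: "gal j \<otimes>\<^bsub>Gal L gauss_rat\<^esub> gal k = gal (j + k)"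
proof -
  have "gal j \<otimes>\<^bsub>Gal L gauss_rat\<^esub> gal k = compose L (gal j) (gal k)"
    by (simp add: Gal_def BijGroup_def gal_in_Bij)
  also have "\<dots> = gal (j + k)"
    by (auto simp: compose_def gal_def restrict_def sig_in_L sig_sig add.commute)
  finally show ?thesis .
qed

lemma Gal_one: "\<one>\<^bsub>Gal L gauss_rat\<^esub> = gal 0"
  by (auto simp: Gal_def BijGroup_def gal_def restrict_def sig_0)

text \<open>On the basis element \<alpha> i the combination takes the value \<open>S i C\<close>, so
  the dual family extracts each \<open>C j\<close> up to the factor \<open>d\<close>.\<close>

lemma sig_linearly_independent:
  assumes 0: "\<And>y. y \<in> L \<Longrightarrow> (\<Sum>m<n. C m * sig m y) = 0" and j: "j < n"
  shows "C j = 0"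
proof -
  have "0 = (\<Sum>i<n. (\<Sum>m<n. C m * sig m (\<alpha> i)) * \<alpha>' (j + i))"
    using 0[OF \<alpha>_in_L] by simp
  also have "\<dots> = (\<Sum>i<n. S i C * \<alpha>' (j + i))"
    by (simp add: sig_\<alpha> S_def add.commute)
  also have "\<dots> = of_int d * C j" by (rule S_dual[OF j])
  finally show ?thesis using d_nz by simp
qed

text \<open>Every automorphism is a combination of the powers of \<open>\<sigma>\<close>, by the dual basis; by Dedekind's
  independence argument, it can involve only one of them.\<close>

lemma Gal_imp_gal:
  assumes f: "f \<in> carrier (Gal L gauss_rat)"
  shows "\<exists>m. f = gal m"
proof -
  have hom: "f \<in> Ring.ring_hom (CC\<lparr>carrier := L\<rparr>) (CC\<lparr>carrier := L\<rparr>)" and bij: "f \<in> Bij L"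
    and fK: "\<And>x. x \<in> gauss_rat \<Longrightarrow> f x = x"
    using f by (auto simp: Gal_def)
  have fmult: "f (x * y) = f x * f y" and fadd: "f (x + y) = f x + f y" if "x \<in> L" "y \<in> L" for x y
    using ring_hom_mult[OF hom, of x y] ring_hom_add[OF hom, of x y] that by simp_all
  have fsum: "f (sum h A) = (\<Sum>i\<in>A. f (h i))" if "\<And>i. i \<in> A \<Longrightarrow> h i \<in> L"
    for h :: "nat \<Rightarrow> complex" and A
    using that by (induction A rule: infinite_finite_induct)
      (auto simp: fK gauss_rat_closed fadd L_sum)
  \<comment> \<open>\<open>S_dual\<close> writes \<open>d\<close> times each coordinate of
    \<open>x\<close> through the conjugates of \<open>x\<close>; inserted into the expansion of
    \<open>f x\<close>, it gives these coefficients.\<close>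
  define C where "C m = (\<Sum>i<n. f (\<alpha> i) * \<alpha>' (i + m))" for m
  have comb: "of_int d * f x = (\<Sum>m<n. C m * sig m x)" if x: "x \<in> L" for x
  proof -
    obtain a where a: "\<And>j. a j \<in> gauss_rat" and xa: "x = S 0 a" using x by (elim L_E) blast
    have "(\<Sum>m<n. C m * sig m x) = (\<Sum>m<n. \<Sum>i<n. f (\<alpha> i) * (S m a * \<alpha>' (i + m)))"
      by (simp add: xa sig_S a C_def sum_distrib_right sum_distrib_left mult_ac)
    also have "\<dots> = (\<Sum>i<n. \<Sum>m<n. f (\<alpha> i) * (S m a * \<alpha>' (i + m)))"
      by (rule sum.swap)
    also have "\<dots> = (\<Sum>i<n. f (\<alpha> i) * (of_int d * a i))"
      by (intro sum.cong refl) (simp add: S_dual flip: sum_distrib_left)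
    also have "\<dots> = of_int d * (\<Sum>i<n. f (a i * \<alpha> i))"
      by (simp add: sum_distrib_left fmult a K_subset_L \<alpha>_in_L fK mult_ac)
    also have "(\<Sum>i<n. f (a i * \<alpha> i)) = f x"
      unfolding xa S_def by (subst fsum) (auto simp: a K_subset_L \<alpha>_in_L L_mult)
    finally show ?thesis by simp
  qed
  \<comment> \<open>Expand \<open>f (x * y)\<close> and subtract \<open>f x\<close> times the
    expansion of \<open>f y\<close>. The left-hand sides cancel, and a relation between the powers
    of \<sigma>, valid for every \<open>y\<close>, remains.\<close>
  have key: "C m * (sig m x - f x) = 0" if x: "x \<in> L" and m: "m < n" for x m
  proof (rule sig_linearly_independent[of "\<lambda>m. C m * (sig m x - f x)", OF _ m])
    fix y assume y: "y \<in> L"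
    have "(\<Sum>m<n. C m * (sig m x - f x) * sig m y) =
        (\<Sum>m<n. C m * sig m (x * y)) - f x * (\<Sum>m<n. C m * sig m y)"
      by (simp add: sig_mult x y sum_subtractf[symmetric] sum_distrib_left algebra_simps)
    also have "\<dots> = of_int d * f (x * y) - f x * (of_int d * f y)"
      by (simp add: comb x y L_mult)
    also have "\<dots> = 0" by (simp add: fmult x y)
    finally show "(\<Sum>m<n. C m * (sig m x - f x) * sig m y) = 0" .
  qed
  have "\<exists>m<n. C m \<noteq> 0"
  proof (rule ccontr)
    assume "\<not> (\<exists>m<n. C m \<noteq> 0)"
    then have "of_int d * f 1 = 0" using comb[of 1] K_subset_L gauss_rat_closed(1) by simp
    then show False using d_nz fK gauss_rat_closed(1) by simp
  qed
  then obtain m where m: "m < n" "C m \<noteq> 0" by blast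
  have eq: "f x = gal m x" if x: "x \<in> L" for x using key[OF x m(1)] m(2) x by (simp add: gal_eq)
  have ext: "f \<in> extensional L" "gal m \<in> extensional L" using bij by (auto simp: Bij_def gal_def)
  have "f = gal m" by (rule extensionalityI[OF ext eq])
  then show ?thesis ..
qed

lemma carrier_Gal: "carrier (Gal L gauss_rat) = range gal"
  using gal_in_Gal Gal_imp_gal by blast

lemma group_Gal: "group (Gal L gauss_rat)"
proof (rule groupI)
  fix f assume "f \<in> carrier (Gal L gauss_rat)"
  then obtain k where f: "f = gal k" using carrier_Gal by auto
  have "(n - 1) * k + k = n * k" using n by (cases n) auto
  then have "gal ((n - 1) * k) \<otimes>\<^bsub>Gal L gauss_rat\<^esub> f = \<one>\<^bsub>Gal L gauss_rat\<^esub>"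
    using gal_mod[of "n * k"] by (simp add: f Gal_mult Gal_one)
  then show "\<exists>g\<in>carrier (Gal L gauss_rat). g \<otimes>\<^bsub>Gal L gauss_rat\<^esub> f = \<one>\<^bsub>Gal L gauss_rat\<^esub>"
    using gal_in_Gal by blast
qed (auto simp: carrier_Gal Gal_mult Gal_one add.assoc)

lemma generate_Gal: "carrier (Gal L gauss_rat) = generate (Gal L gauss_rat) {gal 1}"
proof
  show "generate (Gal L gauss_rat) {gal 1} \<subseteq> carrier (Gal L gauss_rat)"
    by (rule group.generate_incl[OF group_Gal]) (simp add: gal_in_Gal)
  have "gal k \<in> generate (Gal L gauss_rat) {gal 1}" for k
  proof (induction k)
    case 0
    show ?case using generate.one[of "Gal L gauss_rat"] by (simp add: Gal_one)
  next
    case (Suc k)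
    have "gal k \<otimes>\<^bsub>Gal L gauss_rat\<^esub> gal 1 \<in> generate (Gal L gauss_rat) {gal 1}"
      by (intro generate.eng Suc generate.incl) simp
    then show ?case by (simp add: Gal_mult)
  qed
  then show "carrier (Gal L gauss_rat) \<subseteq> generate (Gal L gauss_rat) {gal 1}"
    by (auto simp: carrier_Gal)
qed

lemma galois_ext_L: "galois_ext L gauss_rat n"
proof -
  have "{x \<in> L. \<forall>f \<in> carrier (Gal L gauss_rat). f x = x} = gauss_rat"
  proof (intro equalityI subsetI)
    fix x assume x: "x \<in> {x \<in> L. \<forall>f \<in> carrier (Gal L gauss_rat). f x = x}"
    then have "sig 1 x = x" using gal_in_Gal[of 1] gal_eq[of x 1] by auto
    then show "x \<in> gauss_rat" using x sig_fixed_imp_K by blast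
  next
    fix x assume "x \<in> gauss_rat"
    then show "x \<in> {x \<in> L. \<forall>f \<in> carrier (Gal L gauss_rat). f x = x}"
      by (auto simp: carrier_Gal gal_eq K_subset_L sig_K)
  qed
  then show ?thesis using field_ext_L by (simp add: galois_ext_def)
qed

section \<open>Frobenius on the integers of \<open>L\<close> and inertness of
  \<open>p\<close>\<close>

lemma sig_algebraic_int:
  assumes x: "x \<in> L" and ai: "algebraic_int x"
  shows "algebraic_int (sig k x)"
proof -
  obtain P :: "int poly" where P: "poly (map_poly of_int P) x = 0" "lead_coeff P = 1"
    using ai algebraic_int_altdef_ipoly by blast
  have K: "of_int c \<in> gauss_rat" for c by (rule gauss_int_subset_rat[OF gauss_int_closed(4)])
  have "poly (map_poly of_int P) (sig k x) = (\<Sum>i\<le>degree P. of_int (coeff P i) * sig k x ^ i)"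
    by (simp add: poly_altdef degree_map_poly coeff_map_poly)
  also have "\<dots> = sig k (\<Sum>i\<le>degree P. of_int (coeff P i) * x ^ i)"
    by (simp add: sig_sum sig_mult sig_K sig_power x K L_mult L_power K_subset_L)
  also have "(\<Sum>i\<le>degree P. of_int (coeff P i) * x ^ i) = poly (map_poly of_int P) x"
    by (simp add: poly_altdef degree_map_poly coeff_map_poly)
  finally have "poly (map_poly of_int P) (sig k x) = 0"
    by (simp add: P(1) sig_K gauss_rat_closed)
  then show ?thesis using P(2) algebraic_int_altdef_ipoly by blast
qed

lemma sig_frob:
  assumes x: "x \<in> L" and ai: "algebraic_int x"
  shows "int_cong p (x ^ l) (sig 1 x)"
proof -
  obtain a where a: "\<And>j. a j \<in> gauss_rat" and xa: "x = S 0 a" using x by (elim L_E) blast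
  \<comment> \<open>The coordinates of an algebraic integer of \<open>L\<close> may have
    denominators, but by \<open>S_dual\<close> these divide \<open>d\<close>. So
    \<open>S_frob\<close> is applied to \<open>d * x\<close>, and \<open>d\<close> is cancelled at
    the end.\<close>
  define b where "b j = of_int d * a j" for j
  have b: "b j \<in> gauss_int" if j: "j < n" for j
  proof (rule gauss_rat_algebraic_int)
    show "b j \<in> gauss_rat"
      unfolding b_def by (intro gauss_rat_closed(5) a gauss_int_subset_rat[OF gauss_int_closed(4)])
    have "b j = (\<Sum>k<n. sig k x * \<alpha>' (j + k))" using S_dual[OF j, of a] by (simp add: b_def xa sig_S a)
    then show "algebraic_int (b j)"
      using sig_algebraic_int[OF x ai] \<alpha>'_int by (auto intro!: algebraic_int_sum algebraic_int_times)
  qed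
  have Sb: "S k b = of_int d * sig k x" for k
    unfolding b_def S_scale by (simp add: xa sig_S a)
  have "int_cong p (of_int d * x ^ l) (of_int d ^ l * x ^ l)"
    using gauss_fermat[of "of_int d"] ai
    by (intro int_cong_mult int_cong_sym[of _ "of_int d ^ l"] int_cong_refl algebraic_int_power)
      (auto simp: gauss_int_closed)
  also have "of_int d ^ l * x ^ l = S 0 b ^ l"
    using x by (simp add: Sb sig_0 power_mult_distrib)
  also have "int_cong p (S 0 b ^ l) (S (Suc 0) b)" by (rule S_frob[OF b])
  also have "S (Suc 0) b = of_int d * sig 1 x" by (simp add: Sb)
  finally have "int_cong p (of_int d * x ^ l) (of_int d * sig 1 x)" .
  then have "int_cong p (of_int d * (x ^ l - sig 1 x)) 0"
    by (simp add: int_cong_def right_diff_distrib)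
  then have "int_cong p (x ^ l - sig 1 x) 0"
    by (rule p_cong_cancel_d)
      (intro algebraic_int_diff algebraic_int_power sig_algebraic_int ai x)
  then show ?thesis by (simp add: int_cong_def)
qed

lemma sig_frob_power:
  assumes x: "x \<in> L" and ai: "algebraic_int x"
  shows "int_cong p (x ^ (l ^ k)) (sig k x)"
proof (induction k)
  case 0
  show ?case using x by (simp add: sig_0)
next
  case (Suc k)
  have "int_cong p ((x ^ (l ^ k)) ^ l) (sig k x ^ l)"
    using x ai by (intro int_cong_power Suc algebraic_int_power sig_algebraic_int)
  also have "int_cong p (sig k x ^ l) (sig 1 (sig k x))"
    using x ai by (intro sig_frob sig_in_L sig_algebraic_int)
  finally show ?case using x by (simp add: sig_sig mult.commute flip: power_mult)
qed

text \<open>Compares the exponent of the norm congruence with \<open>l ^ n\<close>, so that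
  \<open>x ^ (l ^ n)\<close> is a multiple of the power of \<open>x\<close> congruent to the
  norm.\<close>

lemma geometric_le: "(\<Sum>k<m. l ^ k) \<le> l ^ m"
proof (induction m)
  case (Suc m)
  have "(\<Sum>k<Suc m. l ^ k) \<le> 2 * l ^ m" using Suc by simp
  also have "\<dots> \<le> l * l ^ m" using l_gt_1 by (intro mult_right_mono) auto
  finally show ?case by simp
qed simp

lemma cong_0_if_Nm_cong_0:
  assumes x: "x \<in> L" and ai: "algebraic_int x" and Nm: "int_cong p (Nm x) 0"
  shows "int_cong p x 0"
proof -
  define M where "M = (\<Sum>k<n. l ^ k)"
  have "int_cong p (\<Prod>k<n. x ^ (l ^ k)) (\<Prod>k<n. sig k x)"
    using x ai by (intro int_cong_prod sig_frob_power algebraic_int_power sig_algebraic_int)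
  then have "int_cong p (x ^ M) 0"
    using Nm int_cong_trans by (simp add: M_def power_sum Nm_def)
  then have "int_cong p (x ^ (l ^ n - M) * x ^ M) 0"
    using ai by (intro int_cong_0_mult algebraic_int_power)
  then have "int_cong p (x ^ (l ^ n)) 0"
    using geometric_le[of n] by (simp add: M_def flip: power_add)
  moreover have "int_cong p x (x ^ (l ^ n))"
    using int_cong_sym[OF sig_frob_power[OF x ai, of n]] sig_period[OF x, of 0] x by (simp add: sig_0)
  ultimately show ?thesis using int_cong_trans by blast
qed

text \<open>Divisibility by \<open>p\<close> among all algebraic integers is divisibility in the
  integers of \<open>L\<close>, since \<open>y / p\<close> stays in the field. This is the bridge
  from congruences to ideals.\<close>

lemma PIdl_L: "y \<in> PIdl\<^bsub>int_ring_of L\<^esub> p \<longleftrightarrow> y \<in> L \<and> int_cong p y 0"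
proof
  have pL: "p \<in> L" using p_gauss by (intro K_subset_L gauss_int_subset_rat)
  show "y \<in> L \<and> int_cong p y 0" if "y \<in> PIdl\<^bsub>int_ring_of L\<^esub> p"
    using that p_nz pL by (auto simp: PIdl_int_ring_of int_cong_def L_mult)
  show "y \<in> PIdl\<^bsub>int_ring_of L\<^esub> p" if y: "y \<in> L \<and> int_cong p y 0"
  proof -
    have "y / p \<in> L" unfolding divide_inverse
      by (rule L_mult[OF conjunct1[OF y]
            K_subset_L[OF gauss_rat_closed(4)[OF gauss_int_subset_rat[OF p_gauss]]]])
    moreover have "algebraic_int (y / p)" using y by (simp add: int_cong_def)
    moreover have "y = y / p * p" using p_nz by simp
    ultimately show ?thesis unfolding PIdl_int_ring_of by blast
  qed
qed

text \<open>The norm of \<open>x * y\<close> contains the factor \<open>x * y\<close>, so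
  \<open>p\<close> divides it in Z[i]; there \<open>p\<close> is prime and divides one of the two
  norms.\<close>

lemma Nm_cong_0_if:
  assumes x: "x \<in> L" "algebraic_int x" and y: "y \<in> L" "algebraic_int y"
    and xy: "int_cong p (x * y) 0"
  shows "int_cong p (Nm x) 0 \<or> int_cong p (Nm y) 0"
proof -
  have Nm_gauss: "Nm z \<in> gauss_int" if z: "z \<in> L" "algebraic_int z" for z
    using z by (intro gauss_rat_algebraic_int Nm_K)
      (auto simp: Nm_def intro!: algebraic_int_prod sig_algebraic_int)
  have "Nm x * Nm y = (\<Prod>k<n. sig k (x * y))"
    using x y by (simp add: Nm_def sig_mult prod.distrib)
  also have "\<dots> = (\<Prod>k<n - 1. sig (Suc k) (x * y)) * (x * y)"
    unfolding prod_lessThan_first[OF n] using x y by (simp add: sig_0 L_mult mult.commute)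
  finally have "int_cong p (Nm x * Nm y) 0"
    using x y xy
    by (simp add: int_cong_0_mult algebraic_int_prod sig_algebraic_int algebraic_int_times L_mult)
  then have ai: "algebraic_int (Nm x * Nm y / p)" by (simp add: int_cong_def)
  have "Nm x * Nm y / p \<in> gauss_rat" unfolding divide_inverse
    using x y p_gauss by (intro gauss_rat_closed(4,5) Nm_K gauss_int_subset_rat)
  then have "Nm x * Nm y / p \<in> gauss_int" using ai by (rule gauss_rat_algebraic_int)
  moreover have "Nm x * Nm y = p * (Nm x * Nm y / p)" using p_nz by simp
  ultimately have "(\<exists>u\<in>gauss_int. Nm x = p * u) \<or> (\<exists>u\<in>gauss_int. Nm y = p * u)"
    using Nm_gauss x y by (intro p_prime) blast+
  then show ?thesis using p_nz gauss_int_algebraic_int by (auto simp: int_cong_def)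
qed

lemma PIdl_gauss: "PIdl\<^bsub>int_ring_of gauss_rat\<^esub> p = (\<lambda>x. p * x) ` gauss_int"
  unfolding PIdl_int_ring_of using carrier_int_ring_of_gauss_rat by (auto simp: mult.commute)

lemma inert_prime_p: "inert_prime L gauss_rat p"
proof -
  have pK: "p \<in> gauss_rat" and p_ai: "algebraic_int p"
    using p_gauss by (auto intro: gauss_int_subset_rat gauss_int_algebraic_int)
  have K: "primeideal (PIdl\<^bsub>int_ring_of gauss_rat\<^esub> p) (int_ring_of gauss_rat)"
  proof (rule primeidealI)
    show R: "cring (int_ring_of gauss_rat)" by (rule cring_int_ring_of[OF subfield_gauss_rat])
    show "ideal (PIdl\<^bsub>int_ring_of gauss_rat\<^esub> p) (int_ring_of gauss_rat)"
      by (rule cring.cgenideal_ideal[OF R]) (simp add: int_ring_of_def pK p_ai)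
    have "1 \<notin> PIdl\<^bsub>int_ring_of gauss_rat\<^esub> p"
      unfolding PIdl_gauss using p_nonunit by (metis (no_types, lifting) imageE)
    moreover have "1 \<in> carrier (int_ring_of gauss_rat)"
      by (simp add: int_ring_of_def gauss_rat_closed)
    ultimately show "carrier (int_ring_of gauss_rat) \<noteq> PIdl\<^bsub>int_ring_of gauss_rat\<^esub> p" by blast
    fix a b assume ab: "a \<in> carrier (int_ring_of gauss_rat)" "b \<in> carrier (int_ring_of gauss_rat)"
      "a \<otimes>\<^bsub>int_ring_of gauss_rat\<^esub> b \<in> PIdl\<^bsub>int_ring_of gauss_rat\<^esub> p"
    have "a \<in> gauss_int" "b \<in> gauss_int"
      using ab(1,2) carrier_int_ring_of_gauss_rat by (auto simp: int_ring_of_def)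
    moreover have "\<exists>x\<in>gauss_int. a * b = p * x"
      using ab(3) unfolding PIdl_gauss by (auto simp: int_ring_of_def)
    ultimately show "a \<in> PIdl\<^bsub>int_ring_of gauss_rat\<^esub> p \<or> b \<in> PIdl\<^bsub>int_ring_of gauss_rat\<^esub> p"
      unfolding PIdl_gauss using p_prime by blast
  qed
  have L: "primeideal (PIdl\<^bsub>int_ring_of L\<^esub> p) (int_ring_of L)"
  proof (rule primeidealI)
    show R: "cring (int_ring_of L)" by (rule cring_int_ring_of[OF subfield_L])
    show "ideal (PIdl\<^bsub>int_ring_of L\<^esub> p) (int_ring_of L)"
      by (rule cring.cgenideal_ideal[OF R]) (simp add: int_ring_of_def pK p_ai K_subset_L)
    have "1 \<notin> PIdl\<^bsub>int_ring_of L\<^esub> p"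
    proof
      assume "1 \<in> PIdl\<^bsub>int_ring_of L\<^esub> p"
      then have "algebraic_int (1 / p)" using PIdl_L by (simp add: int_cong_def)
      moreover have "1 / p \<in> gauss_rat" using gauss_rat_closed(4)[OF pK] by (simp add: divide_inverse)
      ultimately have "1 / p \<in> gauss_int" by (intro gauss_rat_algebraic_int)
      then show False using p_nonunit[of "1 / p"] p_nz by simp
    qed
    moreover have "1 \<in> carrier (int_ring_of L)"
      by (simp add: int_ring_of_def gauss_rat_closed K_subset_L)
    ultimately show "carrier (int_ring_of L) \<noteq> PIdl\<^bsub>int_ring_of L\<^esub> p" by blast
    fix a b assume ab: "a \<in> carrier (int_ring_of L)" "b \<in> carrier (int_ring_of L)"
      "a \<otimes>\<^bsub>int_ring_of L\<^esub> b \<in> PIdl\<^bsub>int_ring_of L\<^esub> p"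
    have a: "a \<in> L" "algebraic_int a" and b: "b \<in> L" "algebraic_int b"
      using ab(1,2) by (auto simp: int_ring_of_def)
    have "int_cong p (a * b) 0" using ab(3) unfolding PIdl_L by (simp add: int_ring_of_def)
    then have "int_cong p (Nm a) 0 \<or> int_cong p (Nm b) 0" by (rule Nm_cong_0_if[OF a b])
    then show "a \<in> PIdl\<^bsub>int_ring_of L\<^esub> p \<or> b \<in> PIdl\<^bsub>int_ring_of L\<^esub> p"
      unfolding PIdl_L using cong_0_if_Nm_cong_0 a b by blast
  qed
  show ?thesis
    unfolding inert_prime_def using K L p_nz pK p_ai by (simp add: int_ring_of_def)
qed

theorem suitable_data_L:
  assumes "n = U * nt"
  shows "suitable_data U nt gauss_rat L p (gal 1)"
  unfolding suitable_data_def
  using imaginary_quadratic_gauss_rat class_number_gauss_rat galois_ext_L L_generated \<alpha>_real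
    gal_in_Gal generate_Gal inert_prime_p assms by blast

end

section \<open>Averaging over the units modulo n\<close>

definition root1 :: "nat \<Rightarrow> complex" where
  "root1 n = cis (2 * pi / real n)"

definition units_mod :: "nat \<Rightarrow> nat set" where
  "units_mod n = {w. w < n \<and> coprime w n}"

lemma finite_units_mod [simp]: "finite (units_mod n)"
  by (simp add: units_mod_def)

lemma root1_power: "root1 n ^ k = cis (2 * pi * real k / real n)"
  by (simp add: root1_def Complex.DeMoivre mult_ac)

lemma root1_power_n: "n > 0 \<Longrightarrow> root1 n ^ n = 1"
  by (simp add: root1_power)

lemma root1_power_mod: "n > 0 \<Longrightarrow> root1 n ^ (k mod n) = root1 n ^ k"
proof -
  assume n: "n > 0"
  have "root1 n ^ k = root1 n ^ (k mod n + n * (k div n))" by simp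
  also have "\<dots> = root1 n ^ (k mod n)"
    unfolding power_add power_mult root1_power_n[OF n] by simp
  finally show ?thesis by simp
qed

lemma root1_power_cong:
  assumes "n > 0" "[j = k] (mod n)"
  shows "root1 n ^ j = root1 n ^ k"
  using root1_power_mod[OF assms(1), of j] root1_power_mod[OF assms(1), of k] assms(2)
  by (simp add: cong_def)

lemma root1_inj: "n > 0 \<Longrightarrow> inj_on (\<lambda>k. root1 n ^ k) {..<n}"
  using bij_betw_roots_unity[of n] by (simp add: root1_power bij_betw_def)

lemma root1_power_eq_1_iff: "n > 0 \<Longrightarrow> root1 n ^ k = 1 \<longleftrightarrow> n dvd k"
proof
  assume n: "n > 0" and 1: "root1 n ^ k = 1"
  have "root1 n ^ (k mod n) = root1 n ^ 0" using 1 by (simp add: root1_power_mod n)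
  then have "k mod n = 0" using inj_onD[OF root1_inj[OF n], of "k mod n" 0] n by simp
  then show "n dvd k" by (rule mod_0_imp_dvd)
qed (auto simp: power_mult root1_power_n)

lemma root1_algebraic_int: "n > 0 \<Longrightarrow> algebraic_int (root1 n)"
  by (rule algebraic_int_root[where p = "monom 1 n" and y = 1])
    (auto simp: poly_monom root1_power_n degree_monom_eq)

lemma root1_sum: "n > 0 \<Longrightarrow> (\<Sum>j<n. root1 n ^ (j * k)) = (if n dvd k then of_nat n else 0)"
proof (cases "n dvd k")
  case True
  moreover assume "n > 0"
  ultimately have "root1 n ^ (j * k) = 1" for j by (simp add: root1_power_eq_1_iff)
  then show ?thesis using True by simp
next
  case False
  assume n: "n > 0"
  then have "root1 n ^ k \<noteq> 1" using False by (simp add: root1_power_eq_1_iff)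
  then have "(\<Sum>j<n. (root1 n ^ k) ^ j) = ((root1 n ^ k) ^ n - 1) / (root1 n ^ k - 1)"
    by (rule geometric_sum)
  also have "(root1 n ^ k) ^ n = 1"
    using root1_power_n[OF n] by (metis mult.commute power_mult power_one)
  finally show ?thesis using False by (simp add: mult.commute flip: power_mult)
qed

lemma root1_multiple: "n > 0 \<Longrightarrow> d > 0 \<Longrightarrow> root1 (d * n) ^ (d * k) = root1 n ^ k"
  by (simp add: root1_power mult.assoc)

text \<open>These are Ramanujan sums. Grouping all \<open>w < n\<close> by \<open>gcd w n\<close>
  splits the full sum, which is 0 or \<open>n\<close>, into the Ramanujan sums of the divisors of
  \<open>n\<close>; strong induction handles the proper ones.\<close>

lemma sum_units_mod_rat: "n > 0 \<Longrightarrow> (\<Sum>w\<in>units_mod n. root1 n ^ (w * k)) \<in> \<rat>"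
proof (induction n rule: less_induct)
  case (less n)
  let ?R = "\<lambda>m. (\<Sum>w\<in>units_mod m. root1 m ^ (w * k))"
  let ?D = "{d. d dvd n}"
  have fin: "finite ?D" using less.prems by simp
  have part: "(\<Sum>w\<in>{w \<in> {..<n}. gcd w n = d}. root1 n ^ (w * k)) = ?R (n div d)" if d: "d dvd n" for d
  proof -
    obtain m where m: "n = d * m" using d by blast
    have dm: "d > 0" "m > 0" using less.prems m by simp_all
    show ?thesis
    proof (rule sum.reindex_bij_witness[of _ "\<lambda>v. d * v" "\<lambda>w. w div d"])
      fix w assume w: "w \<in> {w \<in> {..<n}. gcd w n = d}"
      then have "d dvd w" using gcd_dvd1[of w n] by auto
      then obtain v where v: "w = d * v" by (rule dvdE)
      have "gcd w n = d" using w by simp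
      then have "d * gcd v m = d * 1" unfolding v m gcd_mult_distrib_nat by simp
      then have "gcd v m = 1" using dm(1) mult_left_cancel[of d "gcd v m" 1] by blast
      then have "coprime v m" by (rule gcd_eq_1_imp_coprime)
      then show "w div d \<in> units_mod (n div d)" "d * (w div d) = w"
        using w dm by (auto simp: v m units_mod_def)
      show "root1 (n div d) ^ (w div d * k) = root1 n ^ (w * k)"
        using dm root1_multiple[OF dm(2,1), of "v * k"] by (simp add: v m mult.assoc)
    next
      fix v assume "v \<in> units_mod (n div d)"
      then have v: "v < m" "gcd v m = 1" using dm by (auto simp: m units_mod_def)
      show "d * v \<in> {w \<in> {..<n}. gcd w n = d}" "d * v div d = v"
        using v dm by (simp_all add: m gcd_mult_left)
    qed
  qed
  have "(\<Sum>w<n. root1 n ^ (w * k)) = (\<Sum>d\<in>?D. \<Sum>w\<in>{w \<in> {..<n}. gcd w n = d}. root1 n ^ (w * k))"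
    by (rule sum.group[symmetric]) (use fin in auto)
  also have "\<dots> = (\<Sum>d\<in>?D. ?R (n div d))" by (intro sum.cong refl part) simp
  also have "\<dots> = ?R n + (\<Sum>d\<in>?D - {1}. ?R (n div d))"
    by (subst sum.remove[of _ 1]) (use fin in auto)
  finally have eq: "?R n = (\<Sum>w<n. root1 n ^ (w * k)) - (\<Sum>d\<in>?D - {1}. ?R (n div d))" by simp
  have "(\<Sum>d\<in>?D - {1}. ?R (n div d)) \<in> \<rat>"
  proof (rule Rats_sum)
    fix d assume d: "d \<in> ?D - {1}"
    then have "n div d < n" "n div d > 0" using less.prems
      by (auto intro!: div_less_dividend simp: dvd_div_eq_0_iff)
    then show "?R (n div d) \<in> \<rat>" by (rule less.IH)
  qed
  then show ?case unfolding eq root1_sum[OF less.prems] by (intro Rats_diff) auto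
qed

text \<open>The functions \<open>w \<mapsto> P (\<zeta> ^ w)\<close> with \<open>P\<close> a rational polynomial. Averaging such a function over
  the units replaces the action of the Galois group of the cyclotomic field, so that
  irreducibility of cyclotomic polynomials is not needed.\<close>

definition cyclo_fun :: "nat \<Rightarrow> (nat \<Rightarrow> complex) set" where
  "cyclo_fun n = {\<phi>. \<exists>a. (\<forall>j. a j \<in> \<rat>) \<and> (\<forall>w. \<phi> w = (\<Sum>j<n. a j * root1 n ^ (w * j)))}"

lemma cyclo_fun_root:
  assumes n: "n > 0" and c: "c \<in> \<rat>"
  shows "(\<lambda>w. c * root1 n ^ (w * k)) \<in> cyclo_fun n"
proof -
  define a where "a j = (if j = k mod n then c else 0)" for j
  have "c * root1 n ^ (w * k) = (\<Sum>j<n. a j * root1 n ^ (w * j))" for w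
  proof -
    have "(\<Sum>j<n. a j * root1 n ^ (w * j)) = (\<Sum>j<n. if j = k mod n then c * root1 n ^ (w * j) else 0)"
      by (rule sum.cong) (auto simp: a_def)
    also have "\<dots> = c * root1 n ^ (w * (k mod n))" using n by simp
    also have "root1 n ^ (w * (k mod n)) = root1 n ^ (w * k)"
      by (rule root1_power_cong[OF n]) (simp add: cong_def mod_mult_right_eq)
    finally show ?thesis by simp
  qed
  moreover have "\<forall>j. a j \<in> \<rat>" using c by (simp add: a_def)
  ultimately show ?thesis unfolding cyclo_fun_def by blast
qed

lemma cyclo_fun_const: "n > 0 \<Longrightarrow> c \<in> \<rat> \<Longrightarrow> (\<lambda>w. c) \<in> cyclo_fun n"
  using cyclo_fun_root[of n c 0] by simp

lemma cyclo_fun_power_root: "n > 0 \<Longrightarrow> (\<lambda>w. root1 n ^ (w * k)) \<in> cyclo_fun n"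
  using cyclo_fun_root[of n 1 k] by simp

lemma cyclo_fun_add:
  assumes "\<phi> \<in> cyclo_fun n" "\<psi> \<in> cyclo_fun n"
  shows "(\<lambda>w. \<phi> w + \<psi> w) \<in> cyclo_fun n"
proof -
  obtain a b where ab: "\<forall>j. a j \<in> \<rat>" "\<forall>w. \<phi> w = (\<Sum>j<n. a j * root1 n ^ (w * j))"
    "\<forall>j. b j \<in> \<rat>" "\<forall>w. \<psi> w = (\<Sum>j<n. b j * root1 n ^ (w * j))"
    using assms unfolding cyclo_fun_def by blast
  show ?thesis unfolding cyclo_fun_def
    by (rule CollectI, rule exI[of _ "\<lambda>j. a j + b j"])
      (simp add: ab sum.distrib ring_distribs)
qed

lemma cyclo_fun_sum:
  assumes "n > 0" "\<And>i. i \<in> A \<Longrightarrow> \<phi> i \<in> cyclo_fun n"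
  shows "(\<lambda>w. \<Sum>i\<in>A. \<phi> i w) \<in> cyclo_fun n"
  using assms(2)
  by (induction A rule: infinite_finite_induct)
    (simp_all add: cyclo_fun_const[OF assms(1)] cyclo_fun_add)

lemma cyclo_fun_mult:
  assumes n: "n > 0" and "\<phi> \<in> cyclo_fun n" "\<psi> \<in> cyclo_fun n"
  shows "(\<lambda>w. \<phi> w * \<psi> w) \<in> cyclo_fun n"
proof -
  obtain a b where ab: "\<forall>j. a j \<in> \<rat>" "\<forall>w. \<phi> w = (\<Sum>j<n. a j * root1 n ^ (w * j))"
    "\<forall>j. b j \<in> \<rat>" "\<forall>w. \<psi> w = (\<Sum>j<n. b j * root1 n ^ (w * j))"
    using assms(2,3) unfolding cyclo_fun_def by blast
  have "\<phi> w * \<psi> w = (\<Sum>i<n. \<Sum>j<n. (a i * b j) * root1 n ^ (w * (i + j)))" for w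
    by (simp add: ab sum_product power_add distrib_left mult_ac)
  moreover have "(\<lambda>w. \<Sum>i<n. \<Sum>j<n. (a i * b j) * root1 n ^ (w * (i + j))) \<in> cyclo_fun n"
    by (intro cyclo_fun_sum n cyclo_fun_root) (use ab in auto)
  ultimately show ?thesis by simp
qed

lemma cyclo_fun_prod:
  assumes "n > 0" "\<And>i. i \<in> A \<Longrightarrow> \<phi> i \<in> cyclo_fun n"
  shows "(\<lambda>w. \<Prod>i\<in>A. \<phi> i w) \<in> cyclo_fun n"
  using assms(2)
  by (induction A rule: infinite_finite_induct)
    (simp_all add: cyclo_fun_const[OF assms(1)] cyclo_fun_mult[OF assms(1)])

lemma cyclo_fun_power:
  assumes "n > 0" "\<phi> \<in> cyclo_fun n"
  shows "(\<lambda>w. \<phi> w ^ k) \<in> cyclo_fun n"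
  using cyclo_fun_prod[of n "{..<k}" "\<lambda>_. \<phi>"] assms by simp

lemma units_mod_nonempty: "n > 0 \<Longrightarrow> units_mod n \<noteq> {}"
proof -
  assume "n > 0"
  then have "1 mod n \<in> units_mod n" by (cases "n = 1") (auto simp: units_mod_def)
  then show ?thesis by blast
qed

text \<open>A function that is constant on the units equals its average over them, and averaging
  turns each root of unity into a Ramanujan sum.\<close>

lemma cyclo_fun_invariant_rat:
  assumes n: "n > 0" and \<phi>: "\<phi> \<in> cyclo_fun n" and inv: "\<And>w. w \<in> units_mod n \<Longrightarrow> \<phi> w = x"
  shows "x \<in> \<rat>"
proof -
  obtain a where a: "\<forall>j. a j \<in> \<rat>" "\<forall>w. \<phi> w = (\<Sum>j<n. a j * root1 n ^ (w * j))"
    using \<phi> unfolding cyclo_fun_def by blast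
  have "of_nat (card (units_mod n)) * x = (\<Sum>w\<in>units_mod n. \<phi> w)" using inv by simp
  also have "\<dots> = (\<Sum>j<n. \<Sum>w\<in>units_mod n. a j * root1 n ^ (w * j))"
    using a(2) by (simp add: sum.swap[of _ "units_mod n"])
  also have "\<dots> \<in> \<rat>"
    by (rule Rats_sum) (simp add: a(1) sum_units_mod_rat[OF n] Rats_mult flip: sum_distrib_left)
  finally have "of_nat (card (units_mod n)) * x \<in> \<rat>" .
  moreover have "card (units_mod n) > 0" using units_mod_nonempty[OF n] by (simp add: card_gt_0_iff)
  ultimately have "of_nat (card (units_mod n)) * x / of_nat (card (units_mod n)) \<in> \<rat>"
    by (intro Rats_divide) auto
  then show ?thesis using units_mod_nonempty[OF n] by simp
qed

lemma units_mod_times: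
  assumes n: "n > 0" and u: "u \<in> units_mod n" and s: "s \<in> units_mod n"
  shows "(u * s) mod n \<in> units_mod n"
  using assms by (simp add: units_mod_def)

lemma units_mod_inverse:
  assumes n: "n > 0" and u: "u \<in> units_mod n"
  obtains v where "v \<in> units_mod n" "[u * v = 1] (mod n)"
proof -
  have cop: "coprime u n" using u by (simp add: units_mod_def)
  obtain v where v: "[u * v = 1] (mod n)" using cong_solve_coprime_nat[OF cop] by auto
  then have uv: "[u * (v mod n) = 1] (mod n)" by (simp add: cong_def mod_mult_right_eq)
  have "coprime (v mod n) n"
  proof -
    have "coprime (u * (v mod n)) n" using cong_imp_coprime[OF cong_sym[OF uv]] by simp
    then show ?thesis by simp
  qed
  then have "v mod n \<in> units_mod n" using n by (simp add: units_mod_def)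
  then show ?thesis using uv by (rule that)
qed

lemma units_mod_times_cancel:
  assumes "u \<in> units_mod n" "s \<in> units_mod n" "[v * u = 1] (mod n)"
  shows "(v * ((u * s) mod n)) mod n = s"
proof -
  have "(v * ((u * s) mod n)) mod n = (v * u * s) mod n" by (simp add: mod_mult_right_eq mult.assoc)
  also have "\<dots> = (1 * s) mod n" using assms(3) by (metis cong_def mod_mult_left_eq)
  finally show ?thesis using assms(2) by (simp add: units_mod_def)
qed

lemma units_mod_times_bij:
  assumes n: "n > 0" and u: "u \<in> units_mod n"
  shows "bij_betw (\<lambda>s. (u * s) mod n) (units_mod n) (units_mod n)"
proof -
  obtain v where v: "v \<in> units_mod n" "[u * v = 1] (mod n)" using units_mod_inverse[OF n u] by blast
  have v': "[v * u = 1] (mod n)" using v(2) by (simp add: mult.commute)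
  show ?thesis
    by (rule bij_betw_byWitness[where f' = "\<lambda>s. (v * s) mod n"])
      (use units_mod_times[OF n] units_mod_times_cancel u v v' in auto)
qed

lemma units_mod_prod:
  assumes n: "n > 0" and u: "u \<in> units_mod n"
  shows "(\<Prod>s\<in>units_mod n. F ((u * s) mod n)) = (\<Prod>s\<in>units_mod n. F s)"
  by (rule prod.reindex_bij_betw[OF units_mod_times_bij[OF n u]])

section \<open>Primes congruent to 1 modulo n\<close>

lemma power_minus_1_factorization:
  assumes n: "n > 0"
  shows "(x :: complex) ^ n - 1 = (\<Prod>s<n. (x - root1 n ^ s))"
proof -
  define P where "P = monom 1 n - (1 :: complex poly)"
  define Q where "Q = (\<Prod>s<n. [:- (root1 n ^ s), 1:])"
  have degP: "degree P \<le> n" unfolding P_def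
    by (intro degree_diff_le) (auto simp: degree_monom_le)
  have degQ: "degree Q = n" unfolding Q_def by (subst degree_prod_eq_sum_degree) auto
  have "lead_coeff Q = 1" unfolding Q_def by (simp add: lead_coeff_prod)
  then have cQ: "coeff Q n = 1" using degQ by simp
  have cP: "coeff P n = 1" using n by (simp add: P_def coeff_1)
  have "P = Q"
  proof (rule poly_eqI_degree_lead_coeff[of P n Q "(\<lambda>k. root1 n ^ k) ` {..<n}"])
    show "card ((\<lambda>k. root1 n ^ k) ` {..<n}) \<ge> n" by (subst card_image) (use root1_inj[OF n] in auto)
    fix z assume "z \<in> (\<lambda>k. root1 n ^ k) ` {..<n}"
    then obtain k where k: "k < n" "z = root1 n ^ k" by blast
    have "poly P z = 0"
      using n by (simp add: P_def poly_monom k root1_power_eq_1_iff flip: power_mult)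
    moreover have "poly Q z = 0" unfolding Q_def poly_prod using k by (intro prod_zero) auto
    ultimately show "poly P z = poly Q z" by simp
  qed (simp_all add: cP cQ degP degQ)
  then have "poly P x = poly Q x" by simp
  then show ?thesis by (simp add: P_def Q_def poly_monom poly_prod)
qed

text \<open>This is the value of the n-th cyclotomic polynomial at \<open>m\<close>. Replacing the
  root of unity by its w-th power only permutes the factors.\<close>

lemma cyclotomic_value_int:
  assumes n: "n > 0"
  shows "(\<Prod>s\<in>units_mod n. (of_nat m - root1 n ^ s)) \<in> \<int>"
proof -
  let ?c = "\<Prod>s\<in>units_mod n. (of_nat m - root1 n ^ s)"
  have "algebraic_int ?c"
    by (intro algebraic_int_prod algebraic_int_diff algebraic_int_power root1_algebraic_int n) simp
  moreover have "?c \<in> \<rat>"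
  proof (rule cyclo_fun_invariant_rat[OF n])
    show "(\<lambda>w. \<Prod>s\<in>units_mod n. (of_nat m + (-1) * root1 n ^ (w * s))) \<in> cyclo_fun n"
      by (intro cyclo_fun_prod cyclo_fun_add cyclo_fun_const cyclo_fun_root n) auto
    fix w assume w: "w \<in> units_mod n"
    have "(\<Prod>s\<in>units_mod n. (of_nat m - root1 n ^ ((w * s) mod n))) = ?c"
      by (rule units_mod_prod[OF n w])
    then show "(\<Prod>s\<in>units_mod n. (of_nat m + (-1) * root1 n ^ (w * s))) = ?c"
      by (simp add: root1_power_mod[OF n])
  qed
  ultimately show ?thesis by (rule rational_algebraic_int_is_int)
qed

text \<open>Take a prime \<open>l\<close> dividing the cyclotomic value \<Phi> at \<open>n\<close>
  itself. It divides \<open>n ^ n - 1\<close>, so it is prime to \<open>n\<close>. If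
  \<open>n\<close> had order \<open>d = n / q\<close> modulo \<open>l\<close> with
  \<open>q > 1\<close>, then \<Phi> would divide \<open>(n ^ n - 1) / (n ^ d - 1)\<close>, a sum of
  \<open>q\<close> terms that are 1 modulo \<open>l\<close>, and \<open>l\<close> would divide
  \<open>q\<close>. So the order is \<open>n\<close>, which therefore divides
  \<open>l - 1\<close>.\<close>

lemma exists_prime_cong_1:
  assumes n: "n \<ge> 3"
  obtains l :: nat where "prime l" "[l = 1] (mod n)"
proof -
  have n0: "n > 0" using n by simp
  define \<Phi> where "\<Phi> = (\<Prod>s\<in>units_mod n. (of_nat n - root1 n ^ s))"
  obtain c :: int where c: "\<Phi> = of_int c"
    using cyclotomic_value_int[OF n0, of n] unfolding \<Phi>_def by (elim Ints_cases)
  \<comment> \<open>Here \<open>n \<ge> 3\<close> enters: each factor has absolute value at least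
    \<open>n - 1\<close>, so \<Phi> is not a unit and has a prime divisor.\<close>
  have factor: "cmod (of_nat n - root1 n ^ s) \<ge> 2" for s
  proof -
    have "cmod (root1 n ^ s) = 1" by (simp add: root1_power)
    then have "cmod (of_nat n - root1 n ^ s) \<ge> real n - 1"
      using norm_triangle_ineq2[of "of_nat n" "root1 n ^ s"] by simp
    then show ?thesis using n by linarith
  qed
  have "cmod \<Phi> \<ge> (\<Prod>s\<in>units_mod n. 2)"
    unfolding \<Phi>_def prod_norm[symmetric] by (intro prod_mono) (use factor in auto)
  moreover have "card (units_mod n) > 0" using units_mod_nonempty[OF n0] by (simp add: card_gt_0_iff)
  then have "(2::real) ^ 1 \<le> 2 ^ card (units_mod n)" by (intro power_increasing) auto
  ultimately have "cmod \<Phi> \<ge> 2" by simp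
  then have "\<bar>c\<bar> \<ge> 2" unfolding c by simp
  then have "nat \<bar>c\<bar> \<noteq> 1" by linarith
  then obtain l where l: "prime l" "l dvd nat \<bar>c\<bar>" using prime_factor_nat by blast
  then have "int l dvd int (nat \<bar>c\<bar>)" by (simp only: int_dvd_int_iff)
  then have "int l dvd c" by simp
  then obtain e where "c = int l * e" by blast
  then have \<Phi>l: "\<Phi> = of_nat l * of_int e" by (simp add: c)
  have l0: "l > 0" using l(1) prime_gt_0_nat by blast
  \<comment> \<open>The cofactor \<open>r\<close> is only an algebraic integer, but the quotient
    \<open>T / l\<close> is also rational.\<close>
  have dvd_if: "int l dvd T"
    if T: "of_int T = \<Phi> * r" "algebraic_int r" for T :: int and r
  proof -
    have "complex_of_int T / of_nat l = of_int e * r" using T l0 by (simp add: \<Phi>l)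
    then have "algebraic_int (complex_of_int T / of_nat l)"
      using T(2) by (simp add: algebraic_int_times)
    moreover have "complex_of_int T / of_nat l \<in> \<rat>" by simp
    ultimately have "complex_of_int T / of_nat l \<in> \<int>" by (rule rational_algebraic_int_is_int)
    then obtain q where "complex_of_int T / of_nat l = of_int q" by (elim Ints_cases)
    then have "complex_of_int T = of_int (int l * q)" using l0 by (simp add: field_simps)
    then have "T = int l * q" by (simp only: of_int_eq_iff)
    then show ?thesis by simp
  qed
  have sub: "units_mod n \<subseteq> {..<n}" by (auto simp: units_mod_def)
  have ai: "algebraic_int (\<Prod>s\<in>A. (of_nat n - root1 n ^ s))" for A
    by (intro algebraic_int_prod algebraic_int_diff algebraic_int_power root1_algebraic_int n0) simp
  have "of_int (int n ^ n - 1) = \<Phi> * (\<Prod>s\<in>{..<n} - units_mod n. (of_nat n - root1 n ^ s))"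
    using power_minus_1_factorization[OF n0, of "of_nat n"] prod.subset_diff[OF sub]
    by (simp add: \<Phi>_def mult.commute)
  then have "int l dvd int n ^ n - 1" using dvd_if ai by blast
  then have "[int n ^ n = 1] (mod int l)" by (simp add: cong_iff_dvd_diff)
  then have pow_n: "[n ^ n = 1] (mod l)" by (metis cong_int_iff of_nat_1 of_nat_power)
  then have cop: "coprime n l"
    using cong_imp_coprime[OF cong_sym[OF pow_n]] n0 by simp
  define d where "d = ord l n"
  have "d dvd n" using pow_n unfolding d_def ord_divides .
  then obtain q where q: "n = d * q" by blast
  have dq: "d > 0" "q > 0" using n0 q by simp_all
  have "q = 1"
  proof (rule ccontr)
    assume "q \<noteq> 1"
    then have q1: "q > 1" using dq by linarith
    \<comment> \<open>The exponents of the d-th roots of unity among the n-th ones; none is a unit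
      modulo \<open>n\<close>, since \<open>q > 1\<close> divides them all. They account for the
      factor \<open>n ^ d - 1\<close>.\<close>
    define B where "B = (\<lambda>s. q * s) ` {..<d}"
    have B: "B \<subseteq> {..<n}" using dq by (auto simp: B_def q mult.commute)
    have disj: "units_mod n \<inter> B = {}"
    proof (rule ccontr)
      assume "units_mod n \<inter> B \<noteq> {}"
      then obtain s where "coprime (q * s) (d * q)" by (auto simp: B_def units_mod_def q)
      then have "coprime q q" by simp
      then show False using q1 by simp
    qed
    have "(\<Prod>s\<in>B. (of_nat n - root1 n ^ s)) = (\<Prod>s<d. (of_nat n - root1 n ^ (q * s)))"
      unfolding B_def using dq by (subst prod.reindex) (auto intro!: inj_onI)
    also have "\<dots> = (\<Prod>s<d. (of_nat n - root1 d ^ s))"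
      using root1_multiple[OF dq] by (simp add: q mult.commute)
    also have "\<dots> = of_nat n ^ d - 1"
      by (rule power_minus_1_factorization[OF dq(1), symmetric])
    finally have prodB: "(\<Prod>s\<in>B. (of_nat n - root1 n ^ s)) = of_nat n ^ d - 1" .
    define r where "r = (\<Prod>s\<in>{..<n} - (units_mod n \<union> B). (of_nat n - root1 n ^ s))"
    have "of_nat n ^ n - 1 = (\<Prod>s<n. (of_nat n - root1 n ^ s))"
      by (rule power_minus_1_factorization[OF n0])
    also have "\<dots> = r * (\<Prod>s\<in>units_mod n \<union> B. (of_nat n - root1 n ^ s))"
      unfolding r_def by (rule prod.subset_diff) (use sub B in auto)
    also have "(\<Prod>s\<in>units_mod n \<union> B. (of_nat n - root1 n ^ s)) = \<Phi> * (of_nat n ^ d - 1)"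
      unfolding \<Phi>_def prodB[symmetric] by (rule prod.union_disjoint) (use disj in \<open>auto simp: B_def\<close>)
    finally have eq1: "of_nat n ^ n - 1 = (of_nat n ^ d - 1) * (\<Phi> * r)" by (simp add: mult_ac)
    have eq2: "(of_nat n :: complex) ^ n - 1 = (of_nat n ^ d - 1) * (\<Sum>i<q. (of_nat n ^ d) ^ i)"
      using power_diff_1_eq[of "(of_nat n :: complex) ^ d" q] by (simp add: q power_mult)
    have "n ^ d \<noteq> 1" using n dq by (simp add: nat_power_eq_Suc_0_iff)
    then have "complex_of_nat (n ^ d) \<noteq> of_nat 1" by (simp only: of_nat_eq_iff not_False_eq_True)
    then have "(of_nat n :: complex) ^ d - 1 \<noteq> 0" by simp
    then have "(\<Sum>i<q. (of_nat n ^ d) ^ i) = \<Phi> * r" using eq1 eq2 by simp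
    then have "of_int (\<Sum>i<q. (int n ^ d) ^ i) = \<Phi> * r" by simp
    moreover have "algebraic_int r" unfolding r_def by (rule ai)
    ultimately have dvd: "int l dvd (\<Sum>i<q. (int n ^ d) ^ i)" by (rule dvd_if)
    have "[n ^ d = 1] (mod l)" unfolding d_def by (rule ord)
    then have nd: "[int n ^ d = 1] (mod int l)" by (metis cong_int_iff of_nat_1 of_nat_power)
    have "[(\<Sum>i<q. (int n ^ d) ^ i) = (\<Sum>i<q. 1 ^ i)] (mod int l)"
      by (intro cong_sum cong_pow nd)
    then have "int l dvd int q" using dvd by (simp add: cong_dvd_iff)
    then have "l dvd n" by (simp add: q)
    then have "l dvd gcd n l" by simp
    then have "l dvd 1" using cop by (simp only: coprime_imp_gcd_eq_1)
    then show False using l(1) by simp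
  qed
  then have "n dvd totient l"
    using q order_divides_totient[of l n] cop by (simp add: d_def coprime_commute)
  then have "n dvd l - 1" using l(1) by (simp add: totient_prime)
  then have "[1 = l] (mod n)" using l0 cong_altdef_nat[of 1 l n] by (simp add: cong_sym_eq)
  then have "[l = 1] (mod n)" by (rule cong_sym)
  then show ?thesis using that l(1) by blast
qed

section \<open>Kummer elements\<close>

lemma sum_times_mod:
  fixes F :: "nat \<Rightarrow> 'a :: comm_monoid_add"
  assumes n: "n > 0" and u: "u \<in> units_mod n"
  shows "(\<Sum>t<n. F ((u * t) mod n)) = (\<Sum>t<n. F t)"
proof -
  obtain v where v: "v \<in> units_mod n" "[u * v = 1] (mod n)" using units_mod_inverse[OF n u] by blast
  have cancel: "(a * ((b * t) mod n)) mod n = t" if "[a * b = 1] (mod n)" "t < n" for a b t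
  proof -
    have "[a * b * t = 1 * t] (mod n)" by (intro cong_mult that(1) cong_refl)
    then show ?thesis using that(2) by (simp add: cong_def mod_mult_right_eq mult.assoc)
  qed
  have vu: "[v * u = 1] (mod n)" using v(2) by (simp add: mult.commute)
  show ?thesis
    by (rule sum.reindex_bij_witness[of _ "\<lambda>t. (v * t) mod n" "\<lambda>t. (u * t) mod n"])
      (use n cancel[OF v(2)] cancel[OF vu] in auto)
qed

lemma nat_pred_cong:
  fixes n t :: nat
  assumes "n > 0"
  shows "[(n - 1) * t + t = 0] (mod n)" "[(n - 1) * ((n - 1) * t) = t] (mod n)"
proof -
  obtain m where m: "n = Suc m" using assms by (cases n) auto
  have "(n - 1) * t + t = n * t" by (simp add: m)
  then show "[(n - 1) * t + t = 0] (mod n)" by (simp add: cong_def)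
  have sq: "m * (m * t) + Suc m * t = Suc m * (m * t) + t" by (simp add: algebra_simps)
  have 0: "[Suc m * k = 0] (mod Suc m)" for k by (simp only: cong_0_iff dvd_triv_left)
  have "[m * (m * t) + Suc m * t = m * (m * t) + 0] (mod Suc m)"
    by (intro cong_add cong_refl 0)
  moreover have "[Suc m * (m * t) + t = 0 + t] (mod Suc m)"
    by (intro cong_add cong_refl 0)
  ultimately have "[m * (m * t) + 0 = 0 + t] (mod Suc m)"
    unfolding sq using cong_trans[OF cong_sym] by blast
  then show "[(n - 1) * ((n - 1) * t) = t] (mod n)" by (simp add: m)
qed

lemma dvd_pred_iff:
  fixes n i j :: nat
  assumes n: "n > 0" and ij: "i < n" "j < n"
  shows "n dvd i + (n - 1) * j \<longleftrightarrow> i = j"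
proof -
  have "n dvd i + (n - 1) * j \<longleftrightarrow> [i + (n - 1) * j = j + (n - 1) * j] (mod n)"
  proof -
    have "[j + (n - 1) * j = 0] (mod n)" using nat_pred_cong(1)[OF n, of j] by (simp add: add.commute)
    then show ?thesis unfolding cong_0_iff[symmetric] using cong_trans cong_sym by blast
  qed
  also have "\<dots> \<longleftrightarrow> [i = j] (mod n)" by (rule cong_add_rcancel_nat)
  also have "\<dots> \<longleftrightarrow> i = j" using ij by (simp add: cong_def)
  finally show ?thesis .
qed

definition nroot :: "nat \<Rightarrow> complex \<Rightarrow> complex" where
  "nroot n x = rcis (root n (cmod x)) (Arg x / real n)"

lemma nroot_power: "n > 0 \<Longrightarrow> nroot n x ^ n = x"
  by (simp add: nroot_def DeMoivre2 rcis_cmod_Arg)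

text \<open>The principal root commutes with conjugation wherever \<open>Arg\<close> changes sign
  under it. A positive real part keeps \<open>x\<close> off the negative axis, where
  \<open>Arg\<close> is \<open>pi\<close> on both sides.\<close>

lemma nroot_cnj:
  assumes "Re x > 0"
  shows "nroot n (cnj x) = cnj (nroot n x)"
proof -
  have x: "x \<noteq> 0" using assms by auto
  have bounds: "- pi < Arg x" "Arg x \<le> pi" using Arg_bounded[of x] by auto
  have "Arg x \<noteq> pi"
  proof
    assume "Arg x = pi"
    then have "x = rcis (cmod x) pi" using rcis_cmod_Arg[of x] by simp
    then have "Re x = - cmod x" by (metis Re_rcis cos_pi mult_minus1_right)
    then show False using assms norm_ge_zero[of x] by linarith
  qed
  moreover have "sgn (cnj x) = cis (- Arg x)"
    using cis_Arg[OF x] by (simp add: sgn_eq flip: cis_cnj)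
  ultimately have "Arg (cnj x) = - Arg x" using bounds by (intro cis_Arg_unique) auto
  then show ?thesis by (simp add: nroot_def rcis_def cis_cnj)
qed

text \<open>\<open>z\<close> is an element of order \<open>n\<close> modulo \<open>l\<close>: its
  powers with unit exponents are the residues of \<zeta> at the primes over \<open>l\<close>.
  \<open>c\<close> plays the role of \<open>(g - 1) / n\<close> modulo \<open>l\<close>, so that
  adding \<open>c * n\<close> turns the residue 1 into \<open>g\<close>.\<close>

locale kummer_data =
  fixes n l g c z :: nat
  assumes n: "n > 0" and l: "prime l" and l_cong: "[l = 1] (mod n)"
    and z_def: "z = g ^ ((l - 1) div n)"
    and z_order: "\<And>k. [z ^ k = 1] (mod l) \<longleftrightarrow> n dvd k"
    and c: "[1 + c * n = g] (mod l)" and g: "coprime g l"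
begin

abbreviation \<zeta> :: complex where "\<zeta> \<equiv> root1 n"
abbreviation U :: "nat set" where "U \<equiv> units_mod n"
abbreviation eql :: "complex \<Rightarrow> complex \<Rightarrow> bool" (infix "\<sim>\<^sub>l" 50) where
  "x \<sim>\<^sub>l y \<equiv> int_cong (of_nat l) x y"

lemmas \<zeta>_int = root1_algebraic_int[OF n]
lemmas \<zeta>_cong = root1_power_cong[OF n]

lemma l_gt_1: "l > 1"
  using l prime_gt_1_nat by blast

lemma n_dvd: "n dvd l - 1"
  using l_cong l_gt_1 cong_altdef_nat[of 1 l n] by (simp add: cong_sym_eq)

lemma coprime_n_l: "coprime n l"
proof -
  have "n \<le> l - 1" using n_dvd l_gt_1 by (intro dvd_imp_le) auto
  then have "\<not> l dvd n" using n l_gt_1 by (auto dest!: dvd_imp_le)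
  then show ?thesis using l by (metis coprime_commute prime_imp_coprime)
qed

lemma z_order_Suc: "[z ^ k = Suc 0] (mod l) \<longleftrightarrow> n dvd k"
  using z_order[of k] by simp

lemma z_cong: "[j = k] (mod n) \<Longrightarrow> [z ^ j = z ^ k] (mod l)"
proof -
  have "[z ^ k = z ^ (k mod n)] (mod l)" for k
  proof -
    have "[z ^ (n * (k div n)) * z ^ (k mod n) = 1 * z ^ (k mod n)] (mod l)"
      by (intro cong_mult cong_refl) (simp add: z_order_Suc)
    then show ?thesis by (simp flip: power_add)
  qed
  note this[of j] this[of k]
  moreover assume "[j = k] (mod n)"
  ultimately show ?thesis by (simp add: cong_def)
qed

lemma cancel_coprime:
  assumes "coprime r l" "of_nat r * x \<sim>\<^sub>l 0" "algebraic_int x"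
  shows "x \<sim>\<^sub>l 0"
  using int_cong_cancel_coprime[of "of_nat l" "int r" x "int l"] assms l_gt_1
  by (simp add: int_cong_def)

section \<open>Idempotents modulo \<open>l\<close> in place of the primes over
  \<open>l\<close>\<close>

definition E :: "nat \<Rightarrow> complex" where
  "E v = (\<Sum>k<n. of_nat (z ^ ((n - 1) * v * k)) * \<zeta> ^ k)"

lemma E_int: "algebraic_int (E v)"
  unfolding E_def
  by (intro algebraic_int_sum algebraic_int_times algebraic_int_power \<zeta>_int algebraic_int_of_nat)

text \<open>Modulo \<open>l\<close>, the numbers \<open>E v / n\<close> are orthogonal idempotents on which \<open>\<zeta>\<close> acts as \<open>z ^ v\<close>.\<close>

lemma E_act_\<zeta>: "\<zeta> * E v \<sim>\<^sub>l of_nat (z ^ v) * E v"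
proof -
  define G where "G k = of_nat (z ^ v) * (of_nat (z ^ ((n - 1) * v * k)) * \<zeta> ^ k)" for k
  have "\<zeta> * E v = (\<Sum>k<n. of_nat (z ^ ((n - 1) * v * k)) * \<zeta> ^ (k + 1))"
    by (simp add: E_def sum_distrib_left mult_ac)
  also have "\<dots> \<sim>\<^sub>l (\<Sum>k<n. G ((k + 1) mod n))"
  proof (rule int_cong_sum)
    fix k
    have "[(n - 1) * v * ((k + 1) mod n) = (n - 1) * v * (k + 1)] (mod n)"
      by (intro cong_mult cong_refl) (simp add: cong_def)
    then have "[v + (n - 1) * v * ((k + 1) mod n) = v + (n - 1) * v * (k + 1)] (mod n)"
      by (intro cong_add cong_refl)
    also have "v + (n - 1) * v * (k + 1) = (n - 1) * v * k + ((n - 1) * v + v)"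
      by (simp only: distrib_left mult_1_right ac_simps)
    also have "[(n - 1) * v * k + ((n - 1) * v + v) = (n - 1) * v * k + 0] (mod n)"
      by (intro cong_add cong_refl nat_pred_cong n)
    finally have "[z ^ (v + (n - 1) * v * ((k + 1) mod n)) = z ^ ((n - 1) * v * k)] (mod l)"
      by (intro z_cong) simp
    then have "of_nat (z ^ ((n - 1) * v * k)) \<sim>\<^sub>l of_nat (z ^ (v + (n - 1) * v * ((k + 1) mod n)))"
      by (intro int_cong_of_nat cong_sym[of "z ^ (v + (n - 1) * v * ((k + 1) mod n))"])
    then have "\<zeta> ^ (k + 1) * of_nat (z ^ ((n - 1) * v * k))
        \<sim>\<^sub>l \<zeta> ^ (k + 1) * of_nat (z ^ (v + (n - 1) * v * ((k + 1) mod n)))"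
      by (intro int_cong_mult_left algebraic_int_power \<zeta>_int)
    also have "\<zeta> ^ (k + 1) = \<zeta> ^ ((k + 1) mod n)" by (rule root1_power_mod[OF n, symmetric])
    also have "\<zeta> ^ ((k + 1) mod n) * of_nat (z ^ (v + (n - 1) * v * ((k + 1) mod n))) = G ((k + 1) mod n)"
      by (simp add: G_def power_add)
    finally show "of_nat (z ^ ((n - 1) * v * k)) * \<zeta> ^ (k + 1) \<sim>\<^sub>l G ((k + 1) mod n)"
      by (simp only: root1_power_mod[OF n] mult.commute)
  qed
  also have "(\<Sum>k<n. G ((k + 1) mod n)) = (\<Sum>k<n. G k)" by (rule sum_shift_mod[OF n])
  also have "\<dots> = of_nat (z ^ v) * E v" by (simp add: G_def E_def sum_distrib_left)
  finally show ?thesis .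
qed

text \<open>Expresses that \<open>x\<close> has residue \<open>a\<close> at the prime over
  \<open>l\<close> where \<zeta> has residue \<open>z ^ v\<close>. Multiplication by
  \<open>E v\<close> does the work of reduction modulo that prime.\<close>

definition acts :: "nat \<Rightarrow> complex \<Rightarrow> nat \<Rightarrow> bool" where
  "acts v x a \<longleftrightarrow> algebraic_int x \<and> x * E v \<sim>\<^sub>l of_nat a * E v"

lemma acts_\<zeta>: "acts v \<zeta> (z ^ v)"
  using E_act_\<zeta> \<zeta>_int by (simp add: acts_def)

lemma acts_of_nat: "acts v (of_nat a) a"
  by (simp add: acts_def)

lemma acts_add: "acts v x a \<Longrightarrow> acts v y b \<Longrightarrow> acts v (x + y) (a + b)"
  by (auto simp: acts_def ring_distribs intro!: algebraic_int_add int_cong_add)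

lemma acts_mult:
  assumes "acts v x a" "acts v y b"
  shows "acts v (x * y) (a * b)"
proof -
  have "x * (y * E v) \<sim>\<^sub>l x * (of_nat b * E v)"
    using assms by (intro int_cong_mult_left) (auto simp: acts_def)
  also have "x * (of_nat b * E v) = of_nat b * (x * E v)" by simp
  also have "of_nat b * (x * E v) \<sim>\<^sub>l of_nat b * (of_nat a * E v)"
    using assms by (intro int_cong_mult_left) (auto simp: acts_def)
  finally show ?thesis using assms by (simp add: acts_def mult_ac algebraic_int_times)
qed

lemma acts_power: "acts v x a \<Longrightarrow> acts v (x ^ k) (a ^ k)"
  by (induction k) (use acts_of_nat[of v 1] in \<open>auto intro: acts_mult\<close>)

lemma acts_sum: "(\<And>i. i \<in> A \<Longrightarrow> acts v (x i) (a i)) \<Longrightarrow> acts v (sum x A) (sum a A)"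
  by (induction A rule: infinite_finite_induct)
    (use acts_of_nat[of v 0] in \<open>auto intro: acts_add\<close>)

lemma acts_prod: "(\<And>i. i \<in> A \<Longrightarrow> acts v (x i) (a i)) \<Longrightarrow> acts v (prod x A) (prod a A)"
  by (induction A rule: infinite_finite_induct)
    (use acts_of_nat[of v 1] in \<open>auto intro: acts_mult\<close>)

lemma acts_cong:
  assumes "acts v x a" "[a = b] (mod l)"
  shows "acts v x b"
proof -
  have "E v * of_nat a \<sim>\<^sub>l E v * of_nat b"
    by (intro int_cong_mult_left int_cong_of_nat assms E_int)
  then show ?thesis using assms(1) int_cong_trans by (auto simp: acts_def mult.commute)
qed

lemma z_sum:
  "[(\<Sum>k<n. z ^ (w * k)) = (if n dvd w then n else 0)] (mod l)"
proof (cases "n dvd w")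
  case True
  have "[(\<Sum>k<n. z ^ (w * k)) = (\<Sum>k<n. 1)] (mod l)"
    by (rule cong_sum) (simp add: z_order_Suc True)
  then show ?thesis using True by simp
next
  case False
  have "int (z ^ w) ^ n - 1 = (int (z ^ w) - 1) * (\<Sum>k<n. int (z ^ w) ^ k)"
    by (rule power_diff_1_eq)
  moreover have "[(z ^ w) ^ n = 1] (mod l)" by (simp add: z_order_Suc flip: power_mult)
  then have "[int ((z ^ w) ^ n) = int 1] (mod int l)" by (simp only: cong_int_iff)
  then have "int l dvd int (z ^ w) ^ n - 1" by (simp add: cong_iff_dvd_diff)
  ultimately have "int l dvd (int (z ^ w) - 1) * (\<Sum>k<n. int (z ^ w) ^ k)" by simp
  then have "int l dvd int (z ^ w) - 1 \<or> int l dvd (\<Sum>k<n. int (z ^ w) ^ k)"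
    using l by (simp add: prime_dvd_mult_iff)
  moreover have "\<not> int l dvd int (z ^ w) - 1"
  proof
    assume "int l dvd int (z ^ w) - 1"
    then have "[int (z ^ w) = int 1] (mod int l)" by (simp add: cong_iff_dvd_diff)
    then have "[z ^ w = 1] (mod l)" by (simp only: cong_int_iff)
    then show False using False z_order by blast
  qed
  moreover have "(\<Sum>k<n. int (z ^ w) ^ k) = int (\<Sum>k<n. z ^ (w * k))" by (simp add: power_mult)
  ultimately have "int l dvd int (\<Sum>k<n. z ^ (w * k))" by simp
  then have "l dvd (\<Sum>k<n. z ^ (w * k))" by (simp only: int_dvd_int_iff)
  then show ?thesis using False by (simp add: cong_0_iff)
qed

lemma E_sum: "(\<Sum>v<n. E v) \<sim>\<^sub>l of_nat n"
proof -
  have "(\<Sum>v<n. E v) = (\<Sum>k<n. \<Sum>v<n. of_nat (z ^ ((n - 1) * v * k)) * \<zeta> ^ k)"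
    unfolding E_def by (rule sum.swap)
  also have "\<dots> = (\<Sum>k<n. \<zeta> ^ k * of_nat (\<Sum>v<n. z ^ ((n - 1) * k * v)))"
    by (simp add: sum_distrib_left mult_ac)
  also have "\<dots> \<sim>\<^sub>l (\<Sum>k<n. \<zeta> ^ k * of_nat (if n dvd (n - 1) * k then n else 0))"
    by (intro int_cong_sum int_cong_mult_left int_cong_of_nat z_sum algebraic_int_power \<zeta>_int)
  also have "\<dots> = (\<Sum>k<n. if k = 0 then of_nat n else 0)"
  proof (rule sum.cong[OF refl])
    fix k assume "k \<in> {..<n}"
    then have "n dvd (n - 1) * k \<longleftrightarrow> k = 0" using dvd_pred_iff[OF n n, of k] by auto
    then show "\<zeta> ^ k * of_nat (if n dvd (n - 1) * k then n else 0) = (if k = 0 then of_nat n else 0)"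
      by simp
  qed
  also have "\<dots> = of_nat n" using n by simp
  finally show ?thesis .
qed

text \<open>With \<open>r = gcd v n > 1\<close>, all r-th roots of unity act as 1 on
  \<open>E v\<close>, because \<open>z ^ v\<close> has order dividing \<open>n / r\<close>. Their
  sum is 0 but acts as \<open>r\<close>, which is prime to \<open>l\<close>.\<close>

lemma E_nonunit:
  assumes v: "v < n" "v \<notin> U"
  shows "E v \<sim>\<^sub>l 0"
proof -
  define r where "r = gcd v n"
  have "r dvd n" "r dvd v" by (simp_all add: r_def)
  from \<open>r dvd n\<close> obtain m where m: "n = r * m" by (rule dvdE)
  from \<open>r dvd v\<close> obtain w where w: "v = r * w" by (rule dvdE)
  have rm: "r > 0" "m > 0" using n m by auto
  have r1: "r \<noteq> 1"
  proof
    assume "r = 1"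
    then have "coprime v n" unfolding r_def by (rule gcd_eq_1_imp_coprime)
    then show False using v by (simp add: units_mod_def)
  qed
  have r_cop: "coprime r l" using coprime_n_l m by simp
  have act: "acts v (\<zeta> ^ (m * j)) 1" for j
  proof (rule acts_cong[OF acts_power[OF acts_\<zeta>]])
    have "n dvd v * (m * j)" by (simp add: m w)
    then show "[(z ^ v) ^ (m * j) = 1] (mod l)" by (simp add: z_order_Suc flip: power_mult)
  qed
  have "(\<Sum>j<r. \<zeta> ^ (m * j)) = (\<Sum>j<r. root1 r ^ (j * 1))"
    using root1_multiple[OF rm] by (simp add: m mult.commute)
  also have "\<dots> = 0" using root1_sum[OF rm(1), of 1] r1 by simp
  finally have sum0: "(\<Sum>j<r. \<zeta> ^ (m * j)) = 0" .
  have "acts v (\<Sum>j<r. \<zeta> ^ (m * j)) (\<Sum>j<r. 1)" by (intro acts_sum act)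
  then have "0 \<sim>\<^sub>l of_nat r * E v" unfolding sum0 by (simp add: acts_def)
  then show ?thesis by (rule cancel_coprime[OF r_cop int_cong_sym E_int])
qed

text \<open>The Chinese remainder theorem modulo \<open>l\<close>: \<open>x - y\<close> kills every
  \<open>E v\<close>, those for non-units being 0 already, and the \<open>E v\<close> add up to
  \<open>n\<close>, which is invertible modulo \<open>l\<close>.\<close>

lemma eq_if_acts_eq:
  assumes x: "algebraic_int x" and y: "algebraic_int y"
    and act: "\<And>v. v \<in> U \<Longrightarrow> \<exists>a. acts v x a \<and> acts v y a"
  shows "x \<sim>\<^sub>l y"
proof -
  have "(x - y) * E v \<sim>\<^sub>l 0" if v: "v < n" for v
  proof (cases "v \<in> U")
    case True
    then obtain a where a: "acts v x a" "acts v y a" using act by blast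
    have "x * E v - y * E v \<sim>\<^sub>l of_nat a * E v - of_nat a * E v"
      using a by (intro int_cong_diff) (auto simp: acts_def)
    then show ?thesis by (simp add: left_diff_distrib)
  next
    case False
    then show ?thesis using E_nonunit[OF v] x y by (intro int_cong_0_mult algebraic_int_diff)
  qed
  then have "(\<Sum>v<n. (x - y) * E v) \<sim>\<^sub>l (\<Sum>v<n. 0)" by (intro int_cong_sum) auto
  then have "(x - y) * (\<Sum>v<n. E v) \<sim>\<^sub>l 0" by (simp add: sum_distrib_left)
  moreover have "(x - y) * of_nat n \<sim>\<^sub>l (x - y) * (\<Sum>v<n. E v)"
    using E_sum x y by (intro int_cong_mult_left int_cong_sym[of _ _ "of_nat n"] algebraic_int_diff)
  ultimately have "of_nat n * (x - y) \<sim>\<^sub>l 0" using int_cong_trans by (metis mult.commute)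
  then have "x - y \<sim>\<^sub>l 0" by (rule cancel_coprime[OF coprime_n_l _ algebraic_int_diff[OF x y]])
  then show ?thesis by (simp add: int_cong_def)
qed

text \<open>The multiple of \<open>l\<close> makes the real part of \<open>f a\<close> positive, so that its principal root commutes
  with complex conjugation.\<close>

definition f :: "nat \<Rightarrow> complex" where
  "f a = of_nat (1 + l * (c * (\<Sum>k<n. z ^ ((n - 1) * k))))
     + of_nat c * (\<Sum>k<n. of_nat (z ^ ((n - 1) * k)) * \<zeta> ^ (a * k))"

lemma f_int: "algebraic_int (f a)"
  unfolding f_def
  by (intro algebraic_int_add algebraic_int_times algebraic_int_sum algebraic_int_power \<zeta>_int
      algebraic_int_of_nat)

lemma f_cong: "[a = b] (mod n) \<Longrightarrow> f a = f b"
proof -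
  assume "[a = b] (mod n)"
  then have "\<zeta> ^ (a * k) = \<zeta> ^ (b * k)" for k by (intro \<zeta>_cong cong_mult cong_refl)
  then show ?thesis by (simp add: f_def)
qed

lemma f_cyclo: "(\<lambda>w. f (w * a)) \<in> cyclo_fun n"
  unfolding f_def mult.assoc
  by (intro cyclo_fun_add cyclo_fun_mult cyclo_fun_sum cyclo_fun_const cyclo_fun_power_root n
      Rats_of_nat)

lemma Re_f: "Re (f a) > 0"
proof -
  define M where "M = (\<Sum>k<n. z ^ ((n - 1) * k))"
  define T where "T = (\<Sum>k<n. of_nat (z ^ ((n - 1) * k)) * \<zeta> ^ (a * k))"
  have "cmod T \<le> (\<Sum>k<n. real (z ^ ((n - 1) * k)))"
    unfolding T_def by (rule order_trans[OF norm_sum]) (simp add: norm_mult root1_power norm_power)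
  also have "\<dots> = real M" by (simp add: M_def)
  finally have "\<bar>Re T\<bar> \<le> real M" using abs_Re_le_cmod[of T] by linarith
  then have "real c * Re T \<ge> real c * (- real M)" by (intro mult_left_mono) auto
  moreover have "real (c * M) * 1 \<le> real (c * M) * real l"
    using l_gt_1 by (intro mult_left_mono) auto
  moreover have "Re (f a) = 1 + real (c * M) * real l + real c * Re T"
    unfolding f_def M_def[symmetric] T_def[symmetric] by (simp add: mult_ac)
  ultimately show ?thesis by simp
qed

lemma cnj_\<zeta>_power: "cnj (\<zeta> ^ k) = \<zeta> ^ ((n - 1) * k)"
proof -
  have "\<zeta> ^ ((n - 1) * k) * \<zeta> ^ k = \<zeta> ^ 0"
    unfolding power_add[symmetric] by (intro \<zeta>_cong nat_pred_cong n)
  moreover have "cnj (\<zeta> ^ k) * \<zeta> ^ k = 1"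
    by (simp add: root1_power cis_cnj cis_mult)
  ultimately have "cnj (\<zeta> ^ k) * \<zeta> ^ k = \<zeta> ^ ((n - 1) * k) * \<zeta> ^ k" by simp
  moreover have nz: "\<zeta> ^ k \<noteq> 0" by (simp add: root1_power)
  ultimately show ?thesis using mult_right_cancel[OF nz] by blast
qed

lemma cnj_f: "cnj (f a) = f ((n - 1) * a)"
proof -
  have "cnj (\<zeta> ^ (a * k)) = \<zeta> ^ ((n - 1) * a * k)" for k
    unfolding cnj_\<zeta>_power by (simp add: mult.assoc)
  then show ?thesis
    by (simp only: f_def complex_cnj_add complex_cnj_mult cnj_sum complex_cnj_of_nat)
qed

definition inv_mod :: "nat \<Rightarrow> nat" where
  "inv_mod s = (SOME a. a \<in> U \<and> [a * s = 1] (mod n))"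

lemma inv_mod: "s \<in> U \<Longrightarrow> inv_mod s \<in> U \<and> [inv_mod s * s = 1] (mod n)"
proof -
  assume "s \<in> U"
  then obtain a where "a \<in> U" "[s * a = 1] (mod n)" using units_mod_inverse[OF n] by blast
  then have "a \<in> U \<and> [a * s = 1] (mod n)" by (simp add: mult.commute)
  then show ?thesis unfolding inv_mod_def by (rule someI)
qed

text \<open>The index is inverted so that the conjugate with residue \<open>g\<close> at the prime
  belonging to \<open>v\<close> is \<beta> v.\<close>

definition \<beta> :: "nat \<Rightarrow> complex" where
  "\<beta> s = f (inv_mod s)"

lemma \<beta>_eq:
  assumes s: "s \<in> U" and a: "[a * s = 1] (mod n)"
  shows "\<beta> s = f a"
proof -
  have "[inv_mod s * (a * s) = inv_mod s * 1] (mod n)" by (intro cong_mult cong_refl a)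
  moreover have "[a * (inv_mod s * s) = a * 1] (mod n)"
    using inv_mod[OF s] by (intro cong_mult cong_refl) auto
  moreover have "a * (inv_mod s * s) = inv_mod s * (a * s)" by simp
  ultimately have "[inv_mod s = a] (mod n)" by (metis cong_sym cong_trans mult_1_right)
  then show ?thesis unfolding \<beta>_def by (rule f_cong)
qed

text \<open>The sum in \<open>f\<close> is a finite Fourier transform: with \<open>a\<close> inverse
  to \<open>s\<close> it acts on \<open>E v\<close> as the sum of
  \<open>z ^ (k * (a * v - 1))\<close>, which is \<open>n\<close> for \<open>v = s\<close> and 0 for
  the other units. So \<beta> s acts as \<open>1 + c * n\<close>, that is \<open>g\<close>, or as
  1.\<close>

lemma \<beta>_acts:
  assumes s: "s \<in> U" and v: "v \<in> U"
  shows "acts v (\<beta> s) (if s = v then g else 1)"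
proof -
  let ?a = "inv_mod s" and ?h = "\<lambda>k. z ^ ((n - 1) * k)"
  let ?M = "c * (\<Sum>k<n. ?h k)"
  have cong_w: "[(n - 1) * k + v * (?a * k) = k * (?a * (v + (n - 1) * s))] (mod n)" for k
  proof -
    have "[k * (?a * v) + k * (n - 1) * (?a * s) = k * (?a * v) + k * (n - 1) * 1] (mod n)"
      using inv_mod[OF s] by (intro cong_add cong_mult cong_refl) auto
    then have "[k * (?a * v) + k * (n - 1) = k * (?a * v) + k * (n - 1) * (?a * s)] (mod n)"
      by (simp add: cong_sym_eq)
    then show ?thesis by (simp only: distrib_left ac_simps)
  qed
  have "acts v (\<beta> s) ((1 + l * ?M) + c * (\<Sum>k<n. ?h k * (z ^ v) ^ (?a * k)))"
    unfolding \<beta>_def f_def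
    by (intro acts_add acts_mult acts_sum acts_power acts_\<zeta> acts_of_nat)
  moreover have "[(1 + l * ?M) + c * (\<Sum>k<n. ?h k * (z ^ v) ^ (?a * k)) = (if s = v then g else 1)] (mod l)"
  proof -
    have "[?h k * (z ^ v) ^ (?a * k) = z ^ (?a * (v + (n - 1) * s) * k)] (mod l)" for k
    proof -
      have "?h k * (z ^ v) ^ (?a * k) = z ^ ((n - 1) * k + v * (?a * k))"
        by (simp only: power_add power_mult[of z v])
      moreover have "?a * (v + (n - 1) * s) * k = k * (?a * (v + (n - 1) * s))"
        by (rule mult.commute)
      ultimately show ?thesis using z_cong[OF cong_w[of k]] by (simp only:)
    qed
    then have "[(\<Sum>k<n. ?h k * (z ^ v) ^ (?a * k)) = (\<Sum>k<n. z ^ (?a * (v + (n - 1) * s) * k))] (mod l)"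
      by (rule cong_sum)
    also have "[(\<Sum>k<n. z ^ (?a * (v + (n - 1) * s) * k)) =
        (if n dvd ?a * (v + (n - 1) * s) then n else 0)] (mod l)"
      by (rule z_sum)
    also have "n dvd ?a * (v + (n - 1) * s) \<longleftrightarrow> s = v"
    proof -
      have "coprime n ?a" using inv_mod[OF s] by (simp add: units_mod_def coprime_commute)
      then have "n dvd ?a * (v + (n - 1) * s) \<longleftrightarrow> n dvd v + (n - 1) * s"
        by (rule coprime_dvd_mult_right_iff)
      then show ?thesis using dvd_pred_iff[OF n, of v s] s v by (auto simp: units_mod_def)
    qed
    finally have "[(1 + l * ?M) + c * (\<Sum>k<n. ?h k * (z ^ v) ^ (?a * k)) =
        (1 + 0) + c * (if s = v then n else 0)] (mod l)"
      by (intro cong_add cong_mult cong_refl) (auto simp: cong_def)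
    also have "[(1 + 0) + c * (if s = v then n else 0) = (if s = v then g else 1)] (mod l)"
      using c by simp
    finally show ?thesis .
  qed
  ultimately show ?thesis by (rule acts_cong)
qed

end

context kummer_data
begin

section \<open>Kummer generators and the family \<alpha>\<close>

lemma \<beta>_int: "algebraic_int (\<beta> s)"
  by (simp add: \<beta>_def f_int)

definition b :: "nat \<Rightarrow> complex" where
  "b s = nroot n (\<beta> s)"

lemma b_power: "b s ^ n = \<beta> s"
  by (simp add: b_def nroot_power n)

lemma b_int: "algebraic_int (b s)"
  by (rule algebraic_int_root[where p = "monom 1 n" and y = "\<beta> s"])
    (use n in \<open>auto simp: poly_monom b_power degree_monom_eq \<beta>_int\<close>)

definition \<omega> :: "nat \<Rightarrow> complex" where
  "\<omega> t = (\<Prod>s\<in>U. b s ^ ((t * s) mod n))"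

text \<open>The cocycle of carries: when the reduced exponents of \<open>b s\<close> add up to
  \<open>n\<close> or more, a factor \<open>b s ^ n = \<beta> s\<close> splits off.\<close>

definition \<gamma> :: "nat \<Rightarrow> nat \<Rightarrow> complex" where
  "\<gamma> t v = (\<Prod>s\<in>U. \<beta> s ^ (((t * s) mod n + (v * s) mod n) div n))"

definition N :: complex where
  "N = (\<Prod>s\<in>U. \<beta> s)"

text \<open>An integral substitute for the inverse of \<omega> t: the exponents are complemented to
  \<open>n\<close>, so that the product is \<open>N\<close>.\<close>

definition \<omega>' :: "nat \<Rightarrow> complex" where
  "\<omega>' t = (\<Prod>s\<in>U. b s ^ (n - (t * s) mod n))"

lemma \<omega>_int: "algebraic_int (\<omega> t)"
  unfolding \<omega>_def by (intro algebraic_int_prod algebraic_int_power b_int)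

lemma \<omega>'_int: "algebraic_int (\<omega>' t)"
  unfolding \<omega>'_def by (intro algebraic_int_prod algebraic_int_power b_int)

lemma \<omega>_cong: "[t = v] (mod n) \<Longrightarrow> \<omega> t = \<omega> v"
proof -
  assume "[t = v] (mod n)"
  then have "(t * s) mod n = (v * s) mod n" for s
    using cong_mult[OF _ cong_refl, of t v n s] by (simp add: cong_def)
  then show ?thesis by (simp add: \<omega>_def)
qed

lemma \<gamma>_cong: "[t = t'] (mod n) \<Longrightarrow> [v = v'] (mod n) \<Longrightarrow> \<gamma> t v = \<gamma> t' v'"
proof -
  assume tv: "[t = t'] (mod n)" "[v = v'] (mod n)"
  have "(t * s) mod n = (t' * s) mod n" "(v * s) mod n = (v' * s) mod n" for s
    using cong_mult[OF tv(1) cong_refl, of s] cong_mult[OF tv(2) cong_refl, of s]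
    by (simp_all add: cong_def)
  then show ?thesis by (simp add: \<gamma>_def)
qed

lemma \<omega>_0: "\<omega> 0 = 1"
  by (simp add: \<omega>_def)

lemma \<omega>_mult: "\<omega> t * \<omega> v = \<omega> (t + v) * \<gamma> t v"
proof -
  have eq: "b s ^ ((t * s) mod n) * b s ^ ((v * s) mod n) =
      b s ^ (((t + v) * s) mod n) * \<beta> s ^ (((t * s) mod n + (v * s) mod n) div n)" for s
  proof -
    let ?e = "(t * s) mod n + (v * s) mod n"
    have "b s ^ ?e = b s ^ (?e mod n + n * (?e div n))" by simp
    also have "\<dots> = b s ^ (?e mod n) * (b s ^ n) ^ (?e div n)" by (simp only: power_add power_mult)
    also have "?e mod n = ((t + v) * s) mod n" by (simp add: mod_add_eq distrib_right)
    finally show ?thesis by (simp only: power_add b_power)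
  qed
  show ?thesis
    unfolding \<omega>_def \<gamma>_def prod.distrib[symmetric] by (intro prod.cong refl eq)
qed

lemma \<omega>_\<omega>': "\<omega> t * \<omega>' t = N"
proof -
  have eq: "b s ^ ((t * s) mod n) * b s ^ (n - (t * s) mod n) = \<beta> s" for s
  proof -
    have "(t * s) mod n \<le> n" by (rule less_imp_le) (rule mod_less_divisor[OF n])
    then show ?thesis by (simp only: power_add[symmetric] le_add_diff_inverse b_power)
  qed
  show ?thesis
    unfolding \<omega>_def \<omega>'_def N_def prod.distrib[symmetric] by (intro prod.cong refl eq)
qed

lemma cnj_\<beta>:
  assumes s: "s \<in> U"
  shows "cnj (\<beta> s) = \<beta> (((n - 1) * s) mod n)" and "((n - 1) * s) mod n \<in> U"
proof -
  show s': "((n - 1) * s) mod n \<in> U"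
  proof -
    have "[(n - 1) * ((n - 1) * s) = s] (mod n)" by (rule nat_pred_cong(2)[OF n])
    moreover have "coprime s n" using s by (simp add: units_mod_def)
    ultimately have "coprime ((n - 1) * ((n - 1) * s)) n" using cong_imp_coprime cong_sym by blast
    then show ?thesis using n by (simp add: units_mod_def)
  qed
  have "cnj (\<beta> s) = f ((n - 1) * inv_mod s)" by (simp only: \<beta>_def cnj_f)
  also have "\<dots> = \<beta> (((n - 1) * s) mod n)"
  proof (rule \<beta>_eq[OF s', symmetric])
    have "[(n - 1) * inv_mod s * (((n - 1) * s) mod n) = (n - 1) * inv_mod s * ((n - 1) * s)] (mod n)"
      by (intro cong_mult cong_refl) (simp add: cong_def)
    also have "(n - 1) * inv_mod s * ((n - 1) * s) = (n - 1) * ((n - 1) * (inv_mod s * s))"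
      by (simp only: mult_ac)
    also have "[\<dots> = inv_mod s * s] (mod n)" by (rule nat_pred_cong(2)[OF n])
    also have "[inv_mod s * s = 1] (mod n)" using inv_mod[OF s] by blast
    finally show "[(n - 1) * inv_mod s * (((n - 1) * s) mod n) = 1] (mod n)" .
  qed
  finally show "cnj (\<beta> s) = \<beta> (((n - 1) * s) mod n)" .
qed

lemma pred_unit: "(n - 1) mod n \<in> U"
proof -
  have "1 mod n \<in> U" using n by (cases "n = 1") (auto simp: units_mod_def)
  then have "((n - 1) * (1 mod n)) mod n \<in> U" by (rule cnj_\<beta>(2))
  then show ?thesis using mod_mult_right_eq[of "n - 1" 1 n] by (simp only: mult_1_right)
qed

lemma cnj_b: "s \<in> U \<Longrightarrow> cnj (b s) = b (((n - 1) * s) mod n)"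
proof -
  assume s: "s \<in> U"
  have "Re (\<beta> s) > 0" by (simp add: \<beta>_def Re_f)
  then show ?thesis by (simp only: b_def cnj_\<beta>(1)[OF s, symmetric] nroot_cnj)
qed

text \<open>Conjugation acts as the unit -1: it sends \<open>b s\<close> to \<open>b (- s)\<close>,
  and the substitution of \<open>- s\<close> for \<open>s\<close> changes the exponent
  \<open>t * s\<close> into \<open>- t * s\<close>.\<close>

lemma cnj_\<omega>: "cnj (\<omega> t) = \<omega> ((n - 1) * t)"
proof -
  let ?u = "(n - 1) mod n"
  have "cnj (\<omega> t) = (\<Prod>s\<in>U. b (((n - 1) * s) mod n) ^ ((t * s) mod n))"
    unfolding \<omega>_def cnj_prod complex_cnj_power by (intro prod.cong refl) (simp add: cnj_b)
  also have "\<dots> = (\<Prod>s\<in>U. b ((?u * s) mod n) ^ (((n - 1) * t * ((?u * s) mod n)) mod n))"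
  proof (intro prod.cong refl)
    fix s
    have u: "(?u * s) mod n = ((n - 1) * s) mod n" by (simp add: mod_mult_left_eq)
    have "[(n - 1) * t * ((?u * s) mod n) = (n - 1) * t * ((n - 1) * s)] (mod n)"
      unfolding u by (intro cong_mult cong_refl) (simp add: cong_def)
    also have "(n - 1) * t * ((n - 1) * s) = (n - 1) * ((n - 1) * (t * s))" by (simp only: mult_ac)
    also have "[\<dots> = t * s] (mod n)" by (rule nat_pred_cong(2)[OF n])
    finally have "((n - 1) * t * ((?u * s) mod n)) mod n = (t * s) mod n" by (simp only: cong_def)
    then show "b (((n - 1) * s) mod n) ^ ((t * s) mod n) =
        b ((?u * s) mod n) ^ (((n - 1) * t * ((?u * s) mod n)) mod n)"
      by (simp only: u)
  qed
  also have "\<dots> = \<omega> ((n - 1) * t)"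
    unfolding \<omega>_def by (rule units_mod_prod[OF n pred_unit])
  finally show ?thesis .
qed

text \<open>An inverse finite Fourier transform: up to the factor \<open>n\<close>, the \<omega> t
  are the Lagrange resolvents of the \<alpha> j, as \<open>\<omega>_from_\<alpha>\<close> shows.
  Shifting \<open>j\<close> by one multiplies \<omega> t by \<zeta> ^ t.\<close>

definition \<alpha> :: "nat \<Rightarrow> complex" where
  "\<alpha> j = (\<Sum>t<n. \<zeta> ^ (j * t) * \<omega> t)"

definition \<alpha>' :: "nat \<Rightarrow> complex" where
  "\<alpha>' j = (\<Sum>t<n. \<zeta> ^ ((n - 1) * j * t) * \<omega>' t)"

text \<open>Obtained by multiplying out the two sums with \<open>\<omega>_mult\<close> and writing
  \<omega> (t + v) back as a resolvent; the latter brings in the division by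
  \<open>n\<close>.\<close>

definition coef :: "nat \<Rightarrow> nat \<Rightarrow> nat \<Rightarrow> complex" where
  "coef i j m = (\<Sum>t<n. \<Sum>v<n. \<zeta> ^ (i * t + j * v + (n - 1) * m * (t + v)) * \<gamma> t v) / of_nat n"

lemma \<alpha>_int: "algebraic_int (\<alpha> j)"
  unfolding \<alpha>_def by (intro algebraic_int_sum algebraic_int_times algebraic_int_power \<zeta>_int \<omega>_int)

lemma \<alpha>'_int: "algebraic_int (\<alpha>' j)"
  unfolding \<alpha>'_def by (intro algebraic_int_sum algebraic_int_times algebraic_int_power \<zeta>_int \<omega>'_int)

lemma \<alpha>_period: "\<alpha> (j + n) = \<alpha> j"
proof -
  have "\<zeta> ^ ((j + n) * t) = \<zeta> ^ (j * t)" for t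
    by (rule \<zeta>_cong) (simp add: cong_def distrib_right)
  then show ?thesis by (simp add: \<alpha>_def)
qed

lemma \<alpha>_real: "\<alpha> j \<in> \<real>"
proof -
  define F where "F t = \<zeta> ^ (j * t) * \<omega> t" for t
  have F_cong: "F t = F v" if tv: "[t = v] (mod n)" for t v
    unfolding F_def using \<omega>_cong[OF tv] \<zeta>_cong[OF cong_mult[OF cong_refl tv, of j]] by simp
  have "cnj (\<alpha> j) = (\<Sum>t<n. F (((n - 1) mod n * t) mod n))"
  proof -
    have "cnj (\<zeta> ^ (j * t) * \<omega> t) = F (((n - 1) mod n * t) mod n)" for t
    proof -
      have "cnj (\<zeta> ^ (j * t) * \<omega> t) = F ((n - 1) * t)"
        unfolding complex_cnj_mult cnj_\<zeta>_power cnj_\<omega> F_def by (simp only: mult_ac)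
      also have "\<dots> = F (((n - 1) mod n * t) mod n)"
        by (rule F_cong) (simp add: cong_def mod_mult_left_eq)
      finally show ?thesis .
    qed
    then show ?thesis unfolding \<alpha>_def cnj_sum by simp
  qed
  also have "\<dots> = (\<Sum>t<n. F t)" by (rule sum_times_mod[OF n pred_unit])
  finally show ?thesis by (simp add: Reals_cnj_iff \<alpha>_def F_def)
qed

lemma \<omega>_from_\<alpha>:
  "(\<Sum>m<n. \<zeta> ^ ((n - 1) * m * w) * \<alpha> (m + k)) = of_nat n * \<zeta> ^ (k * w) * \<omega> w"
proof -
  have ph: "(\<Sum>m<n. \<zeta> ^ ((n - 1) * m * w) * \<zeta> ^ ((m + k) * t)) =
      \<zeta> ^ (k * t) * (if t = w mod n then of_nat n else 0)" if t: "t < n" for t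
  proof -
    have "\<zeta> ^ ((n - 1) * m * w) * \<zeta> ^ ((m + k) * t) = \<zeta> ^ (k * t) * \<zeta> ^ (m * (t + (n - 1) * w))" for m
      unfolding power_add[symmetric] by (simp only: distrib_left distrib_right ac_simps)
    then have "(\<Sum>m<n. \<zeta> ^ ((n - 1) * m * w) * \<zeta> ^ ((m + k) * t)) =
        \<zeta> ^ (k * t) * (\<Sum>m<n. \<zeta> ^ (m * (t + (n - 1) * w)))"
      by (simp only: sum_distrib_left)
    also have "(\<Sum>m<n. \<zeta> ^ (m * (t + (n - 1) * w))) = (if n dvd t + (n - 1) * w then of_nat n else 0)"
      by (rule root1_sum[OF n])
    also have "n dvd t + (n - 1) * w \<longleftrightarrow> t = w mod n"
    proof -
      have "[t + (n - 1) * w = t + (n - 1) * (w mod n)] (mod n)"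
        by (intro cong_add cong_mult cong_refl) (simp add: cong_def)
      then have "n dvd t + (n - 1) * w \<longleftrightarrow> n dvd t + (n - 1) * (w mod n)"
        by (rule cong_dvd_iff[OF _ , of _ _ n, THEN iffD1, rotated] | simp add: cong_def dvd_eq_mod_eq_0)
      then show ?thesis using dvd_pred_iff[OF n t, of "w mod n"] n by simp
    qed
    finally show ?thesis .
  qed
  have "(\<Sum>m<n. \<zeta> ^ ((n - 1) * m * w) * \<alpha> (m + k)) =
      (\<Sum>m<n. \<Sum>t<n. \<zeta> ^ ((n - 1) * m * w) * \<zeta> ^ ((m + k) * t) * \<omega> t)"
    by (simp only: \<alpha>_def sum_distrib_left mult.assoc)
  also have "\<dots> = (\<Sum>t<n. \<Sum>m<n. \<zeta> ^ ((n - 1) * m * w) * \<zeta> ^ ((m + k) * t) * \<omega> t)"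
    by (rule sum.swap)
  also have "\<dots> = (\<Sum>t<n. (\<Sum>m<n. \<zeta> ^ ((n - 1) * m * w) * \<zeta> ^ ((m + k) * t)) * \<omega> t)"
    by (simp only: sum_distrib_right)
  also have "\<dots> = (\<Sum>t<n. if t = w mod n then \<zeta> ^ (k * t) * of_nat n * \<omega> t else 0)"
  proof (intro sum.cong refl)
    fix t assume "t \<in> {..<n}"
    then have "t < n" by simp
    then show "(\<Sum>m<n. \<zeta> ^ ((n - 1) * m * w) * \<zeta> ^ ((m + k) * t)) * \<omega> t =
        (if t = w mod n then \<zeta> ^ (k * t) * of_nat n * \<omega> t else 0)"
      by (simp only: ph) simp
  qed
  also have "\<dots> = \<zeta> ^ (k * (w mod n)) * of_nat n * \<omega> (w mod n)" using n by simp
  also have "\<omega> (w mod n) = \<omega> w" by (rule \<omega>_cong) (simp add: cong_def)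
  also have "\<zeta> ^ (k * (w mod n)) = \<zeta> ^ (k * w)"
    by (rule \<zeta>_cong) (simp add: cong_def mod_mult_right_eq)
  finally show ?thesis by simp
qed

text \<open>The shift by \<open>k\<close> multiplies the term of \<open>t\<close> and
  \<open>v\<close> by \<zeta> ^ (k (t + v)), and the resolvent that yields \<omega> (t + v) from the
  shifted family carries the same factor. Hence \<open>coef\<close> is independent of
  \<open>k\<close>.\<close>

lemma \<alpha>_mult: "\<alpha> (i + k) * \<alpha> (j + k) = (\<Sum>m<n. coef i j m * \<alpha> (m + k))"
proof -
  have "of_nat n * (\<alpha> (i + k) * \<alpha> (j + k)) =
      of_nat n * (\<Sum>t<n. \<Sum>v<n. (\<zeta> ^ ((i + k) * t) * \<omega> t) * (\<zeta> ^ ((j + k) * v) * \<omega> v))"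
    by (simp only: \<alpha>_def sum_product)
  also have "\<dots> = (\<Sum>t<n. \<Sum>v<n. \<zeta> ^ (i * t + j * v) * \<gamma> t v *
      (of_nat n * \<zeta> ^ (k * (t + v)) * \<omega> (t + v)))"
    unfolding sum_distrib_left
  proof (intro sum.cong refl)
    fix t v
    have "\<zeta> ^ ((i + k) * t) * \<zeta> ^ ((j + k) * v) = \<zeta> ^ (i * t + j * v) * \<zeta> ^ (k * (t + v))"
      unfolding power_add[symmetric] by (simp only: distrib_left distrib_right ac_simps)
    moreover have "of_nat n * ((\<zeta> ^ ((i + k) * t) * \<omega> t) * (\<zeta> ^ ((j + k) * v) * \<omega> v)) =
        of_nat n * (\<zeta> ^ ((i + k) * t) * \<zeta> ^ ((j + k) * v)) * (\<omega> t * \<omega> v)"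
      by (simp only: mult_ac)
    ultimately show "of_nat n * ((\<zeta> ^ ((i + k) * t) * \<omega> t) * (\<zeta> ^ ((j + k) * v) * \<omega> v)) =
        \<zeta> ^ (i * t + j * v) * \<gamma> t v * (of_nat n * \<zeta> ^ (k * (t + v)) * \<omega> (t + v))"
      unfolding \<omega>_mult by (simp only: mult_ac)
  qed
  also have "\<dots> = (\<Sum>t<n. \<Sum>v<n. \<Sum>m<n. \<zeta> ^ (i * t + j * v) * \<gamma> t v *
      (\<zeta> ^ ((n - 1) * m * (t + v)) * \<alpha> (m + k)))"
    by (simp only: \<omega>_from_\<alpha>[symmetric] sum_distrib_left)
  also have "\<dots> = (\<Sum>t<n. \<Sum>m<n. \<Sum>v<n. \<zeta> ^ (i * t + j * v) * \<gamma> t v *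
      (\<zeta> ^ ((n - 1) * m * (t + v)) * \<alpha> (m + k)))"
    by (intro sum.cong refl sum.swap)
  also have "\<dots> = (\<Sum>m<n. \<Sum>t<n. \<Sum>v<n. \<zeta> ^ (i * t + j * v) * \<gamma> t v *
      (\<zeta> ^ ((n - 1) * m * (t + v)) * \<alpha> (m + k)))"
    by (rule sum.swap)
  also have "\<dots> = (\<Sum>m<n. (of_nat n * coef i j m) * \<alpha> (m + k))"
  proof (intro sum.cong refl)
    fix m
    have eq: "of_nat n * coef i j m =
        (\<Sum>t<n. \<Sum>v<n. \<zeta> ^ (i * t + j * v + (n - 1) * m * (t + v)) * \<gamma> t v)"
      using n by (simp add: coef_def)
    show "(\<Sum>t<n. \<Sum>v<n. \<zeta> ^ (i * t + j * v) * \<gamma> t v * (\<zeta> ^ ((n - 1) * m * (t + v)) * \<alpha> (m + k))) =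
        (of_nat n * coef i j m) * \<alpha> (m + k)"
      unfolding eq sum_distrib_right by (intro sum.cong refl) (simp only: power_add mult_ac)
  qed
  also have "\<dots> = of_nat n * (\<Sum>m<n. coef i j m * \<alpha> (m + k))"
    by (simp only: sum_distrib_left mult.assoc)
  finally show ?thesis using n by simp
qed

text \<open>\<open>f (w * a)\<close> is the conjugate of \<open>f a\<close> under \<zeta> \<mapsto>
  \<zeta> ^ w; this conjugation takes the \<beta> of index \<open>w * s\<close> back to \<beta>
  s.\<close>

lemma \<beta>_times:
  assumes w: "w \<in> U" and s: "s \<in> U"
  shows "f (w * inv_mod ((w * s) mod n)) = \<beta> s"
proof (rule \<beta>_eq[OF s, symmetric])
  let ?r = "(w * s) mod n"
  have r: "?r \<in> U" by (rule units_mod_times[OF n w s])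
  have "w * inv_mod ?r * s = inv_mod ?r * (w * s)" by (simp only: mult_ac)
  also have "[\<dots> = inv_mod ?r * ?r] (mod n)" by (intro cong_mult cong_refl) (simp add: cong_def)
  also have "[inv_mod ?r * ?r = 1] (mod n)" using inv_mod[OF r] by blast
  finally show "[w * inv_mod ?r * s = 1] (mod n)" .
qed

text \<open>The function of \<open>w\<close> is \<open>coef\<close> with \<zeta> formally replaced
  by \<zeta> ^ w, the carry exponents staying fixed. Replacing \<open>s\<close> by
  \<open>w * s\<close> turns the conjugate of \<gamma> t v into \<gamma> (w t) (w v), the root of
  unity changes alike, and summing over all \<open>t\<close> and \<open>v\<close> absorbs
  \<open>w\<close>.\<close>

lemma coef_rat: "coef i j m \<in> \<rat>"
proof (rule cyclo_fun_invariant_rat[OF n])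
  let ?e = "\<lambda>t v s. ((t * s) mod n + (v * s) mod n) div n"
  let ?x = "\<lambda>t v. i * t + j * v + (n - 1) * m * (t + v)"
  let ?\<phi> = "\<lambda>w. inverse (of_nat n) *
    (\<Sum>t<n. \<Sum>v<n. \<zeta> ^ (w * ?x t v) * (\<Prod>s\<in>U. f (w * inv_mod s) ^ ?e t v s))"
  show "?\<phi> \<in> cyclo_fun n"
    by (intro cyclo_fun_mult cyclo_fun_sum cyclo_fun_const cyclo_fun_power_root cyclo_fun_prod
        cyclo_fun_power f_cyclo n Rats_inverse Rats_of_nat)
  fix w assume w: "w \<in> U"
  have \<gamma>w: "(\<Prod>s\<in>U. f (w * inv_mod s) ^ ?e t v s) = \<gamma> (w * t) (w * v)" for t v
  proof -
    have "(\<Prod>s\<in>U. f (w * inv_mod s) ^ ?e t v s) =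
        (\<Prod>s\<in>U. f (w * inv_mod ((w * s) mod n)) ^ ?e t v ((w * s) mod n))"
      by (rule units_mod_prod[OF n w, symmetric])
    also have "\<dots> = (\<Prod>s\<in>U. \<beta> s ^ ?e (w * t) (w * v) s)"
    proof (intro prod.cong refl)
      fix s assume "s \<in> U"
      moreover have "(u * ((w * s) mod n)) mod n = (w * u * s) mod n" for u
        by (simp add: mod_mult_right_eq mult_ac)
      ultimately show "f (w * inv_mod ((w * s) mod n)) ^ ?e t v ((w * s) mod n) =
          \<beta> s ^ ?e (w * t) (w * v) s"
        by (simp only: \<beta>_times[OF w])
    qed
    finally show ?thesis by (simp only: \<gamma>_def)
  qed
  define H where "H t v = \<zeta> ^ ?x t v * \<gamma> t v" for t v
  have H_cong: "H t v = H (t mod n) (v mod n)" for t v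
  proof -
    have c: "[t = t mod n] (mod n)" "[v = v mod n] (mod n)" by (simp_all add: cong_def)
    have "[?x t v = ?x (t mod n) (v mod n)] (mod n)"
      by (intro cong_add cong_mult cong_refl c)
    then show ?thesis unfolding H_def using \<gamma>_cong[OF c] \<zeta>_cong by metis
  qed
  have "(\<Sum>t<n. \<Sum>v<n. \<zeta> ^ (w * ?x t v) * (\<Prod>s\<in>U. f (w * inv_mod s) ^ ?e t v s)) =
      (\<Sum>t<n. \<Sum>v<n. H ((w * t) mod n) ((w * v) mod n))"
  proof (intro sum.cong refl)
    fix t v
    have "w * ?x t v = ?x (w * t) (w * v)" by (simp only: distrib_left mult_ac)
    then have "\<zeta> ^ (w * ?x t v) * (\<Prod>s\<in>U. f (w * inv_mod s) ^ ?e t v s) = H (w * t) (w * v)"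
      unfolding \<gamma>w H_def by (simp only:)
    then show "\<zeta> ^ (w * ?x t v) * (\<Prod>s\<in>U. f (w * inv_mod s) ^ ?e t v s) = H ((w * t) mod n) ((w * v) mod n)"
      using H_cong[of "w * t" "w * v"] by (simp only:)
  qed
  also have "\<dots> = (\<Sum>t<n. \<Sum>v<n. H ((w * t) mod n) v)"
    by (intro sum.cong refl sum_times_mod[OF n w])
  also have "\<dots> = (\<Sum>t<n. \<Sum>v<n. H t v)"
    by (rule sum_times_mod[OF n w, of "\<lambda>t. \<Sum>v<n. H t v"])
  finally show "?\<phi> w = coef i j m"
    by (simp only: coef_def H_def divide_inverse mult.commute)
qed

lemma \<alpha>_total: "(\<Sum>j<n. \<alpha> (j + k)) = of_nat n"
  using \<omega>_from_\<alpha>[of 0 k] by (simp add: \<omega>_0)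

text \<open>One factor \<open>n\<close> comes from the resolvent, the other from orthogonality of
  the characters, and \<open>N\<close> from \<open>\<omega>_\<omega>'\<close>.\<close>

lemma \<alpha>_dual:
  assumes ij: "i < n" "j < n"
  shows "(\<Sum>k<n. \<alpha> (i + k) * \<alpha>' (j + k)) = (if i = j then of_nat n ^ 2 * N else 0)"
proof -
  have inner: "(\<Sum>k<n. \<zeta> ^ ((n - 1) * (j + k) * v) * \<alpha> (i + k)) =
      \<zeta> ^ ((n - 1) * j * v) * (of_nat n * \<zeta> ^ (i * v) * \<omega> v)" for v
  proof -
    have "(\<Sum>k<n. \<zeta> ^ ((n - 1) * (j + k) * v) * \<alpha> (i + k)) =
        \<zeta> ^ ((n - 1) * j * v) * (\<Sum>k<n. \<zeta> ^ ((n - 1) * k * v) * \<alpha> (k + i))"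
      by (simp only: sum_distrib_left distrib_left distrib_right power_add mult_ac add.commute)
    then show ?thesis by (simp only: \<omega>_from_\<alpha>)
  qed
  have "(\<Sum>k<n. \<alpha> (i + k) * \<alpha>' (j + k)) =
      (\<Sum>k<n. \<Sum>v<n. \<zeta> ^ ((n - 1) * (j + k) * v) * \<alpha> (i + k) * \<omega>' v)"
    by (simp only: \<alpha>'_def sum_distrib_left mult_ac)
  also have "\<dots> = (\<Sum>v<n. \<Sum>k<n. \<zeta> ^ ((n - 1) * (j + k) * v) * \<alpha> (i + k) * \<omega>' v)"
    by (rule sum.swap)
  also have "\<dots> = (\<Sum>v<n. (\<Sum>k<n. \<zeta> ^ ((n - 1) * (j + k) * v) * \<alpha> (i + k)) * \<omega>' v)"
    by (simp only: sum_distrib_right)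
  also have "\<dots> = (\<Sum>v<n. \<zeta> ^ (v * (i + (n - 1) * j)) * (of_nat n * (\<omega> v * \<omega>' v)))"
    unfolding inner by (simp only: power_add distrib_left mult_ac)
  also have "\<dots> = (\<Sum>v<n. \<zeta> ^ (v * (i + (n - 1) * j))) * (of_nat n * N)"
    by (simp only: \<omega>_\<omega>' sum_distrib_right)
  also have "(\<Sum>v<n. \<zeta> ^ (v * (i + (n - 1) * j))) = (if i = j then of_nat n else 0)"
    using root1_sum[OF n, of "i + (n - 1) * j"] dvd_pred_iff[OF n ij] by simp
  finally show ?thesis by (simp add: power2_eq_square)
qed

section \<open>The dual constant and the Frobenius congruence modulo \<open>l\<close>\<close>

lemma N_int: "N \<in> \<int>"
proof (rule rational_algebraic_int_is_int)
  show "algebraic_int N" unfolding N_def by (intro algebraic_int_prod \<beta>_int)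
  show "N \<in> \<rat>"
  proof (rule cyclo_fun_invariant_rat[OF n])
    show "(\<lambda>w. \<Prod>s\<in>U. f (w * inv_mod s)) \<in> cyclo_fun n"
      by (intro cyclo_fun_prod f_cyclo n)
    fix w assume w: "w \<in> U"
    have "(\<Prod>s\<in>U. f (w * inv_mod s)) = (\<Prod>s\<in>U. f (w * inv_mod ((w * s) mod n)))"
      by (rule units_mod_prod[OF n w, symmetric])
    also have "\<dots> = N" unfolding N_def by (intro prod.cong refl \<beta>_times w)
    finally show "(\<Prod>s\<in>U. f (w * inv_mod s)) = N" .
  qed
qed

lemma prod_\<beta>_acts:
  assumes v: "v \<in> U"
  shows "acts v (\<Prod>s\<in>U. \<beta> s ^ e s) (g ^ e v)"
proof -
  have "acts v (\<Prod>s\<in>U. \<beta> s ^ e s) (\<Prod>s\<in>U. (if s = v then g else 1) ^ e s)"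
    by (intro acts_prod acts_power \<beta>_acts v)
  also have "(\<Prod>s\<in>U. (if s = v then g else 1) ^ e s) = (\<Prod>s\<in>U. if s = v then g ^ e s else 1)"
    by (intro prod.cong refl) auto
  also have "\<dots> = g ^ e v" using v by simp
  finally show ?thesis .
qed

lemma N_cong: "N \<sim>\<^sub>l of_nat g"
proof (rule eq_if_acts_eq)
  show "algebraic_int N" unfolding N_def by (intro algebraic_int_prod \<beta>_int)
  fix v assume v: "v \<in> U"
  have "acts v N g" using prod_\<beta>_acts[OF v, of "\<lambda>_. 1"] by (simp add: N_def)
  then show "\<exists>a. acts v N a \<and> acts v (of_nat g) a" using acts_of_nat by blast
qed simp

text \<open>Exactly one factor of \<open>N\<close> has residue \<open>g\<close> at each prime over
  \<open>l\<close> and the others have residue 1, so the rational integer \<open>N\<close> is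
  \<open>g\<close> modulo \<open>l\<close>; both \<open>g\<close> and \<open>n\<close> are prime to
  \<open>l\<close>.\<close>

lemma dual_const:
  obtains d :: int where "of_int d = of_nat n ^ 2 * N" "coprime d (int l)"
proof -
  obtain N0 :: int where N0: "N = of_int N0" using N_int by (elim Ints_cases)
  have "algebraic_int ((complex_of_int N0 - of_nat g) / of_nat l)"
    using N_cong by (simp add: int_cong_def N0)
  moreover have "(of_int N0 - of_nat g) / of_nat l \<in> (\<rat> :: complex set)"
    by (intro Rats_divide Rats_diff) auto
  ultimately have "(of_int N0 - of_nat g) / of_nat l \<in> (\<int> :: complex set)"
    by (rule rational_algebraic_int_is_int)
  then obtain q where "(of_int N0 - of_nat g) / of_nat l = complex_of_int q" by (elim Ints_cases)
  then have "complex_of_int (N0 - int g) = of_int (q * int l)" using l_gt_1 by (simp add: field_simps)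
  then have "N0 - int g = q * int l" by (simp only: of_int_eq_iff)
  then have "[N0 = int g] (mod int l)" by (simp add: cong_iff_dvd_diff)
  from cong_imp_coprime[OF cong_sym[OF this]] have "coprime N0 (int l)" using g by simp
  then have "coprime (int n ^ 2 * N0) (int l)" using coprime_n_l by simp
  then show ?thesis using that[of "int n ^ 2 * N0"] by (simp add: N0)
qed

text \<open>At the prime belonging to \<open>v\<close>, only \<beta> v contributes to \<omega> t ^
  n, with residue \<open>g ^ (t * v mod n)\<close>. Raised to the power \<open>(l - 1) / n\<close>
  this becomes \<open>z ^ (t * v)\<close>, the residue of \<zeta> ^ t.\<close>

lemma \<omega>_frob: "\<omega> t ^ (l - 1) \<sim>\<^sub>l \<zeta> ^ t"
proof (rule eq_if_acts_eq)
  show "algebraic_int (\<omega> t ^ (l - 1))" by (intro algebraic_int_power \<omega>_int)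
  show "algebraic_int (\<zeta> ^ t)" by (intro algebraic_int_power \<zeta>_int)
  fix v assume v: "v \<in> U"
  let ?m = "(l - 1) div n"
  have lm: "l - 1 = n * ?m" using n_dvd by simp
  have "\<omega> t ^ n = (\<Prod>s\<in>U. \<beta> s ^ ((t * s) mod n))"
    unfolding \<omega>_def prod_power_distrib
    by (intro prod.cong refl) (simp only: b_power[symmetric] power_mult[symmetric] mult.commute)
  then have "acts v (\<omega> t ^ n) (g ^ ((t * v) mod n))" using prod_\<beta>_acts[OF v] by simp
  then have "acts v ((\<omega> t ^ n) ^ ?m) ((g ^ ((t * v) mod n)) ^ ?m)" by (rule acts_power)
  moreover have "(\<omega> t ^ n) ^ ?m = \<omega> t ^ (l - 1)"
    unfolding power_mult[symmetric] lm[symmetric] ..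
  moreover have "(g ^ ((t * v) mod n)) ^ ?m = z ^ ((t * v) mod n)"
    unfolding z_def power_mult[symmetric] by (simp only: mult.commute)
  ultimately have "acts v (\<omega> t ^ (l - 1)) (z ^ ((t * v) mod n))" by simp
  moreover have "acts v (\<zeta> ^ t) (z ^ ((t * v) mod n))"
  proof (rule acts_cong[OF acts_power[OF acts_\<zeta>]])
    have "[z ^ (v * t) = z ^ ((t * v) mod n)] (mod l)"
      by (rule z_cong) (simp add: cong_def mult.commute)
    then show "[(z ^ v) ^ t = z ^ ((t * v) mod n)] (mod l)" by (simp only: power_mult)
  qed
  ultimately show "\<exists>a. acts v (\<omega> t ^ (l - 1)) a \<and> acts v (\<zeta> ^ t) a" by blast
qed

lemma \<alpha>_frob: "\<alpha> j ^ l \<sim>\<^sub>l \<alpha> (Suc j)"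
proof -
  have "\<alpha> j ^ l \<sim>\<^sub>l (\<Sum>t<n. (\<zeta> ^ (j * t) * \<omega> t) ^ l)"
    unfolding \<alpha>_def
    by (intro frobenius_int_cong_sum l algebraic_int_times algebraic_int_power \<zeta>_int \<omega>_int)
  also have "\<dots> \<sim>\<^sub>l (\<Sum>t<n. \<zeta> ^ (Suc j * t) * \<omega> t)"
  proof (rule int_cong_sum)
    fix t
    \<comment> \<open>Since \<open>l\<close> is 1 modulo \<open>n\<close>, the power
      \<open>l\<close> fixes the n-th roots of unity.\<close>
    have "(\<zeta> ^ (j * t)) ^ l = \<zeta> ^ (j * t)"
      unfolding power_mult[symmetric]
      by (rule \<zeta>_cong) (use cong_mult[OF cong_refl l_cong, of "j * t"] in simp)
    moreover have "\<omega> t ^ l = \<omega> t * \<omega> t ^ (l - 1)" using l_gt_1 by (simp flip: power_Suc)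
    ultimately have "(\<zeta> ^ (j * t) * \<omega> t) ^ l = (\<zeta> ^ (j * t) * \<omega> t) * \<omega> t ^ (l - 1)"
      by (simp only: power_mult_distrib mult.assoc)
    also have "\<dots> \<sim>\<^sub>l (\<zeta> ^ (j * t) * \<omega> t) * \<zeta> ^ t"
      by (intro int_cong_mult_left \<omega>_frob algebraic_int_times algebraic_int_power \<zeta>_int \<omega>_int)
    also have "(\<zeta> ^ (j * t) * \<omega> t) * \<zeta> ^ t = \<zeta> ^ (Suc j * t) * \<omega> t"
      by (simp add: power_add mult_ac)
    finally show "(\<zeta> ^ (j * t) * \<omega> t) ^ l \<sim>\<^sub>l \<zeta> ^ (Suc j * t) * \<omega> t" .
  qed
  finally show ?thesis by (simp only: \<alpha>_def)
qed

end

section \<open>Choice of the parameters and conclusion\<close>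

lemma ord_power_cong_1_iff:
  fixes l g :: nat
  assumes "ord l g = q * k" "q > 0"
  shows "[(g ^ q) ^ j = 1] (mod l) \<longleftrightarrow> k dvd j"
  unfolding power_mult[symmetric] ord_divides assms(1) using assms(2) by simp

lemma exists_kummer_data:
  assumes n: "n > 0"
  obtains l g c z and y :: int where "kummer_data n l g c z" "[y\<^sup>2 = -1] (mod int l)"
proof -
  obtain l :: nat where l: "prime l" and l4n: "[l = 1] (mod (4 * n))"
    using exists_prime_cong_1[of "4 * n"] n by auto
  have l1: "l > 1" using l prime_gt_1_nat by blast
  have dvd4n: "4 * n dvd l - 1" using l4n l1 cong_altdef_nat[of 1 l "4 * n"] by (simp add: cong_sym_eq)
  obtain g where "residue_primroot l g" using prime_primitive_root_exists[OF l1 l] by blast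
  then have g: "coprime l g" and ord: "ord l g = l - 1"
    using l by (auto simp: residue_primroot_def totient_prime)
  have n_dvd: "n dvd l - 1" and four_dvd: "4 dvd l - 1"
    using dvd4n by (rule dvd_mult_right, rule dvd_mult_left)
  from n_dvd obtain q where q: "l - 1 = n * q" by (rule dvdE)
  from four_dvd obtain r where r: "l - 1 = 4 * r" by (rule dvdE)
  have qr: "q > 0" "r > 0" using q r l1 by (auto intro: gr0I)
  define z where "z = g ^ q"
  have z_order: "[z ^ k = 1] (mod l) \<longleftrightarrow> n dvd k" for k
    unfolding z_def
    by (rule ord_power_cong_1_iff[OF _ qr(1)]) (simp only: ord q mult.commute)
  have cong_n: "[l = 1] (mod n)" using l4n by (rule cong_dvd_modulus_nat) simp
  have "coprime n l"
  proof -
    have "n \<le> l - 1" using n_dvd l1 by (intro dvd_imp_le) auto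
    then have "\<not> l dvd n" using n l1 by (auto dest!: dvd_imp_le)
    then have "coprime l n" by (rule prime_imp_coprime[OF l])
    then show ?thesis by (simp add: coprime_commute)
  qed
  from cong_solve_coprime_nat[OF this] obtain e where e: "[n * e = 1] (mod l)" by auto
  \<comment> \<open>\<open>e\<close> inverts \<open>n\<close> modulo \<open>l\<close>, and
    \<open>g + (l - 1)\<close> is \<open>g - 1\<close> modulo \<open>l\<close> without
    subtraction.\<close>
  define c where "c = e * (g + (l - 1))"
  have "[1 + n * e * (g + (l - 1)) = 1 + 1 * (g + (l - 1))] (mod l)"
    by (intro cong_add cong_mult cong_refl e)
  also have "1 + 1 * (g + (l - 1)) = g + l" using l1 by simp
  also have "[g + l = g] (mod l)" by (simp add: cong_def)
  finally have c: "[1 + c * n = g] (mod l)" by (simp add: c_def mult_ac)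
  have kd: "kummer_data n l g c z"
  proof
    show "z = g ^ ((l - 1) div n)" unfolding q using n by (simp add: z_def)
    show "coprime g l" using g by (simp add: coprime_commute)
  qed (fact n l cong_n z_order c)+
  \<comment> \<open>An element of order 4 modulo \<open>l\<close>; its square has order 2, so it is
    -1.\<close>
  define h where "h = g ^ r"
  have h_order: "[h ^ k = 1] (mod l) \<longleftrightarrow> 4 dvd k" for k
    unfolding h_def
    by (rule ord_power_cong_1_iff[OF _ qr(2)]) (simp only: ord r mult.commute)
  have h2: "\<not> [h ^ 2 = 1] (mod l)" using h_order[of 2] by simp
  have h4: "[h ^ 4 = 1] (mod l)" using h_order[of 4] by simp
  have "int l dvd int (h ^ 4) - int 1"
    using h4 by (simp only: cong_int_iff[symmetric] cong_iff_dvd_diff)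
  also have "int (h ^ 4) - int 1 = (int (h ^ 2) - int 1) * ((int h)\<^sup>2 + 1)"
    by (simp add: algebra_simps power2_eq_square power4_eq_xxxx)
  finally have "int l dvd int (h ^ 2) - int 1 \<or> int l dvd (int h)\<^sup>2 + 1"
    using l by (simp add: prime_dvd_mult_iff)
  moreover have "\<not> int l dvd int (h ^ 2) - int 1"
    using h2 by (simp only: cong_int_iff[symmetric] cong_iff_dvd_diff not_False_eq_True)
  ultimately have "[(int h)\<^sup>2 = -1] (mod int l)" by (simp add: cong_iff_dvd_diff)
  then show ?thesis using that kd by blast
qed

lemma exists_suitable_data:
  assumes "U > 0" "nt > 0"
  shows "\<exists>K L p \<sigma>. suitable_data U nt K L p \<sigma>"
proof -
  define n where "n = U * nt"
  have n: "n > 0" using assms by (simp add: n_def)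
  obtain l g c z and y :: int where kd: "kummer_data n l g c z" and y: "[y\<^sup>2 = -1] (mod int l)"
    using exists_kummer_data[OF n] by metis
  interpret kummer_data n l g c z by (rule kd)
  obtain d :: int where d: "of_int d = of_nat n ^ 2 * N" "coprime d (int l)"
    by (rule dual_const)
  have dual: "(\<Sum>k<n. \<alpha> (i + k) * \<alpha>' (j + k)) = (if i = j then of_int d else 0)"
    if "i < n" "j < n" for i j
    unfolding d(1) by (rule \<alpha>_dual[OF that])
  show ?thesis
  proof (rule split_gauss_prime[OF l y])
    fix p
    assume p: "p \<in> gauss_int" "p \<noteq> 0" "\<And>x. x \<in> gauss_int \<Longrightarrow> p * x \<noteq> 1"
      "\<exists>k\<in>gauss_int. k \<noteq> 0 \<and> of_nat l = p * k"
      "\<And>u v. u \<in> gauss_int \<Longrightarrow> v \<in> gauss_int \<Longrightarrow> \<exists>x\<in>gauss_int. u * v = p * x \<Longrightarrow>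
          (\<exists>x\<in>gauss_int. u = p * x) \<or> (\<exists>x\<in>gauss_int. v = p * x)"
      "\<And>u. u \<in> gauss_int \<Longrightarrow> \<exists>x\<in>gauss_int. u ^ l - u = p * x"
    have "frobenius_basis n l p d \<alpha> \<alpha>' coef"
      by (rule frobenius_basis.intro[OF n l p d(2) \<alpha>_int \<alpha>'_int \<alpha>_real \<alpha>_period coef_rat
            \<alpha>_mult \<alpha>_total dual \<alpha>_frob])
    from frobenius_basis.suitable_data_L[OF this n_def] show ?thesis by (intro exI)
  qed
qed

theorem theorem4p4:
  fixes U nt :: nat
  assumes "U > 0" and "nt > 0"
  shows "code_family U nt \<noteq> {}"
proof -
  from exists_suitable_data[OF assms] obtain K L p \<sigma>
    where sd: "suitable_data U nt K L p \<sigma>"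
    by (elim exE) (rule that)
  from ex_less_of_int[of "real U * (real nt - 1) / 2"]
  obtain k :: int where k: "real_of_int k > real U * (real nt - 1) / 2"
    by (elim exE) (rule that)
  have "code U nt L p \<sigma> k \<in> code_family U nt"
    unfolding code_family_def by (rule CollectI, intro exI conjI) (rule refl, rule sd, rule k)
  then show ?thesis by blast
qed

end
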